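(* Let $M$ be a Riemannian manifold, let $\mu$ be a Borel probability measure on $M$, absolutely continuous with respect to the volume measure, and let $\beta:(0,1/4)\to[0,+\infty)$ be a non-increasing function. Assume that for every locally Lipschitz $f:M\to\mathbb{R}$ and every $s\in(0,1/4)$ one has $$\mathbf{Var}_\mu(f)\le\beta(s)\int|\nabla f|^2\,d\mu+s\,\mathbf{Osc}(f)^2 .$$ Let $n\ge1$ be an integer. Then for every locally Lipschitz $f:M^n\to\mathbb{R}$ and every $s\in(0,1/4)$ one has $$\mathbf{Var}_{\mu^n}(f)\le\beta\Big(\frac sn\Big)\int|\nabla f|^2\,d\mu^n+s\,\mathbf{Osc}(f)^2 .$$
   Context: For a locally Lipschitz function $f$ on a Riemannian manifold, $|\nabla f|(x)=\limsup_{y\to x}\frac{|f(x)-f(y)|}{d(x,y)}$, where $d$ is the geodesic distance. $\mathbf{Var}_\mu(f)$ is the variance of $f$ under $\mu$, and $\mathbf{Osc}(f)=\sup f-\inf f\in[0,+\infty]$ (the inequalities are trivial if $\mathbf{Osc}(f)=+\infty$). $M^n$ carries the product Riemannian metric and $\mu^n$ is the $n$-fold product measure. *)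

theory Defs
  imports "HOL-Probability.Probability"
begin

text \<open>Intended for open subsets of Euclidean spaces, where these are the usual \<open>C\<^sup>k\<close> and smooth maps.\<close>

primrec Ck_on :: "nat \<Rightarrow> 'v::real_normed_vector set \<Rightarrow> ('v \<Rightarrow> 'w::real_normed_vector) \<Rightarrow> bool" where
  "Ck_on 0 S f \<longleftrightarrow> continuous_on S f"
| "Ck_on (Suc k) S f \<longleftrightarrow>
     (\<forall>x\<in>S. f differentiable (at x)) \<and> (\<forall>v. Ck_on k S (\<lambda>x. frechet_derivative f (at x) v))"

definition smooth_on :: "'v::real_normed_vector set \<Rightarrow> ('v \<Rightarrow> 'w::real_normed_vector) \<Rightarrow> bool" where
  "smooth_on S f \<longleftrightarrow> (\<forall>k. Ck_on k S f)"

text \<open>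
  A Riemannian manifold is carried by a whole type \<^typ>\<open>'a\<close> with its type-class topology and is
  modelled on the Euclidean space \<^typ>\<open>'e\<close>. It is given by an atlas, whose charts are named by the
  elements of \<open>charts\<close>, and by the coordinate expressions of the metric tensor:
  \<open>metric M c p u v\<close> is the inner product at the point \<open>p\<close> of the two tangent vectors whose
  coordinates in the chart \<open>c\<close> are \<open>u\<close> and \<open>v\<close>. Charts carry names, rather than being pairs of a
  domain and a map, so that a chart of a power can simply be named by the family of its factors.
\<close>

record ('i, 'a, 'e) riemannian =
  charts :: "'i set"
  chart_dom :: "'i \<Rightarrow> 'a set"
  coord :: "'i \<Rightarrow> 'a \<Rightarrow> 'e"
  metric :: "'i \<Rightarrow> 'a \<Rightarrow> 'e \<Rightarrow> 'e \<Rightarrow> real"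

definition chart_im :: "('i, 'a, 'e) riemannian \<Rightarrow> 'i \<Rightarrow> 'e set" where
  "chart_im M c = coord M c ` chart_dom M c"

definition param :: "('i, 'a, 'e) riemannian \<Rightarrow> 'i \<Rightarrow> 'e \<Rightarrow> 'a" where
  "param M c = inv_into (chart_dom M c) (coord M c)"

definition transition :: "('i, 'a, 'e) riemannian \<Rightarrow> 'i \<Rightarrow> 'i \<Rightarrow> 'e \<Rightarrow> 'e" where
  "transition M c d = coord M d \<circ> param M c"

definition smooth_atlas ::
  "('i, 'a::{second_countable_topology, t2_space}, 'e::euclidean_space) riemannian \<Rightarrow> bool" where
  "smooth_atlas M \<longleftrightarrow>
     (\<Union>c\<in>charts M. chart_dom M c) = UNIV \<and>
     (\<forall>c\<in>charts M. open (chart_dom M c) \<and> open (chart_im M c) \<and>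
        homeomorphism (chart_dom M c) (chart_im M c) (coord M c) (param M c)) \<and>
     (\<forall>c\<in>charts M. \<forall>d\<in>charts M.
        smooth_on (coord M c ` (chart_dom M c \<inter> chart_dom M d)) (transition M c d))"

definition riemannian_metric ::
  "('i, 'a::{second_countable_topology, t2_space}, 'e::euclidean_space) riemannian \<Rightarrow> bool" where
  "riemannian_metric M \<longleftrightarrow>
     (\<forall>c\<in>charts M. \<forall>p\<in>chart_dom M c.
        bilinear (metric M c p) \<and>
        (\<forall>u v. metric M c p u v = metric M c p v u) \<and>
        (\<forall>v. v \<noteq> 0 \<longrightarrow> metric M c p v v > 0)) \<and>
     (\<forall>c\<in>charts M. \<forall>u v. smooth_on (chart_im M c) (\<lambda>x. metric M c (param M c x) u v)) \<and>
     (\<forall>c\<in>charts M. \<forall>d\<in>charts M. \<forall>p\<in>chart_dom M c \<inter> chart_dom M d. \<forall>u v.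
        metric M c p u v =
          (let D = frechet_derivative (transition M c d) (at (coord M c p))
           in metric M d p (D u) (D v)))"

definition riemannian_manifold ::
  "('i, 'a::{second_countable_topology, t2_space}, 'e::euclidean_space) riemannian \<Rightarrow> bool" where
  "riemannian_manifold M \<longleftrightarrow> smooth_atlas M \<and> riemannian_metric M"

text \<open>
  As for the library's \<^const>\<open>piecewise_C1_differentiable_on\<close>, the derivative need not stay bounded
  near the finitely many break points; the length, taken in \<open>[0, \<infinity>]\<close>, is still that of the curve,
  so the infimum defining the distance is the one over curves with one-sided derivatives.
\<close>

definition piecewise_C1_curve ::
  "('i, 'a::topological_space, 'e::real_normed_vector) riemannian \<Rightarrow> (real \<Rightarrow> 'a) \<Rightarrow> bool" where
  "piecewise_C1_curve M \<gamma> \<longleftrightarrow>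
     path \<gamma> \<and>
     (\<exists>S. finite S \<and>
        (\<forall>c\<in>charts M. (coord M c \<circ> \<gamma>) C1_differentiable_on
           {t \<in> {0<..<1} - S. \<gamma> t \<in> chart_dom M c}))"

text \<open>By the transformation law of the metric, the speed does not depend on the chart chosen.\<close>

definition speed ::
  "('i, 'a, 'e::real_normed_vector) riemannian \<Rightarrow> (real \<Rightarrow> 'a) \<Rightarrow> real \<Rightarrow> real" where
  "speed M \<gamma> t =
     (let c = (SOME c. c \<in> charts M \<and> \<gamma> t \<in> chart_dom M c);
          v = vector_derivative (coord M c \<circ> \<gamma>) (at t)
      in sqrt (metric M c (\<gamma> t) v v))"

definition curve_length ::
  "('i, 'a, 'e::real_normed_vector) riemannian \<Rightarrow> (real \<Rightarrow> 'a) \<Rightarrow> ennreal" where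
  "curve_length M \<gamma> = (\<integral>\<^sup>+t\<in>{0..1}. ennreal (speed M \<gamma> t) \<partial>lborel)"

text \<open>The distance is \<open>\<infinity>\<close> between different connected components.\<close>

definition geodesic_dist ::
  "('i, 'a::topological_space, 'e::real_normed_vector) riemannian \<Rightarrow> 'a \<Rightarrow> 'a \<Rightarrow> ennreal" where
  "geodesic_dist M p q =
     (INF \<gamma>\<in>{\<gamma>. piecewise_C1_curve M \<gamma> \<and> pathstart \<gamma> = p \<and> pathfinish \<gamma> = q}. curve_length M \<gamma>)"

definition locally_lipschitz ::
  "('i, 'a::topological_space, 'e::real_normed_vector) riemannian \<Rightarrow> ('a \<Rightarrow> real) \<Rightarrow> bool" where
  "locally_lipschitz M f \<longleftrightarrow>
     (\<forall>x. \<exists>U L. open U \<and> x \<in> U \<and>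
        (\<forall>y\<in>U. \<forall>z\<in>U. ennreal \<bar>f y - f z\<bar> \<le> ennreal L * geodesic_dist M y z))"

definition grad_norm ::
  "('i, 'a::topological_space, 'e::real_normed_vector) riemannian \<Rightarrow> ('a \<Rightarrow> real) \<Rightarrow> 'a \<Rightarrow> ennreal" where
  "grad_norm M f x = Limsup (at x) (\<lambda>y. ennreal \<bar>f x - f y\<bar> / geodesic_dist M x y)"

text \<open>
  The volume measure is \<open>sqrt (det g) dx\<close> in each chart. These measures, extended by zero outside
  the chart domains, agree on the overlaps of charts, so that their supremum (the least measure
  above all of them) glues them together.
\<close>

definition volume_density :: "('i, 'a, real^'m) riemannian \<Rightarrow> 'i \<Rightarrow> 'a \<Rightarrow> real" where
  "volume_density M c p = sqrt (det (\<chi> j k. metric M c p (axis j 1) (axis k 1)))"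

definition chart_volume ::
  "('i, 'a::topological_space, real^'m) riemannian \<Rightarrow> 'i \<Rightarrow> 'a measure" where
  "chart_volume M c =
     distr (density (restrict_space lborel (chart_im M c))
              (\<lambda>x. ennreal (volume_density M c (param M c x))))
       borel (param M c)"

definition riemannian_volume ::
  "('i, 'a::topological_space, real^'m) riemannian \<Rightarrow> 'a measure" where
  "riemannian_volume M = (SUP c\<in>charts M. chart_volume M c)"

text \<open>
  The \<open>n\<close>-th power with its product metric; points are functions from an index type \<^typ>\<open>'n\<close> with
  \<open>n\<close> elements, and the topology on functions is the product topology.
\<close>

definition riemannian_power ::
  "('i, 'a, 'e::real_normed_vector) riemannian \<Rightarrow> ('n::finite \<Rightarrow> 'i, 'n \<Rightarrow> 'a, 'e^'n) riemannian" where
  "riemannian_power M =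
     \<lparr> charts = {c. \<forall>k. c k \<in> charts M},
       chart_dom = (\<lambda>c. {p. \<forall>k. p k \<in> chart_dom M (c k)}),
       coord = (\<lambda>c p. \<chi> k. coord M (c k) (p k)),
       metric = (\<lambda>c p u v. \<Sum>k\<in>UNIV. metric M (c k) (p k) (u $ k) (v $ k)) \<rparr>"

text \<open>
  The variance takes its value in \<open>[0, \<infinity>]\<close>. For \<open>\<mu>\<close> a probability measure and \<open>f\<close> measurable but not
  integrable, the inner integral is \<open>0\<close> by convention and the value is \<open>\<infinity>\<close>, as it should be.
\<close>

definition Var :: "'a measure \<Rightarrow> ('a \<Rightarrow> real) \<Rightarrow> ennreal" where
  "Var \<mu> f = (\<integral>\<^sup>+x. ennreal ((f x - (\<integral>y. f y \<partial>\<mu>))\<^sup>2) \<partial>\<mu>)"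

definition Osc :: "('a \<Rightarrow> real) \<Rightarrow> ennreal" where
  "Osc f = e2ennreal ((SUP x. ereal (f x)) - (INF x. ereal (f x)))"

end

theory Submission
  imports Defs
begin

text \<open>
  The Efron--Stein inequality bounds the variance under \<open>\<mu>\<^sup>n\<close> by the sum over \<open>k\<close> of the averaged
  variances in the \<open>k\<close>-th variable. Each of these is bounded by the hypothesis with \<open>s / n\<close> in place of \<open>s\<close>,
  as a slice of \<open>f\<close> is locally Lipschitz and oscillates no more than \<open>f\<close>. It remains to see that
  \<open>|\<nabla>f|\<^sup>2\<close> dominates the sum of the squared partial gradients almost everywhere. This fails at points such as
  the diagonal for \<open>f(x, y) = max x y\<close>, but holds wherever \<open>f\<close> is differentiable in product charts: there the
  partial slopes are the dual norms of the blocks of the differential, since a short curve is not much shorter than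
  its chord, and the full slope is attained along a straight coordinate segment. By Rademacher's theorem
  these points have full measure in each chart, and \<open>\<mu>\<^sup>n\<close> is absolutely continuous with respect to Lebesgue
  measure there.

  Rademacher's theorem is obtained from the one-dimensional case (where the upper right Dini derivative integrates to at
  most the increment), by translation invariance for single directions, and by testing against indicators of
  boxes for the additivity in the direction.
\<close>

section \<open>Right derivatives of Lipschitz functions on the line\<close>

text \<open>The Pythagorean sum of the partial slopes comes from representing vectors. In the metric
  \<open>B\<close> of its factor, a block of the differential is \<open>B w\<close> for some vector
  \<open>w\<close>, its squared dual norm is \<open>B w w\<close>, and the vector made up of all
  these \<open>w\<close> is the direction of steepest growth in the power. Distances are needed in
  opposite ways: for a partial slope all curves in \<open>M\<close> must be shown to be long, for
  the full slope a single curve in the power must be short. Each estimate loses only a factor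
  tending to 1.

  The second obstacle is measurability. The slope \<open>grad_norm\<close> is not shown to be
  measurable, and \<open>nn_integral\<close> is additive only on measurable functions, so sums and
  iterated integrals are formed with Borel substitutes only. To be Borel these are built from
  countable operations: limits along a fixed sequence and suprema over a countable dense set of
  directions.

  Infinite oscillation makes the right-hand side infinite, so only bounded \<open>f\<close> matters.
  The integrals in the variance argument are then finite and can be subtracted from each
  other.\<close>

lemma mono_if_right_growth:
  fixes \<psi> :: "real \<Rightarrow> real"
  assumes "continuous_on {a..b} \<psi>" "a \<le> b"
    and step: "\<And>x. a \<le> x \<Longrightarrow> x < b \<Longrightarrow> \<exists>y. x < y \<and> y \<le> b \<and> \<psi> x \<le> \<psi> y"
  shows "\<psi> a \<le> \<psi> b"
proof -
  \<comment> \<open>The last point of \<open>S\<close> must be \<open>b\<close>: from an earlier one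
    the growth step leads to a later point of \<open>S\<close>.\<close>
  define S where "S = {x\<in>{a..b}. \<psi> a \<le> \<psi> x}"
  have "closed S"
    unfolding S_def using assms(1) by (intro continuous_on_closed_Collect_le continuous_intros) auto
  moreover have "bounded S"
    by (rule bounded_subset[of "{a..b}"]) (auto simp: S_def)
  ultimately have "compact S"
    by (simp add: compact_eq_bounded_closed)
  moreover have "a \<in> S"
    using \<open>a \<le> b\<close> by (auto simp: S_def)
  ultimately obtain c where c: "c \<in> S" "\<And>x. x \<in> S \<Longrightarrow> x \<le> c"
    using compact_attains_sup[of S] by blast
  show ?thesis
  proof (cases "c < b")
    case True
    then obtain y where "c < y" "y \<le> b" "\<psi> c \<le> \<psi> y"
      using step[of c] c(1) by (auto simp: S_def)
    then have "y \<in> S"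
      using c(1) by (auto simp: S_def)
    then show ?thesis using c(2) \<open>c < y\<close> by force
  next
    case False
    then show ?thesis using c(1) by (auto simp: S_def)
  qed
qed

text \<open>The upper right Dini derivative. Increments are rational so that the supremum is
  countable and measurability is immediate; for continuous \<open>\<phi>\<close> nothing is lost, as
  \<open>dini_eventually\<close> shows for all real increments.\<close>

definition dini :: "(real \<Rightarrow> real) \<Rightarrow> real \<Rightarrow> real" where
  "dini \<phi> x = (INF n::nat. SUP h\<in>{0<..<1 / Suc n} \<inter> \<rat>. (\<phi> (x + h) - \<phi> x) / h)"

lemma Rats_greaterThanLessThan_nonempty:
  "a < b \<Longrightarrow> {a<..<b::real} \<inter> \<rat> \<noteq> {}"
  using Rats_dense_in_real[of a b] by auto

lemma lipschitz_quotient_le: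
  fixes \<phi> :: "real \<Rightarrow> real"
  assumes "L-lipschitz_on UNIV \<phi>" "h \<noteq> 0"
  shows "\<bar>(\<phi> (x + h) - \<phi> x) / h\<bar> \<le> L"
proof -
  have "\<bar>\<phi> (x + h) - \<phi> x\<bar> \<le> L * \<bar>h\<bar>"
    using lipschitz_onD[OF assms(1), of "x + h" x] by (simp add: dist_real_def)
  then show ?thesis using assms(2) by (simp add: divide_simps)
qed

context
  fixes \<phi> :: "real \<Rightarrow> real" and L :: real
  assumes lip: "L-lipschitz_on UNIV \<phi>"
begin

text \<open>Suprema and infima in the reals mean something only for bounded nonempty sets. The
  Lipschitz constant bounds all quotients, and this bound accompanies every use of
  \<open>dini\<close>.\<close>

lemma dini_bdd_above:
  "0 \<notin> H \<Longrightarrow> bdd_above ((\<lambda>h. (\<phi> (x + h) - \<phi> x) / h) ` H)"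
  by (rule bdd_aboveI2[of _ _ L]) (metis abs_le_D1 lip lipschitz_quotient_le)

lemma dini_sup_bounds:
  "\<bar>SUP h\<in>{0<..<1 / real (Suc n)} \<inter> \<rat>. (\<phi> (x + h) - \<phi> x) / h\<bar> \<le> L"
proof -
  have ne: "{0<..<1 / real (Suc n)} \<inter> \<rat> \<noteq> {}"
    by (rule Rats_greaterThanLessThan_nonempty) simp
  then obtain h where h: "h \<in> {0<..<1 / real (Suc n)} \<inter> \<rat>" by blast
  have "-L \<le> (\<phi> (x + h) - \<phi> x) / h"
    using lipschitz_quotient_le[OF lip, of h x] h by (simp only: abs_le_iff) auto
  also have "\<dots> \<le> (SUP h\<in>{0<..<1 / real (Suc n)} \<inter> \<rat>. (\<phi> (x + h) - \<phi> x) / h)"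
    by (rule cSUP_upper[OF h dini_bdd_above]) auto
  finally have 1: "-L \<le> \<dots>" .
  have 2: "(SUP h\<in>{0<..<1 / real (Suc n)} \<inter> \<rat>. (\<phi> (x + h) - \<phi> x) / h) \<le> L"
    using ne by (rule cSUP_least) (auto intro!: order_trans[OF abs_ge_self lipschitz_quotient_le[OF lip]])
  show ?thesis using 1 2 by linarith
qed

lemma dini_bdd_below:
  "bdd_below (range (\<lambda>n. SUP h\<in>{0<..<1 / real (Suc n)} \<inter> \<rat>. (\<phi> (x + h) - \<phi> x) / h))"
  by (rule bdd_belowI2[of _ "-L"]) (use dini_sup_bounds in \<open>auto simp: abs_le_iff minus_le_iff\<close>)

lemma dini_bounds: "\<bar>dini \<phi> x\<bar> \<le> L"
proof -
  have "-L \<le> dini \<phi> x"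
    unfolding dini_def by (rule cINF_greatest) (use dini_sup_bounds in \<open>auto simp: abs_le_iff minus_le_iff\<close>)
  moreover have "dini \<phi> x \<le> L"
    unfolding dini_def
    by (rule cINF_lower2[OF dini_bdd_below, of 0]) (use dini_sup_bounds[of x 0] in \<open>auto simp: abs_le_iff\<close>)
  ultimately show ?thesis by linarith
qed

lemma dini_frequently:
  assumes "r < dini \<phi> x" "0 < \<delta>"
  obtains h where "0 < h" "h < \<delta>" "r < (\<phi> (x + h) - \<phi> x) / h"
proof -
  obtain n where n: "1 / real (Suc n) < \<delta>"
    using nat_approx_posE[OF \<open>0 < \<delta>\<close>] by blast
  have "dini \<phi> x \<le> (SUP h\<in>{0<..<1 / real (Suc n)} \<inter> \<rat>. (\<phi> (x + h) - \<phi> x) / h)"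
    unfolding dini_def by (rule cINF_lower[OF dini_bdd_below]) auto
  with assms(1) have "r < (SUP h\<in>{0<..<1 / real (Suc n)} \<inter> \<rat>. (\<phi> (x + h) - \<phi> x) / h)"
    by simp
  then obtain h where "h \<in> {0<..<1 / real (Suc n)} \<inter> \<rat>" "r < (\<phi> (x + h) - \<phi> x) / h"
    by (subst (asm) less_cSUP_iff) (auto intro!: dini_bdd_above Rats_greaterThanLessThan_nonempty)
  then show thesis using n that by auto
qed

lemma continuous_quotient: "continuous_on {0<..} (\<lambda>h. (\<phi> (x + h) - \<phi> x) / h)"
proof -
  have "continuous_on UNIV \<phi>"
    using lip by (rule lipschitz_on_continuous_on)
  then have "continuous_on {0<..} (\<lambda>h. \<phi> (x + h))"
    by (rule continuous_on_compose2) (auto intro!: continuous_intros)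
  then show ?thesis by (intro continuous_intros) auto
qed

text \<open>For rational increments this is the definition of \<open>dini\<close>. The quotient is
  continuous in \<open>h > 0\<close>, so a real increment violating the bound would have a rational
  one next to it that violates it too.\<close>

lemma dini_eventually:
  assumes "dini \<phi> x < r"
  shows "\<forall>\<^sub>F h in at_right 0. (\<phi> (x + h) - \<phi> x) / h \<le> r"
proof -
  let ?q = "\<lambda>h. (\<phi> (x + h) - \<phi> x) / h"
  obtain n where n: "(SUP h\<in>{0<..<1 / real (Suc n)} \<inter> \<rat>. ?q h) < r"
    using assms cINF_less_iff[OF _ dini_bdd_below, of x r] unfolding dini_def by auto
  have "?q h \<le> r" if h: "0 < h" "h < 1 / real (Suc n)" for h
  proof (rule ccontr)
    assume "\<not> ?q h \<le> r"
    then have gt: "r < ?q h" by simp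
    have "open ({0<..} \<inter> ?q -` {r<..})"
      by (rule continuous_open_preimage[OF continuous_quotient]) auto
    moreover have "{0<..} \<inter> ?q -` {r<..} = {h \<in> {0<..}. r < ?q h}"
      by auto
    ultimately have "open ({h \<in> {0<..}. r < ?q h} \<inter> {..<1 / real (Suc n)})"
      by (intro open_Int) auto
    moreover have "h \<in> {h \<in> {0<..}. r < ?q h} \<inter> {..<1 / real (Suc n)}"
      using h gt by auto
    ultimately obtain e where "e > 0" and e: "ball h e \<subseteq> {h \<in> {0<..}. r < ?q h} \<inter> {..<1 / real (Suc n)}"
      using open_contains_ball by blast
    obtain k where "k \<in> \<rat>" "h < k" "k < h + e"
      using Rats_dense_in_real[of h "h + e"] \<open>e > 0\<close> by auto
    then have "k \<in> ball h e" by (auto simp: dist_real_def)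
    with e have k: "0 < k" "r < ?q k" "k < 1 / real (Suc n)" by auto
    have "?q k \<le> (SUP h\<in>{0<..<1 / real (Suc n)} \<inter> \<rat>. ?q h)"
      by (rule cSUP_upper[OF _ dini_bdd_above]) (use k \<open>k \<in> \<rat>\<close> in auto)
    with n k show False by simp
  qed
  then show ?thesis
    unfolding eventually_at_right_field by (intro exI[of _ "1 / real (Suc n)"]) auto
qed

end

lemma lipschitz_on_uminus_real: "L-lipschitz_on UNIV \<phi> \<Longrightarrow> L-lipschitz_on UNIV (\<lambda>x. - \<phi> x :: real)"
  by simp

text \<open>\<open>dini\<close> of \<open>- \<phi>\<close> is the negative of the lower right Dini
  derivative of \<open>\<phi>\<close>, so the sum is the gap between the upper and the lower one.
  Where the gap closes, the right derivative exists (\<open>dini_eq_imp_derivative\<close>).\<close>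

lemma dini_add_uminus_nonneg:
  assumes lip: "L-lipschitz_on UNIV \<phi>"
  shows "0 \<le> dini \<phi> x + dini (\<lambda>x. - \<phi> x) x"
proof (rule ccontr)
  assume "\<not> ?thesis"
  then obtain r where r: "dini \<phi> x < r" "r < - dini (\<lambda>x. - \<phi> x) x"
    using dense[of "dini \<phi> x" "- dini (\<lambda>x. - \<phi> x) x"] by auto
  obtain r' where r': "r < r'" "r' < - dini (\<lambda>x. - \<phi> x) x"
    using dense[OF r(2)] by auto
  have "\<forall>\<^sub>F h in at_right 0. (\<phi> (x + h) - \<phi> x) / h \<le> r"
    by (rule dini_eventually[OF lip r(1)])
  moreover have "\<forall>\<^sub>F h in at_right 0. (- \<phi> (x + h) - - \<phi> x) / h \<le> - r'"
    by (rule dini_eventually[OF lipschitz_on_uminus_real[OF lip]]) (use r' in auto)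
  ultimately have "\<forall>\<^sub>F h::real in at_right 0. False"
  proof eventually_elim
    case (elim h)
    have "(- \<phi> (x + h) - - \<phi> x) / h = - ((\<phi> (x + h) - \<phi> x) / h)"
      by (simp add: divide_simps)
    with elim r' show ?case by simp
  qed
  then show False by (simp add: eventually_False trivial_limit_at_right_real)
qed

lemma dini_eq_imp_derivative:
  assumes lip: "L-lipschitz_on UNIV \<phi>" and eq: "dini \<phi> x + dini (\<lambda>x. - \<phi> x) x = 0"
  shows "((\<lambda>h. (\<phi> (x + h) - \<phi> x) / h) \<longlongrightarrow> dini \<phi> x) (at_right 0)"
proof (rule order_tendstoI)
  fix a assume "a < dini \<phi> x"
  then obtain b where b: "a < b" "b < dini \<phi> x" using dense by blast
  have "\<forall>\<^sub>F h in at_right 0. (- \<phi> (x + h) - - \<phi> x) / h \<le> - b"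
    by (rule dini_eventually[OF lipschitz_on_uminus_real[OF lip]]) (use eq b in auto)
  then show "\<forall>\<^sub>F h in at_right 0. a < (\<phi> (x + h) - \<phi> x) / h"
  proof eventually_elim
    case (elim h)
    have "(- \<phi> (x + h) - - \<phi> x) / h = - ((\<phi> (x + h) - \<phi> x) / h)"
      by (simp add: divide_simps)
    with elim b show ?case by simp
  qed
next
  fix a assume "dini \<phi> x < a"
  then obtain b where b: "dini \<phi> x < b" "b < a" using dense by blast
  show "\<forall>\<^sub>F h in at_right 0. (\<phi> (x + h) - \<phi> x) / h < a"
    using dini_eventually[OF lip b(1)] by eventually_elim (use b in auto)
qed

lemma dini_measurable:
  assumes lip: "L-lipschitz_on UNIV \<phi>"
  shows "dini \<phi> \<in> borel_measurable borel"
proof -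
  have [measurable]: "\<phi> \<in> borel_measurable borel"
    by (intro borel_measurable_continuous_onI lipschitz_on_continuous_on[OF lip])
  show ?thesis
    unfolding dini_def[abs_def]
    by (intro borel_measurable_cINF borel_measurable_cSUP dini_bdd_above[OF lip] dini_bdd_below[OF lip])
      (auto intro: countable_Int2 countable_rat)
qed

section \<open>The integral of the Dini derivative is at most the increment\<close>

lemma measure_Int_atLeastAtMost_split:
  fixes K :: "real set"
  assumes "K \<in> sets borel" "a \<le> x" "x \<le> y"
  shows "measure lborel (K \<inter> {a..y}) = measure lborel (K \<inter> {a..x}) + measure lborel (K \<inter> {x<..y})"
proof -
  have "K \<inter> {a..y} = (K \<inter> {a..x}) \<union> (K \<inter> {x<..y})"
    using assms by auto
  moreover have "emeasure lborel (K \<inter> {a..x}) \<noteq> \<infinity>" "emeasure lborel (K \<inter> {x<..y}) \<noteq> \<infinity>"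
    using emeasure_mono[of "K \<inter> {a..x}" "{a..x}" lborel] emeasure_mono[of "K \<inter> {x<..y}" "{x<..y}" lborel] assms
    by (auto simp: top_unique)
  moreover have "(K \<inter> {a..x}) \<inter> (K \<inter> {x<..y}) = {}" by auto
  ultimately show ?thesis
    using measure_Union[of lborel "K \<inter> {a..x}" "K \<inter> {x<..y}"] assms by simp
qed

lemma fmeasurable_Int_atLeastAtMost:
  fixes K :: "real set"
  shows "K \<in> sets borel \<Longrightarrow> K \<inter> {a..b} \<in> fmeasurable lborel"
  by (rule fmeasurableI2[of "{a..b}"]) (auto simp: fmeasurable_def emeasure_lborel_Icc_eq)

lemma measure_Int_greaterThanAtMost_le:
  fixes K :: "real set"
  assumes "K \<in> sets borel" "x \<le> y"
  shows "measure lborel (K \<inter> {x<..y}) \<le> y - x"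
proof -
  have "measure lborel (K \<inter> {x<..y}) \<le> measure lborel {x<..y}"
    by (rule measure_mono_fmeasurable) (use assms in \<open>auto simp: fmeasurable_def\<close>)
  then show ?thesis using assms by simp
qed

text \<open>
  The layers \<open>K j\<close> play the role of an upper semicontinuous minorant of the Dini derivative
  (Vitali--Caratheodory); against its primitive, \<open>\<phi>\<close> grows to the right of every point.
\<close>

lemma layered_growth:
  fixes \<phi> :: "real \<Rightarrow> real" and K :: "nat \<Rightarrow> real set" and c :: "nat \<Rightarrow> real"
  assumes lip: "L-lipschitz_on UNIV \<phi>" and ab: "a \<le> b" and fin: "finite J"
    and closed: "\<And>j. j \<in> J \<Longrightarrow> closed (K j)" and c: "\<And>j. j \<in> J \<Longrightarrow> 0 \<le> c j"
    and le: "\<And>x. (\<Sum>j\<in>J. if x \<in> K j then c j else 0) \<le> dini \<phi> x + L"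
  shows "(\<Sum>j\<in>J. c j * measure lborel (K j \<inter> {a..b})) \<le> \<phi> b - \<phi> a + L * (b - a)"
proof -
  define U where "U x = (\<Sum>j\<in>J. c j * measure lborel (K j \<inter> {a..x}))" for x
  have Kb: "K j \<in> sets borel" if "j \<in> J" for j using closed[OF that] by simp
  have diff: "U y - U x = (\<Sum>j\<in>J. c j * measure lborel (K j \<inter> {x<..y}))" if "a \<le> x" "x \<le> y" for x y
    unfolding U_def sum_subtractf[symmetric]
    by (rule sum.cong) (simp_all add: measure_Int_atLeastAtMost_split[OF Kb that] distrib_left)
  have Ulip: "(sum c J)-lipschitz_on {a..b} U"
  proof (rule lipschitz_on_leI)
    fix x y assume xy: "x \<in> {a..b}" "y \<in> {a..b}" "x \<le> y"
    have d: "U y - U x = (\<Sum>j\<in>J. c j * measure lborel (K j \<inter> {x<..y}))" using diff xy by auto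
    have "\<dots> \<le> (\<Sum>j\<in>J. c j * (y - x))"
      by (intro sum_mono mult_left_mono measure_Int_greaterThanAtMost_le Kb c) (use xy in auto)
    moreover have "0 \<le> (\<Sum>j\<in>J. c j * measure lborel (K j \<inter> {x<..y}))"
      by (intro sum_nonneg mult_nonneg_nonneg c) auto
    ultimately show "dist (U x) (U y) \<le> sum c J * dist x y"
      using d xy by (simp add: dist_real_def sum_distrib_right)
  qed (use c in \<open>auto intro: sum_nonneg\<close>)
  \<comment> \<open>The slope \<eta> is the price for \<open>dini_frequently\<close>, which reaches
    only values strictly below the Dini derivative. It is sent to 0 at the end.\<close>
  have U: "U b - \<eta> * (b - a) \<le> \<phi> b - \<phi> a + L * (b - a)" if \<eta>: "\<eta> > 0" for \<eta>
  proof -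
    define \<psi> where "\<psi> x = \<phi> x + L * x - U x + \<eta> * x" for x
    have "\<psi> a \<le> \<psi> b"
    proof (rule mono_if_right_growth[OF _ ab])
      show "continuous_on {a..b} \<psi>"
        unfolding \<psi>_def
        by (intro continuous_intros lipschitz_on_continuous_on[OF Ulip]
            continuous_on_subset[OF lipschitz_on_continuous_on[OF lip]]) auto
    next
      fix x assume x: "a \<le> x" "x < b"
      have "\<forall>j\<in>J. \<exists>r>0. x \<notin> K j \<longrightarrow> ball x r \<inter> K j = {}"
      proof
        fix j assume "j \<in> J"
        then have "open (- K j)" using closed by auto
        then show "\<exists>r>0. x \<notin> K j \<longrightarrow> ball x r \<inter> K j = {}"
          using zero_less_one[where 'a=real] unfolding open_contains_ball by (cases "x \<in> K j") blast+
      qed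
      then obtain r where r: "\<And>j. j \<in> J \<Longrightarrow> r j > 0" "\<And>j. j \<in> J \<Longrightarrow> x \<notin> K j \<Longrightarrow> ball x (r j) \<inter> K j = {}"
        by metis
      \<comment> \<open>This is where closedness of the layers enters: within \<rho> to the right of
        \<open>x\<close> only layers that contain \<open>x\<close> are met, so \<open>U\<close>
        grows there at most at the rate given by the layer sum at \<open>x\<close>.\<close>
      define \<rho> where "\<rho> = Min (insert (b - x) (r ` J))"
      have \<rho>: "\<rho> > 0" "\<rho> \<le> b - x" "\<And>j. j \<in> J \<Longrightarrow> \<rho> \<le> r j"
        using fin r x by (auto simp: \<rho>_def)
      obtain h where h: "0 < h" "h < \<rho>" "dini \<phi> x - \<eta> < (\<phi> (x + h) - \<phi> x) / h"
        using dini_frequently[OF lip, of "dini \<phi> x - \<eta>" x \<rho>] \<rho>(1) \<eta> by auto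
      have "U (x + h) - U x = (\<Sum>j\<in>J. c j * measure lborel (K j \<inter> {x<..x + h}))"
        using diff x h by auto
      also have "\<dots> \<le> (\<Sum>j\<in>J. (if x \<in> K j then c j else 0) * h)"
      proof (rule sum_mono)
        fix j assume j: "j \<in> J"
        show "c j * measure lborel (K j \<inter> {x<..x + h}) \<le> (if x \<in> K j then c j else 0) * h"
        proof (cases "x \<in> K j")
          case True
          then show ?thesis
            using mult_left_mono[OF measure_Int_greaterThanAtMost_le[OF Kb[OF j], of x "x + h"] c[OF j]] h
            by simp
        next
          case False
          have "{x<..x + h} \<subseteq> ball x (r j)"
            using h \<rho>(3)[OF j] by (auto simp: dist_real_def)
          then have "K j \<inter> {x<..x + h} = {}" using r(2)[OF j False] by auto
          then show ?thesis using False by simp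
        qed
      qed
      also have "\<dots> \<le> (dini \<phi> x + L) * h"
        unfolding sum_distrib_right[symmetric] using le[of x] h by (intro mult_right_mono) auto
      finally have "U (x + h) - U x \<le> (dini \<phi> x + L) * h" .
      moreover have "(dini \<phi> x - \<eta>) * h < \<phi> (x + h) - \<phi> x"
        using h by (simp add: pos_less_divide_eq)
      ultimately have "\<psi> x \<le> \<psi> (x + h)"
        unfolding \<psi>_def by (simp add: algebra_simps)
      then show "\<exists>y>x. y \<le> b \<and> \<psi> x \<le> \<psi> y"
        using h \<rho>(2) by (intro exI[of _ "x + h"]) auto
    qed
    moreover have "U a = 0"
    proof -
      have "measure lborel (K j \<inter> {a..a}) = 0" for j
        by (cases "a \<in> K j") auto
      then show ?thesis by (simp add: U_def)
    qed
    ultimately show ?thesis by (simp add: \<psi>_def algebra_simps)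
  qed
  show ?thesis
  proof (cases "a = b")
    case True
    have "measure lborel (K j \<inter> {b..b}) = 0" for j
      by (cases "b \<in> K j") auto
    then show ?thesis using True by simp
  next
    case False
    with ab have "b - a > 0" by simp
    have "U b \<le> \<phi> b - \<phi> a + L * (b - a) + e" if "e > 0" for e
      using U[of "e / (b - a)"] that \<open>b - a > 0\<close> by simp
    then show ?thesis unfolding U_def by (rule field_le_epsilon)
  qed
qed

text \<open>Outer regularity of the complement: the excess \<open>U - - A\<close> is the same set as
  \<open>A - - U\<close>, the part of \<open>A\<close> that the closed set \<open>- U\<close>
  misses. Intersecting with \<open>{a..b}\<close> keeps the real-valued measures meaningful.\<close>

lemma inner_closed_lborel:
  fixes A :: "real set"
  assumes "A \<in> sets borel" "0 < (e::real)"
  obtains T where "closed T" "T \<subseteq> A" "measure lborel (A \<inter> {a..b}) - e \<le> measure lborel (T \<inter> {a..b})"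
proof -
  have "- A \<in> sets borel" using assms(1) by simp
  then obtain U where U: "open U" "- A \<subseteq> U" "emeasure lborel (U - - A) < e"
    using outer_regular_lborel[OF _ assms(2)] by blast
  have eq: "U - - A = A - (- U)" by auto
  show thesis
  proof (rule that)
    show "closed (- U)" "- U \<subseteq> A" using U by auto
    have fin: "- U \<inter> {a..b} \<in> fmeasurable lborel" "A - - U \<in> fmeasurable lborel"
    proof -
      show "- U \<inter> {a..b} \<in> fmeasurable lborel"
        by (rule fmeasurable_Int_atLeastAtMost) (use U in auto)
      show "A - - U \<in> fmeasurable lborel"
        using U assms by (auto simp only: fmeasurable_def eq sets_lborel) (auto intro: less_trans[OF _ ennreal_less_top])
    qed
    have "measure lborel (A \<inter> {a..b}) \<le> measure lborel ((- U \<inter> {a..b}) \<union> (A - - U))"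
      by (rule measure_mono_fmeasurable) (use assms fin in \<open>auto intro: fmeasurable.Un\<close>)
    also have "\<dots> \<le> measure lborel (- U \<inter> {a..b}) + measure lborel (A - - U)"
      by (rule measure_Un_le) (use U assms in auto)
    also have "measure lborel (A - - U) \<le> e"
      using U(3) assms by (simp add: eq measure_def enn2real_leI less_imp_le Int_commute)
    finally show "measure lborel (A \<inter> {a..b}) - e \<le> measure lborel (- U \<inter> {a..b})" by simp
  qed
qed

lemma set_integrable_sum_real:
  fixes f :: "'i \<Rightarrow> 'a \<Rightarrow> real"
  shows "(\<And>i. i \<in> I \<Longrightarrow> set_integrable M A (f i)) \<Longrightarrow> set_integrable M A (\<lambda>x. \<Sum>i\<in>I. f i x)"
  unfolding set_integrable_def real_scaleR_def sum_distrib_left by (rule Bochner_Integration.integrable_sum)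

lemma set_integral_sum_real:
  fixes f :: "'i \<Rightarrow> 'a \<Rightarrow> real"
  shows "(\<And>i. i \<in> I \<Longrightarrow> set_integrable M A (f i)) \<Longrightarrow>
    (LINT x:A|M. (\<Sum>i\<in>I. f i x)) = (\<Sum>i\<in>I. LINT x:A|M. f i x)"
  unfolding set_integrable_def set_lebesgue_integral_def real_scaleR_def sum_distrib_left by (rule Bochner_Integration.integral_sum)

lemma set_integrable_const: "set_integrable lborel {a..b::real} (\<lambda>x. c :: real)"
  unfolding set_integrable_def by (intro integrable_scaleR_left integrable_real_indicator) (auto simp: emeasure_lborel_Icc_eq)

lemma dini_set_integrable:
  assumes lip: "L-lipschitz_on UNIV \<phi>"
  shows "set_integrable lborel {a..b} (dini \<phi>)"
proof -
  have [measurable]: "dini \<phi> \<in> borel_measurable borel" by (rule dini_measurable[OF lip])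
  show ?thesis
  proof (unfold set_integrable_def, rule Bochner_Integration.integrable_bound)
    show "integrable lborel (\<lambda>x. L * indicator {a..b} x)"
      by (intro integrable_mult_right integrable_real_indicator) (auto simp: emeasure_lborel_Icc_eq)
    show "AE x in lborel. norm (indicator {a..b} x *\<^sub>R dini \<phi> x) \<le> norm (L * indicator {a..b} x :: real)"
      using order_trans[OF dini_bounds[OF lip] abs_ge_self] by (intro AE_I2) (auto simp: indicator_def)
  qed measurable
qed

text \<open>Adding \<open>L\<close> makes the Dini derivative nonnegative and bounded by
  \<open>2 * L\<close>. It is then rounded down to multiples of \<delta>, and each of the finitely
  many level sets is replaced by a closed subset, which gives layers for
  \<open>layered_growth\<close>. Rounding costs \<open>\<delta> * (b - a)\<close>, the closed
  subsets cost at most \<epsilon>.\<close>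

lemma dini_integral_le:
  assumes lip: "L-lipschitz_on UNIV \<phi>" and ab: "a \<le> b"
  shows "(LINT x:{a..b}|lborel. dini \<phi> x) \<le> \<phi> b - \<phi> a"
proof -
  have [measurable]: "dini \<phi> \<in> borel_measurable borel" by (rule dini_measurable[OF lip])
  define g where "g x = dini \<phi> x + L" for x
  have [measurable]: "g \<in> borel_measurable borel" unfolding g_def by measurable
  have g: "0 \<le> g x" "g x \<le> 2 * L" for x
    using dini_bounds[OF lip, of x] by (auto simp: g_def abs_le_iff)
  have approx: "(LINT x:{a..b}|lborel. g x) \<le> \<phi> b - \<phi> a + L * (b - a) + \<delta> * (b - a) + \<epsilon>"
    if \<delta>: "\<delta> > 0" and \<epsilon>: "\<epsilon> > 0" for \<delta> \<epsilon> :: real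
  proof -
    define m where "m = nat \<lfloor>2 * L / \<delta>\<rfloor>"
    define lev where "lev x = nat \<lfloor>g x / \<delta>\<rfloor>" for x
    define A where "A j = {x. lev x = j}" for j
    have [measurable]: "lev \<in> measurable borel (count_space UNIV)" unfolding lev_def by measurable
    have A[measurable]: "A j \<in> sets borel" for j unfolding A_def by measurable
    have lev_le: "lev x \<le> m" for x
      unfolding lev_def m_def using g[of x] \<delta> by (intro nat_mono floor_mono divide_right_mono) auto
    have lev_g: "real (lev x) * \<delta> \<le> g x" "g x \<le> real (lev x) * \<delta> + \<delta>" for x
    proof -
      have "0 \<le> g x / \<delta>" using g \<delta> by auto
      then have "real (lev x) = of_int \<lfloor>g x / \<delta>\<rfloor>" by (simp add: lev_def)
      then have "real (lev x) \<le> g x / \<delta>" "g x / \<delta> \<le> real (lev x) + 1" by linarith+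
      then show "real (lev x) * \<delta> \<le> g x" "g x \<le> real (lev x) * \<delta> + \<delta>"
        using \<delta> by (auto simp: field_simps)
    qed
    \<comment> \<open>There are \<open>m + 1\<close> layers of height at most
      \<open>m * \<delta>\<close>, each of which loses measure at most \<open>e\<close>. The summand
      1 keeps the denominator positive when \<open>m = 0\<close>.\<close>
    define e where "e = \<epsilon> / ((real m + 1) * (m * \<delta> + 1))"
    have pos: "(real m + 1) * (m * \<delta> + 1) > 0" using \<delta> by (intro mult_pos_pos) (auto simp: add_nonneg_pos)
    then have e: "e > 0" using \<epsilon> unfolding e_def by (intro divide_pos_pos) (simp_all add: add.commute)
    have "\<forall>j. \<exists>T. closed T \<and> T \<subseteq> A j \<and> measure lborel (A j \<inter> {a..b}) - e \<le> measure lborel (T \<inter> {a..b})"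
      using inner_closed_lborel[OF A e] by metis
    then obtain K where K: "\<And>j. closed (K j)" "\<And>j. K j \<subseteq> A j"
      "\<And>j. measure lborel (A j \<inter> {a..b}) - e \<le> measure lborel (K j \<inter> {a..b})"
      by metis
    have growth: "(\<Sum>j\<le>m. (j * \<delta>) * measure lborel (K j \<inter> {a..b})) \<le> \<phi> b - \<phi> a + L * (b - a)"
    proof (rule layered_growth[OF lip ab])
      fix x
      have "(\<Sum>j\<le>m. if x \<in> K j then j * \<delta> else 0) \<le> (\<Sum>j\<le>m. if j = lev x then j * \<delta> else 0)"
        by (rule sum_mono) (use K(2) \<delta> in \<open>auto simp: A_def\<close>)
      also have "\<dots> = lev x * \<delta>" using lev_le by simp
      also have "\<dots> \<le> dini \<phi> x + L" using lev_g(1)[of x] by (simp add: g_def)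
      finally show "(\<Sum>j\<le>m. if x \<in> K j then j * \<delta> else 0) \<le> dini \<phi> x + L" .
    qed (use K \<delta> in auto)
    have intA: "set_integrable lborel {a..b} (indicator (A j) :: real \<Rightarrow> real)" for j
      using fmeasurable_Int_atLeastAtMost[OF A, of j a b]
      unfolding set_integrable_def real_scaleR_def indicator_inter_arith[symmetric]
      by (intro integrable_real_indicator) (auto simp: fmeasurable_def Int_commute)
    have "(LINT x:{a..b}|lborel. g x) \<le> (LINT x:{a..b}|lborel. (\<Sum>j\<le>m. (j * \<delta>) * indicator (A j) x) + \<delta>)"
    proof (rule set_integral_mono)
      show "set_integrable lborel {a..b} g"
        unfolding g_def by (intro set_integral_add dini_set_integrable[OF lip] set_integrable_const)
      show "set_integrable lborel {a..b} (\<lambda>x. (\<Sum>j\<le>m. (j * \<delta>) * indicator (A j) x) + \<delta>)"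
        by (intro set_integral_add set_integrable_sum_real set_integrable_mult_right intA set_integrable_const)
      fix x
      have "(\<Sum>j\<le>m. (j * \<delta>) * indicator (A j) x) = (\<Sum>j\<le>m. if j = lev x then j * \<delta> else 0)"
        by (rule sum.cong) (auto simp: A_def indicator_def)
      also have "\<dots> = lev x * \<delta>" using lev_le by simp
      finally show "g x \<le> (\<Sum>j\<le>m. (j * \<delta>) * indicator (A j) x) + \<delta>"
        using lev_g(2)[of x] by simp
    qed
    also have "\<dots> = (\<Sum>j\<le>m. (j * \<delta>) * measure lborel (A j \<inter> {a..b})) + \<delta> * (b - a)"
    proof -
      have "(LINT x:{a..b}|lborel. (\<Sum>j\<le>m. (j * \<delta>) * indicator (A j) x) + \<delta>) =
        (LINT x:{a..b}|lborel. (\<Sum>j\<le>m. (j * \<delta>) * indicator (A j) x)) + (LINT x:{a..b}|lborel. \<delta>)"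
        by (intro set_integral_add(2) set_integrable_sum_real set_integrable_mult_right intA set_integrable_const)
      also have "(LINT x:{a..b}|lborel. (\<Sum>j\<le>m. (j * \<delta>) * indicator (A j) x)) =
        (\<Sum>j\<le>m. (LINT x:{a..b}|lborel. (j * \<delta>) * indicator (A j) x))"
        by (intro set_integral_sum_real set_integrable_mult_right intA)
      also have "\<dots> = (\<Sum>j\<le>m. (j * \<delta>) * measure lborel (A j \<inter> {a..b}))"
        by (intro sum.cong refl)
          (simp add: set_lebesgue_integral_def indicator_inter_arith[symmetric] Int_commute)
      also have "(LINT x:{a..b}|lborel. \<delta>) = \<delta> * (b - a)"
        using ab by (simp add: set_lebesgue_integral_def)
      finally show ?thesis .
    qed
    also have "(\<Sum>j\<le>m. (j * \<delta>) * measure lborel (A j \<inter> {a..b})) \<le>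
      (\<Sum>j\<le>m. (j * \<delta>) * measure lborel (K j \<inter> {a..b}) + (m * \<delta>) * e)"
    proof (rule sum_mono)
      fix j assume "j \<in> {..m}"
      then have j: "j * \<delta> \<le> m * \<delta>" "0 \<le> j * \<delta>" using \<delta> by auto
      have "(j * \<delta>) * measure lborel (A j \<inter> {a..b}) \<le> (j * \<delta>) * (measure lborel (K j \<inter> {a..b}) + e)"
        using K(3)[of j] j by (intro mult_left_mono) auto
      also have "\<dots> \<le> (j * \<delta>) * measure lborel (K j \<inter> {a..b}) + (m * \<delta>) * e"
        using j e by (simp add: distrib_left mult_right_mono)
      finally show "(j * \<delta>) * measure lborel (A j \<inter> {a..b}) \<le> (j * \<delta>) * measure lborel (K j \<inter> {a..b}) + (m * \<delta>) * e" .
    qed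
    also have "\<dots> \<le> \<phi> b - \<phi> a + L * (b - a) + (m + 1) * ((m * \<delta>) * e)"
      using growth by (simp add: sum.distrib algebra_simps)
    also have "(m + 1) * ((m * \<delta>) * e) \<le> \<epsilon>"
    proof -
      have "(m + 1) * ((m * \<delta>) * e) \<le> ((real m + 1) * (m * \<delta> + 1)) * e"
        using e by (simp add: algebra_simps)
      also have "\<dots> = \<epsilon>" using less_imp_neq[OF pos] unfolding e_def by (intro nonzero_mult_div_cancel_left[THEN trans[OF times_divide_eq_right]]) simp
      finally show ?thesis by simp
    qed
    finally show ?thesis by simp
  qed
  have *: "(LINT x:{a..b}|lborel. g x) \<le> \<phi> b - \<phi> a + L * (b - a) + \<eta>" if "\<eta> > 0" for \<eta>
  proof -
    have d: "(\<eta> / (2 * (b - a + 1))) * (b - a) \<le> \<eta> / 2"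
      using ab that by (simp add: field_simps)
    have "0 < \<eta> / (2 * (b - a + 1))" "0 < \<eta> / 2" using ab that by auto
    from approx[OF this] d show ?thesis by linarith
  qed
  have "(LINT x:{a..b}|lborel. g x) \<le> \<phi> b - \<phi> a + L * (b - a)"
    using * by (rule field_le_epsilon)
  moreover have "(LINT x:{a..b}|lborel. g x) = (LINT x:{a..b}|lborel. dini \<phi> x) + (LINT x:{a..b}|lborel. L)"
    unfolding g_def by (intro set_integral_add dini_set_integrable[OF lip] set_integrable_const)
  moreover have "(LINT x:{a..b}|lborel. L) = L * (b - a)"
    using ab by (simp add: set_lebesgue_integral_def)
  ultimately show ?thesis by simp
qed

text \<open>The integral bounds for \<open>\<phi>\<close> and \<open>- \<phi>\<close> have opposite
  right-hand sides. Hence the sum of the two Dini derivatives, which is nonnegative, has integral at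
  most 0 over every interval \<open>{- n..n}\<close>.\<close>

theorem lipschitz_AE_right_derivative:
  fixes \<phi> :: "real \<Rightarrow> real"
  assumes lip: "L-lipschitz_on UNIV \<phi>"
  shows "AE x in lborel. dini \<phi> x + dini (\<lambda>x. - \<phi> x) x = 0"
proof -
  let ?s = "\<lambda>x. dini \<phi> x + dini (\<lambda>x. - \<phi> x) x"
  note lip' = lipschitz_on_uminus_real[OF lip]
  have [measurable]: "dini \<phi> \<in> borel_measurable borel" "dini (\<lambda>x. - \<phi> x) \<in> borel_measurable borel"
    by (rule dini_measurable[OF lip] dini_measurable[OF lip'])+
  have "AE x in lborel. x \<in> {- real n..real n} \<longrightarrow> ?s x = 0" for n :: nat
  proof -
    have int: "set_integrable lborel {- real n..real n} ?s"
      by (intro set_integral_add dini_set_integrable[OF lip] dini_set_integrable[OF lip'])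
    have "(LINT x:{- real n..real n}|lborel. ?s x) =
      (LINT x:{- real n..real n}|lborel. dini \<phi> x) + (LINT x:{- real n..real n}|lborel. dini (\<lambda>x. - \<phi> x) x)"
      by (intro set_integral_add dini_set_integrable[OF lip] dini_set_integrable[OF lip'])
    also have "\<dots> \<le> 0"
      using dini_integral_le[OF lip, of "- real n" "real n"] dini_integral_le[OF lip', of "- real n" "real n"] by simp
    finally have le: "(\<integral>x. indicator {- real n..real n} x * ?s x \<partial>lborel) \<le> 0"
      by (simp add: set_lebesgue_integral_def)
    have nonneg: "0 \<le> indicator {- real n..real n} x * ?s x" for x :: real
      using dini_add_uminus_nonneg[OF lip, of x] by (simp add: indicator_def)
    have "(\<integral>x. indicator {- real n..real n} x * ?s x \<partial>lborel) = 0"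
      using le nonneg by (intro antisym integral_nonneg_AE) auto
    then have "AE x in lborel. indicator {- real n..real n} x * ?s x = 0"
      using int nonneg by (subst (asm) integral_nonneg_eq_0_iff_AE) (auto simp: set_integrable_def)
    then show ?thesis by eventually_elim (auto simp: indicator_def)
  qed
  then have "AE x in lborel. \<forall>n::nat. x \<in> {- real n..real n} \<longrightarrow> ?s x = 0"
    by (subst AE_all_countable) auto
  then show ?thesis
  proof eventually_elim
    case (elim x)
    obtain n :: nat where "\<bar>x\<bar> \<le> real n" using real_arch_simple by blast
    then show ?case using elim by (auto simp: abs_le_iff)
  qed
qed

section \<open>Rademacher's theorem\<close>

definition dir_dini :: "('v::real_vector \<Rightarrow> real) \<Rightarrow> 'v \<Rightarrow> 'v \<Rightarrow> real" where
  "dir_dini f v x = dini (\<lambda>t. f (x + t *\<^sub>R v)) 0"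

lemma lipschitz_along_line:
  fixes f :: "'v::real_normed_vector \<Rightarrow> real"
  assumes "L-lipschitz_on UNIV f"
  shows "(L * norm v)-lipschitz_on UNIV (\<lambda>t. f (x + t *\<^sub>R v))"
proof (rule lipschitz_onI)
  fix s t :: real
  have "dist (f (x + s *\<^sub>R v)) (f (x + t *\<^sub>R v)) \<le> L * dist (x + s *\<^sub>R v) (x + t *\<^sub>R v)"
    using assms by (rule lipschitz_onD) auto
  also have "dist (x + s *\<^sub>R v) (x + t *\<^sub>R v) = norm v * dist s t"
    by (simp add: dist_norm scaleR_left_diff_distrib[symmetric])
  finally show "dist (f (x + s *\<^sub>R v)) (f (x + t *\<^sub>R v)) \<le> L * norm v * dist s t"
    by (simp add: mult.assoc)
qed (use lipschitz_on_nonneg[OF assms] in auto)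

lemma dir_dini_shift: "dini (\<lambda>s. f (x + s *\<^sub>R v)) t = dir_dini f v (x + t *\<^sub>R v)"
  by (simp add: dir_dini_def dini_def scaleR_left_distrib add.assoc)

lemma dir_dini_bound:
  fixes f :: "'v::real_normed_vector \<Rightarrow> real"
  assumes "L-lipschitz_on UNIV f"
  shows "\<bar>dir_dini f v x\<bar> \<le> L * norm v"
  unfolding dir_dini_def by (rule dini_bounds[OF lipschitz_along_line[OF assms]])

lemma dir_dini_measurable:
  fixes f :: "'v::euclidean_space \<Rightarrow> real"
  assumes lip: "L-lipschitz_on UNIV f"
  shows "dir_dini f v \<in> borel_measurable borel"
proof -
  have [measurable]: "f \<in> borel_measurable borel"
    by (intro borel_measurable_continuous_onI lipschitz_on_continuous_on[OF lip])
  show ?thesis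
    unfolding dir_dini_def[abs_def] dini_def
    by (intro borel_measurable_cINF borel_measurable_cSUP dini_bdd_above[OF lipschitz_along_line[OF lip]]
        dini_bdd_below[OF lipschitz_along_line[OF lip]])
      (auto intro: countable_Int2 countable_rat)
qed

text \<open>On each line in direction \<open>v\<close> almost every parameter is good. By Fubini
  there is one parameter \<open>t\<close> for which \<open>x + t *\<^sub>R v\<close> is good for
  almost every \<open>x\<close>, and translation by \<open>t *\<^sub>R v\<close> preserves Lebesgue
  measure. No change of basis turning \<open>v\<close> into an axis is involved.\<close>

lemma dir_derivative_AE:
  fixes f :: "'v::euclidean_space \<Rightarrow> real"
  assumes lip: "L-lipschitz_on UNIV f"
  shows "AE x in lborel. ((\<lambda>h. (f (x + h *\<^sub>R v) - f x) / h) \<longlongrightarrow> dir_dini f v x) (at_right 0)"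
proof -
  note lip' = lipschitz_on_uminus_real[OF lip]
  let ?P = "\<lambda>x. dir_dini f v x + dir_dini (\<lambda>x. - f x) v x = 0"
  have [measurable]: "dir_dini f v \<in> borel_measurable borel" "dir_dini (\<lambda>x. - f x) v \<in> borel_measurable borel"
    using dir_dini_measurable[OF lip] dir_dini_measurable[OF lip'] by auto
  have "AE t in lborel. ?P (x + t *\<^sub>R v)" for x
    using lipschitz_AE_right_derivative[OF lipschitz_along_line[OF lip, of v x]]
      dir_dini_shift[of f x v] dir_dini_shift[of "\<lambda>x. - f x" x v] by simp
  then have "AE x in (lborel :: 'v measure). AE t in (lborel :: real measure). ?P (x + t *\<^sub>R v)"
    by simp
  then have "AE t in (lborel :: real measure). AE x in (lborel :: 'v measure). ?P (x + t *\<^sub>R v)"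
    by (subst (asm) lborel_pair.AE_commute) measurable
  then obtain t :: real where "AE x in (lborel :: 'v measure). ?P (x + t *\<^sub>R v)"
    using eventually_happens'[of "ae_filter (lborel :: real measure)"] by (auto simp: ae_filter_eq_bot_iff)
  then have "AE x in distr lborel borel ((+) (t *\<^sub>R v)). ?P x"
    by (subst AE_distr_iff) (auto simp: add.commute)
  then have "AE x in lborel. ?P x"
    unfolding lborel_distr_plus .
  then show ?thesis
  proof eventually_elim
    case (elim x)
    show ?case
      using dini_eq_imp_derivative[OF lipschitz_along_line[OF lip], of x v 0] elim
      by (simp add: dir_dini_def)
  qed
qed

text \<open>Adding \<open>C\<close> turns \<open>g\<close> into the density of a measure. This
  measure and the one with constant density \<open>C\<close> agree on boxes, an intersection-stable
  generator, and are finite on an exhausting sequence of boxes, so they coincide and so do their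
  densities almost everywhere.\<close>

lemma AE_zero_if_box_integrals_zero:
  fixes g :: "'v::euclidean_space \<Rightarrow> real"
  assumes [measurable]: "g \<in> borel_measurable borel" and bound: "\<And>x. \<bar>g x\<bar> \<le> C"
    and int: "\<And>a b. (\<integral>x. indicator (box a b) x * g x \<partial>lborel) = 0"
  shows "AE x in lborel. g x = 0"
proof -
  have "density lborel (\<lambda>x. ennreal (g x + C)) = density lborel (\<lambda>x. ennreal C)"
  proof (rule measure_eqI_generator_eq)
    let ?E = "range (\<lambda>(a, b). box a b::'v set)"
    show "Int_stable ?E"
      by (auto simp: Int_stable_def box_Int_box)
    show "?E \<subseteq> Pow UNIV"
      "sets (density lborel (\<lambda>x. ennreal (g x + C))) = sigma_sets UNIV ?E"
      "sets (density lborel (\<lambda>x. ennreal C)) = sigma_sets UNIV ?E"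
      by (simp_all add: borel_eq_box)
    let ?A = "\<lambda>n::nat. box (- (real n *\<^sub>R One)) (real n *\<^sub>R One) :: 'v set"
    show "range ?A \<subseteq> ?E" "(\<Union>i. ?A i) = UNIV"
      unfolding UN_box_eq_UNIV by auto
    have C: "0 \<le> C" using bound[of 0] by simp
    have nonneg: "0 \<le> g x + C" for x using bound[of x] by (simp add: abs_le_iff)
    have ind: "integrable lborel (\<lambda>x. indicator (box a b) x * c :: real)" for a b :: 'v and c
      by (intro integrable_mult_left integrable_real_indicator) (use emeasure_bounded_finite[OF bounded_box[of a b]] in auto)
    have indg: "integrable lborel (\<lambda>x. indicator (box a b) x * g x)" for a b :: 'v
      by (rule Bochner_Integration.integrable_bound[OF ind[of a b C]])
        (use order_trans[OF bound abs_ge_self] in \<open>auto simp: indicator_def\<close>)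
    have eq: "emeasure (density lborel (\<lambda>x. ennreal (g x + C))) (box a b) = emeasure (density lborel (\<lambda>x. ennreal C)) (box a b)"
      for a b :: 'v
    proof -
      have "emeasure (density lborel (\<lambda>x. ennreal (g x + C))) (box a b) = (\<integral>\<^sup>+x. ennreal (indicator (box a b) x * g x + indicator (box a b) x * C) \<partial>lborel)"
        by (subst emeasure_density) (auto simp: indicator_def intro!: nn_integral_cong)
      also have "\<dots> = ennreal (\<integral>x. indicator (box a b) x * g x + indicator (box a b) x * C \<partial>lborel)"
        by (rule nn_integral_eq_integral[OF Bochner_Integration.integrable_add[OF indg ind]])
          (use nonneg in \<open>auto simp: distrib_left[symmetric]\<close>)
      also have "\<dots> = ennreal (\<integral>x. indicator (box a b) x * C \<partial>lborel)"
        by (subst Bochner_Integration.integral_add[OF indg ind]) (simp add: int)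
      also have "\<dots> = (\<integral>\<^sup>+x. ennreal (indicator (box a b) x * C) \<partial>lborel)"
        by (rule nn_integral_eq_integral[symmetric, OF ind]) (use C in auto)
      also have "\<dots> = emeasure (density lborel (\<lambda>x. ennreal C)) (box a b)"
        by (subst emeasure_density) (auto simp: indicator_def intro!: nn_integral_cong)
      finally show ?thesis .
    qed
    then show "emeasure (density lborel (\<lambda>x. ennreal (g x + C))) X = emeasure (density lborel (\<lambda>x. ennreal C)) X"
      if "X \<in> ?E" for X
      using that by auto
    show "emeasure (density lborel (\<lambda>x. ennreal (g x + C))) (?A i) \<noteq> \<infinity>" for i
      unfolding eq by (simp add: emeasure_density nn_integral_cmult_indicator ennreal_mult_eq_top_iff)
  qed
  then have "AE x in lborel. ennreal (g x + C) = ennreal C"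
    by (subst (asm) sigma_finite_measure.density_unique_iff[OF sigma_finite_lborel]) auto
  then show ?thesis
  proof eventually_elim
    case (elim x)
    have "0 \<le> C" "0 \<le> g x + C" using bound[of x] by (auto simp: abs_le_iff)
    then show ?case using elim by (simp add: ennreal_inj)
  qed
qed

lemma dir_derivative_unique:
  fixes x :: "'v::real_normed_vector"
  assumes "((\<lambda>h. (f (x + h *\<^sub>R v) - f x) / h) \<longlongrightarrow> a) (at_right 0)"
    and "((\<lambda>h. (f (x + h *\<^sub>R v) - f x) / h) \<longlongrightarrow> b) (at_right 0)"
  shows "(a::real) = b"
  using assms by (rule tendsto_unique[rotated]) simp

lemma tendsto_inverse_Suc: "(\<lambda>n. 1 / real (Suc n)) \<longlonglongrightarrow> 0"
  by (rule LIMSEQ_Suc[OF lim_1_over_n])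

lemma filterlim_inverse_Suc_at_right: "filterlim (\<lambda>n. 1 / real (Suc n)) (at_right 0) sequentially"
  by (rule tendsto_imp_filterlim_at_right[OF tendsto_inverse_Suc]) auto

text \<open>The quotient in direction \<open>v + w\<close> at \<open>x\<close> is exactly the sum of
  the quotient for \<open>v\<close> at \<open>x\<close> and the quotient for \<open>w\<close> at the
  moving point \<open>x + h n *\<^sub>R v\<close>. At a fixed \<open>x\<close> nothing controls the
  limit of the latter; its integrals over boxes do converge, and these integrals determine the
  functions almost everywhere.\<close>

lemma dir_dini_add_AE:
  fixes f :: "'v::euclidean_space \<Rightarrow> real"
  assumes lip: "L-lipschitz_on UNIV f"
  shows "AE x in lborel. dir_dini f (v + w) x = dir_dini f v x + dir_dini f w x"
proof -
  have L0: "0 \<le> L" using lip lipschitz_on_nonneg by blast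
  have [measurable]: "f \<in> borel_measurable borel"
    by (intro borel_measurable_continuous_onI lipschitz_on_continuous_on[OF lip])
  have [measurable]: "dir_dini f v \<in> borel_measurable borel" for v
    by (rule dir_dini_measurable[OF lip])
  define h where "h n = 1 / real (Suc n)" for n
  have h: "h n > 0" "h n \<le> 1" for n by (auto simp: h_def)
  have h0: "h \<longlonglongrightarrow> 0" unfolding h_def by (rule tendsto_inverse_Suc)
  define q where "q v n x = (f (x + h n *\<^sub>R v) - f x) / h n" for v n x
  have [measurable]: "q v n \<in> borel_measurable borel" for v n unfolding q_def by measurable
  have qb: "\<bar>q v n x\<bar> \<le> L * norm v" for v n x
    using lipschitz_quotient_le[OF lipschitz_along_line[OF lip, of v x], of "h n" 0] h[of n] by (simp add: q_def)
  have qlim: "AE x in lborel. (\<lambda>n. q v n x) \<longlonglongrightarrow> dir_dini f v x" for v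
    using dir_derivative_AE[OF lip, of v]
  proof eventually_elim
    case (elim x)
    show ?case
      unfolding q_def h_def by (rule filterlim_compose[OF elim filterlim_inverse_Suc_at_right])
  qed
  have ind: "integrable lborel (\<lambda>x. c * indicator A x :: real)" if "A \<in> sets borel" "bounded A" for c and A :: "'v set"
    by (intro integrable_mult_right integrable_real_indicator) (use that emeasure_bounded_finite in auto)
  have int_bounded: "integrable lborel (\<lambda>x. indicator A x * u x :: real)"
    if "A \<in> sets borel" "bounded A" "u \<in> borel_measurable borel" "\<And>x. \<bar>u x\<bar> \<le> c" for c and A :: "'v set" and u
    by (rule Bochner_Integration.integrable_bound[OF ind[OF that(1,2), of c]])
      (use that(1,3) order_trans[OF that(4) abs_ge_self] in \<open>auto simp: indicator_def\<close>)
  define I where "I v a b = (\<integral>x. indicator (box a b) x * dir_dini f v x \<partial>lborel)" for v a b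
  have lim: "(\<lambda>n. \<integral>x. indicator (box a b) x * q v n x \<partial>lborel) \<longlonglongrightarrow> I v a b" for v a b
    unfolding I_def
  proof (rule integral_dominated_convergence[where w = "\<lambda>x. L * norm v * indicator (box a b) x"])
    show "AE x in lborel. (\<lambda>n. indicator (box a b) x * q v n x) \<longlonglongrightarrow> indicator (box a b) x * dir_dini f v x"
      using qlim[of v] by eventually_elim (intro tendsto_intros)
    show "AE x in lborel. norm (indicator (box a b) x * q v n x) \<le> L * norm v * indicator (box a b) x" for n
      using qb by (auto simp: indicator_def)
    show "integrable lborel (\<lambda>x. L * norm v * indicator (box a b) x)"
      by (rule ind) auto
  qed auto
  text \<open>The first quotient below is taken at the moving base point \<open>x + h n *\<^sub>R v\<close>; translating the
    integral moves the shift to the box, whose boundary is a null set.\<close>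
  have lim': "(\<lambda>n. \<integral>x. indicator (box a b) x * q w n (x + h n *\<^sub>R v) \<partial>lborel) \<longlonglongrightarrow> I w a b" for a b
  proof -
    obtain R where R: "\<And>x. x \<in> box a b \<Longrightarrow> norm x \<le> R"
      using bounded_box[of a b] by (auto simp: bounded_iff)
    have "(\<integral>x. indicator (box a b) x * q w n (x + h n *\<^sub>R v) \<partial>lborel) =
      (\<integral>x. indicator (box a b) (x - h n *\<^sub>R v) * q w n x \<partial>lborel)" for n
    proof -
      have "(\<integral>x. indicator (box a b) (x - h n *\<^sub>R v) * q w n x \<partial>lborel) =
        (\<integral>x. indicator (box a b) (x - h n *\<^sub>R v) * q w n x \<partial>distr lborel borel ((+) (h n *\<^sub>R v)))"
        by (simp add: lborel_distr_plus)
      also have "\<dots> = (\<integral>x. indicator (box a b) x * q w n (x + h n *\<^sub>R v) \<partial>lborel)"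
        by (subst integral_distr) (auto simp: add.commute)
      finally show ?thesis by simp
    qed
    moreover have "(\<lambda>n. \<integral>x. indicator (box a b) (x - h n *\<^sub>R v) * q w n x \<partial>lborel) \<longlonglongrightarrow> I w a b"
      unfolding I_def
    \<comment> \<open>As \<open>h n \<le> 1\<close>, all the shifted boxes lie in one ball, whose
      radius is enlarged by \<open>norm v\<close>.\<close>
    proof (rule integral_dominated_convergence[where w = "\<lambda>x. L * norm w * indicator (cball 0 (R + norm v)) x"])
      have "negligible (cbox a b - box a b)" by (rule negligible_frontier_interval)
      then have "AE x in lborel. x \<notin> cbox a b - box a b"
        by (intro AE_not_in) (simp add: negligible_iff_null_sets null_sets_completion_iff)
      then show "AE x in lborel. (\<lambda>n. indicator (box a b) (x - h n *\<^sub>R v) * q w n x) \<longlonglongrightarrow> indicator (box a b) x * dir_dini f w x"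
        using qlim[of w]
      proof eventually_elim
        case (elim x)
        have lim_x: "(\<lambda>n. x - h n *\<^sub>R v) \<longlonglongrightarrow> x - 0 *\<^sub>R v" by (intro tendsto_intros h0)
        consider "x \<in> box a b" | "x \<in> - cbox a b" using elim(1) by auto
        then have "\<forall>\<^sub>F n in sequentially. indicator (box a b) (x - h n *\<^sub>R v) = (indicator (box a b) x :: real)"
        proof cases
          case 1
          then have "\<forall>\<^sub>F n in sequentially. x - h n *\<^sub>R v \<in> box a b"
            using lim_x by (intro topological_tendstoD[OF lim_x]) auto
          then show ?thesis by eventually_elim (use 1 in auto)
        next
          case 2
          then have "\<forall>\<^sub>F n in sequentially. x - h n *\<^sub>R v \<in> - cbox a b"
            using lim_x by (intro topological_tendstoD[OF lim_x]) auto
          then show ?thesis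
            by eventually_elim (use 2 box_subset_cbox[of a b] in \<open>auto simp: indicator_def\<close>)
        qed
        then have "(\<lambda>n. indicator (box a b) (x - h n *\<^sub>R v) :: real) \<longlonglongrightarrow> indicator (box a b) x"
          by (rule tendsto_eventually)
        with elim(2) show ?case by (intro tendsto_intros)
      qed
      show "AE x in lborel. norm (indicator (box a b) (x - h n *\<^sub>R v) * q w n x) \<le> L * norm w * indicator (cball 0 (R + norm v)) x" for n
      proof (rule AE_I2)
        fix x
        have "norm x \<le> R + norm v" if "x - h n *\<^sub>R v \<in> box a b"
        proof -
          have "norm x \<le> norm (x - h n *\<^sub>R v) + norm (h n *\<^sub>R v)"
            using norm_triangle_ineq[of "x - h n *\<^sub>R v" "h n *\<^sub>R v"] by simp
          moreover have "norm (h n *\<^sub>R v) \<le> norm v" using h[of n] by (simp add: mult_left_le_one_le)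
          ultimately show ?thesis using R[OF that] by simp
        qed
        then show "norm (indicator (box a b) (x - h n *\<^sub>R v) * q w n x) \<le> L * norm w * indicator (cball 0 (R + norm v)) x"
          using qb[of w n x] L0 by (auto simp: indicator_def)
      qed
      show "integrable lborel (\<lambda>x :: 'v. L * norm w * indicator (cball 0 (R + norm v)) x)"
        by (rule ind) auto
    qed auto
    ultimately show ?thesis by simp
  qed
  have I_add: "I (v + w) a b = I v a b + I w a b" for a b
  proof -
    have split: "q (v + w) n x = q w n (x + h n *\<^sub>R v) + q v n x" for n x
      by (simp add: q_def add_divide_distrib[symmetric] scaleR_right_distrib add.assoc)
    have "(\<integral>x. indicator (box a b) x * q (v + w) n x \<partial>lborel) =
      (\<integral>x. indicator (box a b) x * q w n (x + h n *\<^sub>R v) \<partial>lborel) + (\<integral>x. indicator (box a b) x * q v n x \<partial>lborel)" for n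
      unfolding split distrib_left
      by (intro Bochner_Integration.integral_add int_bounded[OF _ _ _ qb]) auto
    then have "(\<lambda>n. \<integral>x. indicator (box a b) x * q (v + w) n x \<partial>lborel) \<longlonglongrightarrow> I w a b + I v a b"
      using tendsto_add[OF lim' lim] by simp
    from LIMSEQ_unique[OF lim this] show ?thesis by simp
  qed
  have "AE x in lborel. dir_dini f (v + w) x - (dir_dini f v x + dir_dini f w x) = 0"
  proof (rule AE_zero_if_box_integrals_zero[where C = "L * norm (v + w) + (L * norm v + L * norm w)"])
    show "\<bar>dir_dini f (v + w) x - (dir_dini f v x + dir_dini f w x)\<bar> \<le> L * norm (v + w) + (L * norm v + L * norm w)" for x
      using dir_dini_bound[OF lip, of "v + w" x] dir_dini_bound[OF lip, of v x] dir_dini_bound[OF lip, of w x] by linarith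
    fix a b
    have i: "integrable lborel (\<lambda>x. indicator (box a b) x * dir_dini f v x)" for v
      by (rule int_bounded[OF _ _ _ dir_dini_bound[OF lip]]) auto
    show "(\<integral>x. indicator (box a b) x * (dir_dini f (v + w) x - (dir_dini f v x + dir_dini f w x)) \<partial>lborel) = 0"
      using I_add[of a b] i unfolding I_def by (simp add: right_diff_distrib distrib_left)
  qed measurable
  then show ?thesis by eventually_elim simp
qed

text \<open>For \<open>c > 0\<close> the increment is rescaled. One-sided limits say nothing about
  \<open>c < 0\<close>; there, additivity is applied to the sum of \<open>c *\<^sub>R v\<close> and
  \<open>(- c) *\<^sub>R v\<close>, which is 0.\<close>

lemma dir_dini_scale_AE:
  fixes f :: "'v::euclidean_space \<Rightarrow> real"
  assumes lip: "L-lipschitz_on UNIV f"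
  shows "AE x in lborel. dir_dini f (c *\<^sub>R v) x = c * dir_dini f v x"
proof -
  have pos: "AE x in lborel. dir_dini f (c *\<^sub>R v) x = c * dir_dini f v x" if "c > 0" for c and v :: 'v
    using dir_derivative_AE[OF lip, of v] dir_derivative_AE[OF lip, of "c *\<^sub>R v"]
  proof eventually_elim
    case (elim x)
    have "filterlim (\<lambda>h. c * h) (at_right 0) (at_right 0)"
      using that by (intro tendsto_imp_filterlim_at_right tendsto_mult_right_zero) (auto simp: eventually_at_filter)
    from filterlim_compose[OF elim(1) this]
    have "((\<lambda>h. c * ((f (x + (c * h) *\<^sub>R v) - f x) / (c * h))) \<longlongrightarrow> c * dir_dini f v x) (at_right 0)"
      by (intro tendsto_intros)
    moreover have "(\<lambda>h. c * ((f (x + (c * h) *\<^sub>R v) - f x) / (c * h))) = (\<lambda>h. (f (x + h *\<^sub>R c *\<^sub>R v) - f x) / h)"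
      using that by (simp add: mult.commute)
    ultimately have "((\<lambda>h. (f (x + h *\<^sub>R c *\<^sub>R v) - f x) / h) \<longlongrightarrow> c * dir_dini f v x) (at_right 0)"
      by (simp only:)
    then show ?case by (rule dir_derivative_unique[OF elim(2)])
  qed
  have zero: "dir_dini f 0 x = 0" for x
    using dir_dini_bound[OF lip, of 0 x] by simp
  consider "c = 0" | "c > 0" | "c < 0" by linarith
  then show ?thesis
  proof cases
    case 3
    have "AE x in lborel. dir_dini f (c *\<^sub>R v + (- c) *\<^sub>R v) x = dir_dini f (c *\<^sub>R v) x + dir_dini f ((- c) *\<^sub>R v) x"
      by (rule dir_dini_add_AE[OF lip])
    moreover have "AE x in lborel. dir_dini f ((- c) *\<^sub>R v) x = - c * dir_dini f v x"
      by (rule pos) (use 3 in simp)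
    ultimately show ?thesis
      by eventually_elim (simp add: zero)
  qed (auto simp: zero pos)
qed

lemma dir_dini_linear_AE:
  fixes f :: "'v::euclidean_space \<Rightarrow> real"
  assumes lip: "L-lipschitz_on UNIV f"
  shows "AE x in lborel. dir_dini f v x = (\<Sum>b\<in>Basis. (v \<bullet> b) * dir_dini f b x)"
proof -
  have "AE x in lborel. dir_dini f (\<Sum>b\<in>B. (v \<bullet> b) *\<^sub>R b) x = (\<Sum>b\<in>B. (v \<bullet> b) * dir_dini f b x)"
    if "finite B" for B
    using that
  proof induction
    case empty
    then show ?case using dir_dini_bound[OF lip, of 0] by simp
  next
    case (insert b B)
    show ?case
      using insert.IH dir_dini_add_AE[OF lip, of "(v \<bullet> b) *\<^sub>R b" "\<Sum>b\<in>B. (v \<bullet> b) *\<^sub>R b"]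
        dir_dini_scale_AE[OF lip, of "v \<bullet> b" b]
      by eventually_elim (simp add: insert.hyps)
  qed
  from this[of Basis] show ?thesis by (simp add: euclidean_representation)
qed

text \<open>By compactness of the unit sphere, finitely many directions of \<open>Q\<close> come
  within \<open>e\<close> of every unit vector, and for finitely many directions the convergence is
  uniform. The Lipschitz bound for \<open>f\<close> and the boundedness of \<open>D\<close> carry
  the estimate over to all directions. Limits from the right suffice, as \<open>y - x\<close> is a
  positive multiple of a unit vector.\<close>

lemma differentiable_if_dense_directions:
  fixes f :: "'v::euclidean_space \<Rightarrow> real"
  assumes lip: "L-lipschitz_on UNIV f" and D: "bounded_linear D"
    and dense: "closure Q = UNIV"
    and lim: "\<And>v. v \<in> Q \<Longrightarrow> ((\<lambda>h. (f (x + h *\<^sub>R v) - f x) / h) \<longlongrightarrow> D v) (at_right 0)"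
  shows "(f has_derivative D) (at x)"
  unfolding has_derivative_at_alt
proof (intro conjI allI impI D)
  fix \<epsilon> :: real assume \<epsilon>: "\<epsilon> > 0"
  obtain K where K: "K > 0" "\<And>v. norm (D v) \<le> norm v * K"
    using bounded_linear.pos_bounded[OF D] by blast
  have L0: "0 \<le> L" using lip lipschitz_on_nonneg by blast
  \<comment> \<open>The three errors are \<open>L * e\<close> for moving \<open>f\<close> to the
    nearby direction, \<open>e\<close> for the limit along it, and \<open>K * e\<close> for moving
    \<open>D\<close> back.\<close>
  define e where "e = \<epsilon> / (L + K + 1)"
  have pos: "L + K + 1 > 0" using L0 K(1) by simp
  have e: "e > 0" "(L + K + 1) * e = \<epsilon>" using \<epsilon> pos by (auto simp: e_def)
  have "sphere 0 1 \<subseteq> (\<Union>v\<in>Q. ball v e)"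
  proof
    fix u :: 'v
    have "u \<in> closure Q" using dense by simp
    then obtain v where "v \<in> Q" "dist v u < e"
      using closure_approachable e(1) by blast
    then show "u \<in> (\<Union>v\<in>Q. ball v e)" by auto
  qed
  then obtain N where N: "N \<subseteq> Q" "finite N" "sphere 0 1 \<subseteq> (\<Union>v\<in>N. ball v e)"
    using compactE_image[of "sphere 0 (1::real) :: 'v set" Q "\<lambda>v. ball v e"] by auto
  have "\<forall>\<^sub>F h in at_right 0. \<forall>v\<in>N. dist ((f (x + h *\<^sub>R v) - f x) / h) (D v) < e"
    by (rule eventually_ball_finite[OF N(2)]) (rule ballI, rule tendstoD, rule lim, use N(1) e in auto)
  then obtain d where d: "d > 0"
    "\<And>h v. 0 < h \<Longrightarrow> h < d \<Longrightarrow> v \<in> N \<Longrightarrow> dist ((f (x + h *\<^sub>R v) - f x) / h) (D v) < e"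
    unfolding eventually_at_right_field by blast
  show "\<exists>d>0. \<forall>y. norm (y - x) < d \<longrightarrow> norm (f y - f x - D (y - x)) \<le> \<epsilon> * norm (y - x)"
  proof (intro exI[of _ d] conjI allI impI d(1))
    fix y assume y: "norm (y - x) < d"
    define h where "h = norm (y - x)"
    show "norm (f y - f x - D (y - x)) \<le> \<epsilon> * norm (y - x)"
    proof (cases "y = x")
      case True
      then show ?thesis using bounded_linear.linear[OF D] linear_0 by auto
    next
      case False
      then have h: "h > 0" "h < d" using y by (auto simp: h_def)
      define u where "u = (y - x) /\<^sub>R h"
      have u: "norm u = 1" "y - x = h *\<^sub>R u" using h by (auto simp: u_def h_def)
      then have "u \<in> (\<Union>v\<in>N. ball v e)" using N(3) by (auto simp: subset_iff)
      then obtain v where v: "v \<in> N" "norm (u - v) \<le> e"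
        by (auto simp: dist_norm norm_minus_commute less_imp_le)
      have y_eq: "y = x + h *\<^sub>R u" using u(2) by (simp add: algebra_simps)
      have "\<bar>f y - f (x + h *\<^sub>R v)\<bar> \<le> L * norm (h *\<^sub>R (u - v))"
        using lipschitz_onD[OF lip, of y "x + h *\<^sub>R v"] by (simp add: y_eq dist_norm scaleR_right_diff_distrib)
      also have "\<dots> \<le> L * (h * e)" using h v(2) L0 by (intro mult_left_mono) auto
      finally have 1: "\<bar>f y - f (x + h *\<^sub>R v)\<bar> \<le> L * (h * e)" .
      have "\<bar>(f (x + h *\<^sub>R v) - f x) / h - D v\<bar> \<le> e"
        using d(2)[OF h v(1)] by (simp add: dist_real_def)
      then have "h * \<bar>(f (x + h *\<^sub>R v) - f x) / h - D v\<bar> \<le> h * e" using h by (intro mult_left_mono) auto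
      moreover have "h * \<bar>(f (x + h *\<^sub>R v) - f x) / h - D v\<bar> = \<bar>f (x + h *\<^sub>R v) - f x - h * D v\<bar>"
      proof -
        have "h * \<bar>(f (x + h *\<^sub>R v) - f x) / h - D v\<bar> = \<bar>h * ((f (x + h *\<^sub>R v) - f x) / h - D v)\<bar>"
          using h by (simp add: abs_mult)
        moreover have "h * (a / h - b) = a - h * b" for a b using h by (simp add: right_diff_distrib)
        ultimately show ?thesis by metis
      qed
      ultimately have 2: "\<bar>f (x + h *\<^sub>R v) - f x - h * D v\<bar> \<le> h * e" by simp
      have "\<bar>D (v - u)\<bar> \<le> e * K"
      proof -
        have "\<bar>D (v - u)\<bar> \<le> norm (v - u) * K" using K(2)[of "v - u"] by simp
        also have "\<dots> \<le> e * K" using v(2) K(1) by (intro mult_right_mono) (simp_all only: norm_minus_commute[of v u] less_imp_le)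
        finally show ?thesis .
      qed
      then have "h * \<bar>D (v - u)\<bar> \<le> h * (e * K)" using h by (intro mult_left_mono) auto
      moreover have "h * \<bar>D (v - u)\<bar> = \<bar>h * D v - D (y - x)\<bar>"
      proof -
        have "h * D v - D (y - x) = h * D (v - u)"
          unfolding u(2) linear_diff[OF bounded_linear.linear[OF D]] linear_scale[OF bounded_linear.linear[OF D]]
          by (simp add: right_diff_distrib)
        then show ?thesis using h by (simp add: abs_mult)
      qed
      ultimately have 3: "\<bar>h * D v - D (y - x)\<bar> \<le> h * (e * K)" by simp
      have "\<bar>f y - f x - D (y - x)\<bar> \<le> L * (h * e) + h * e + h * (e * K)"
        using 1 2 3 by linarith
      also have "\<dots> = ((L + K + 1) * e) * h" by (simp add: algebra_simps)
      finally show ?thesis using e(2) by (simp add: h_def)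
    qed
  qed
qed

text \<open>Almost-everywhere statements can be combined for countably many directions only. A
  countable dense set is enough, by \<open>differentiable_if_dense_directions\<close>.\<close>

theorem rademacher:
  fixes f :: "'v::euclidean_space \<Rightarrow> real"
  assumes lip: "L-lipschitz_on UNIV f"
  shows "AE x in lborel. f differentiable (at x)"
proof -
  obtain Q :: "'v set" where Q: "countable Q" "\<And>X. open X \<Longrightarrow> X \<noteq> {} \<Longrightarrow> \<exists>d\<in>Q. d \<in> X"
    using countable_dense_exists by blast
  have dense: "closure Q = UNIV"
  proof -
    have "x \<in> closure Q" for x
      unfolding closure_approachable using Q(2)[of "ball x e" for e] by (auto simp: dist_commute)
    then show ?thesis by auto
  qed
  have "AE x in lborel. \<forall>v\<in>Q. dir_dini f v x = (\<Sum>b\<in>Basis. (v \<bullet> b) * dir_dini f b x) \<and>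
      ((\<lambda>h. (f (x + h *\<^sub>R v) - f x) / h) \<longlongrightarrow> dir_dini f v x) (at_right 0)"
    unfolding AE_ball_countable[OF Q(1)]
    using dir_dini_linear_AE[OF lip] dir_derivative_AE[OF lip] by simp
  then show ?thesis
  proof eventually_elim
    case (elim x)
    have "bounded_linear (\<lambda>v. \<Sum>b\<in>Basis. (v \<bullet> b) * dir_dini f b x)"
      by (intro bounded_linear_sum bounded_linear_mult_const bounded_linear_inner_left)
    then have "(f has_derivative (\<lambda>v. \<Sum>b\<in>Basis. (v \<bullet> b) * dir_dini f b x)) (at x)"
    proof (rule differentiable_if_dense_directions[OF lip _ dense])
      fix v assume "v \<in> Q"
      with elim have e: "dir_dini f v x = (\<Sum>b\<in>Basis. (v \<bullet> b) * dir_dini f b x)"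
        and l: "((\<lambda>h. (f (x + h *\<^sub>R v) - f x) / h) \<longlongrightarrow> dir_dini f v x) (at_right 0)" by blast+
      show "((\<lambda>h. (f (x + h *\<^sub>R v) - f x) / h) \<longlongrightarrow> (\<Sum>b\<in>Basis. (v \<bullet> b) * dir_dini f b x)) (at_right 0)"
        using l unfolding e .
    qed
    then show ?case unfolding differentiable_def by blast
  qed
qed

section \<open>Localisation, and differentials as limits of sequences\<close>

lemma Lindelof_image:
  fixes B :: "'i \<Rightarrow> 'a::second_countable_topology set"
  assumes "\<And>x. x \<in> S \<Longrightarrow> open (B x)"
  obtains T where "T \<subseteq> S" "countable T" "(\<Union>x\<in>T. B x) = (\<Union>x\<in>S. B x)"
proof -
  obtain F where F: "F \<subseteq> B ` S" "countable F" "\<Union>F = \<Union>(B ` S)"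
    using Lindelof[of "B ` S"] assms by blast
  obtain T where "countable T" "T \<subseteq> S" "F = B ` T"
    using F(1,2) by (metis countable_subset_image)
  then show thesis using F(3) that by metis
qed

text \<open>Composition with the nearest-point map of a closed ball, which is 1-Lipschitz, extends
  \<open>f\<close> to a globally Lipschitz function that agrees with \<open>f\<close> on the ball.
  Half the radius keeps the closed ball inside the region where \<open>f\<close> is Lipschitz, and
  countably many such balls cover \<open>S\<close>.\<close>

corollary rademacher_local:
  fixes f :: "'v::euclidean_space \<Rightarrow> real"
  assumes "open S" and lip: "\<And>x. x \<in> S \<Longrightarrow> \<exists>r>0. \<exists>L. L-lipschitz_on (ball x r) f"
  shows "AE x in lborel. x \<in> S \<longrightarrow> f differentiable (at x)"
proof -
  obtain r L where rL: "\<And>x. x \<in> S \<Longrightarrow> r x > 0" "\<And>x. x \<in> S \<Longrightarrow> (L x)-lipschitz_on (ball x (r x)) f"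
    using lip by metis
  have loc: "AE y in lborel. y \<in> ball x (r x / 2) \<longrightarrow> f differentiable (at y)" if x: "x \<in> S" for x
  proof -
    define B where "B = cball x (r x / 2)"
    have B: "B \<subseteq> ball x (r x)" "convex B" "closed B" "B \<noteq> {}" using rL(1)[OF x] by (auto simp: B_def)
    have "(L x * 1)-lipschitz_on UNIV (f \<circ> closest_point B)"
    proof (rule lipschitz_on_compose)
      show "1-lipschitz_on UNIV (closest_point B)"
        by (rule lipschitz_onI) (use closest_point_lipschitz[OF B(2-4)] in auto)
      show "(L x)-lipschitz_on (range (closest_point B)) f"
        by (rule lipschitz_on_subset[OF rL(2)[OF x]]) (use closest_point_in_set[OF B(3,4)] B(1) in blast)
    qed
    from rademacher[OF this] show ?thesis
    proof eventually_elim
      case (elim y)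
      show ?case
      proof
        assume y: "y \<in> ball x (r x / 2)"
        obtain D where D: "((f \<circ> closest_point B) has_derivative D) (at y)"
          using elim unfolding differentiable_def by blast
        have "(f has_derivative D) (at y)"
          by (rule has_derivative_transform_within_open[OF D open_ball y]) (simp add: B_def closest_point_self)
        then show "f differentiable (at y)" unfolding differentiable_def by blast
      qed
    qed
  qed
  obtain T where T: "T \<subseteq> S" "countable T" "(\<Union>x\<in>T. ball x (r x / 2)) = (\<Union>x\<in>S. ball x (r x / 2))"
    using Lindelof_image[of S "\<lambda>x. ball x (r x / 2)"] by auto
  have "AE y in lborel. \<forall>x\<in>T. y \<in> ball x (r x / 2) \<longrightarrow> f differentiable (at y)"
    unfolding AE_ball_countable[OF T(2)] using loc T(1) by blast
  then show ?thesis
  proof eventually_elim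
    case (elim y)
    show ?case
    proof
      assume "y \<in> S"
      then have "y \<in> (\<Union>x\<in>S. ball x (r x / 2))" using rL(1)[of y] by force
      then show "f differentiable (at y)" using elim T(3) by blast
    qed
  qed
qed

text \<open>A fixed sequence of increments presents the values of the differential as limits of
  Borel functions of the point; see \<open>q\<close> in
  \<open>chart_gradient_comparison\<close>.\<close>

lemma has_derivative_imp_tendsto_quotient:
  fixes F :: "'v::real_normed_vector \<Rightarrow> real"
  assumes "(F has_derivative D) (at x)"
  shows "(\<lambda>n. (F (x + (1 / real (Suc n)) *\<^sub>R v) - F x) / (1 / real (Suc n))) \<longlonglongrightarrow> D v"
proof -
  have lin: "linear D" using assms by (rule has_derivative_linear)
  have "((\<lambda>t. x + t *\<^sub>R v) has_derivative (\<lambda>t. t *\<^sub>R v)) (at 0)"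
    by (auto intro!: derivative_eq_intros)
  moreover have "(F has_derivative D) (at (x + 0 *\<^sub>R v))" using assms by simp
  ultimately have "((\<lambda>t. F (x + t *\<^sub>R v)) has_derivative (\<lambda>t. D (t *\<^sub>R v))) (at 0)"
    by (rule has_derivative_compose)
  then have "((\<lambda>t. F (x + t *\<^sub>R v)) has_real_derivative D v) (at 0)"
    by (simp add: has_field_derivative_def linear_scale[OF lin] mult_commute_abs)
  then have lim: "((\<lambda>h. (F (x + h *\<^sub>R v) - F x) / h) \<longlongrightarrow> D v) (at 0)"
    by (simp add: DERIV_def)
  show ?thesis
    by (rule filterlim_compose[OF lim])
      (rule filterlim_mono[OF filterlim_inverse_Suc_at_right at_le order_refl], simp)
qed

section \<open>Positive definite forms\<close>

lemma bilinear_form_expand: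
  fixes B :: "'e::euclidean_space \<Rightarrow> 'e \<Rightarrow> real"
  assumes "bilinear B"
  shows "B u v = (\<Sum>b\<in>Basis. \<Sum>b'\<in>Basis. (u \<bullet> b) * (v \<bullet> b') * B b b')"
proof -
  have "B u v = B (\<Sum>b\<in>Basis. (u \<bullet> b) *\<^sub>R b) (\<Sum>b\<in>Basis. (v \<bullet> b) *\<^sub>R b)"
    by (simp add: euclidean_representation)
  also have "\<dots> = (\<Sum>(b, b')\<in>Basis \<times> Basis. B ((u \<bullet> b) *\<^sub>R b) ((v \<bullet> b') *\<^sub>R b'))"
    by (rule bilinear_sum[OF assms])
  also have "\<dots> = (\<Sum>b\<in>Basis. \<Sum>b'\<in>Basis. (u \<bullet> b) * (v \<bullet> b') * B b b')"
    by (simp add: sum.cartesian_product bilinear_lmul[OF assms] bilinear_rmul[OF assms] mult_ac)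
  finally show ?thesis .
qed

lemma bilinear_form_upper:
  fixes B :: "'e::euclidean_space \<Rightarrow> 'e \<Rightarrow> real"
  assumes "bilinear B"
  obtains C where "C > 0" "\<And>v. B v v \<le> C * (norm v)\<^sup>2"
proof -
  obtain K where K: "K > 0" "\<And>a b. norm (B a b) \<le> norm a * norm b * K"
    using assms bounded_bilinear.pos_bounded bilinear_conv_bounded_bilinear by blast
  have "B v v \<le> K * (norm v)\<^sup>2" for v
    using K(2)[of v v] by (simp add: power2_eq_square mult.commute abs_le_iff)
  then show thesis using that K(1) by blast
qed

text \<open>The constant is the minimum of the form on the unit sphere, which is attained by
  compactness and hence positive. Homogeneity does the rest.\<close>

lemma positive_definite_lower:
  fixes B :: "'e::euclidean_space \<Rightarrow> 'e \<Rightarrow> real"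
  assumes bil: "bilinear B" and pos: "\<And>v. v \<noteq> 0 \<Longrightarrow> B v v > 0"
  obtains c where "c > 0" "\<And>v. c * (norm v)\<^sup>2 \<le> B v v"
proof -
  have "continuous_on (sphere 0 1) (\<lambda>v. B v v)"
    using bil by (intro bounded_bilinear.continuous_on[of B] continuous_intros) (simp_all add: bilinear_conv_bounded_bilinear)
  moreover have "sphere (0::'e) 1 \<noteq> {}" by simp
  ultimately obtain u where u: "u \<in> sphere 0 1" "\<And>v. v \<in> sphere 0 1 \<Longrightarrow> B u u \<le> B v v"
    using continuous_attains_inf[OF compact_sphere, of 0 1 "\<lambda>v. B v v"] by blast
  have "B u u * (norm v)\<^sup>2 \<le> B v v" for v
  proof (cases "v = 0")
    case True
    then show ?thesis using bilinear_lzero[OF bil] by simp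
  next
    case False
    have "B u u \<le> B (v /\<^sub>R norm v) (v /\<^sub>R norm v)"
      by (rule u(2)) (use False in simp)
    also have "\<dots> = B v v / (norm v)\<^sup>2"
      by (simp add: bilinear_lmul[OF bil] bilinear_rmul[OF bil] power2_eq_square divide_simps)
    finally show ?thesis using False by (simp add: pos_le_divide_eq)
  qed
  moreover have "B u u > 0" using u(1) by (intro pos) auto
  ultimately show thesis using that by blast
qed

lemma form_cauchy_schwarz:
  fixes B :: "'e::real_vector \<Rightarrow> 'e \<Rightarrow> real"
  assumes bil: "bilinear B" and sym: "\<And>u v. B u v = B v u" and pos: "\<And>v. 0 \<le> B v v" and zero: "B v v = 0 \<Longrightarrow> v = 0"
  shows "(B u v)\<^sup>2 \<le> B u u * B v v"
proof (cases "v = 0")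
  case True
  then show ?thesis using bilinear_rzero[OF bil] by simp
next
  case False
  then have vv: "B v v > 0" using pos[of v] zero by (auto simp: less_le)
  \<comment> \<open>\<open>t *\<^sub>R v\<close> is the projection of \<open>u\<close> onto the line
    of \<open>v\<close>, orthogonal for \<open>B\<close>.\<close>
  define t where "t = B u v / B v v"
  have "0 \<le> B (u - t *\<^sub>R v) (u - t *\<^sub>R v)" by (rule pos)
  also have "\<dots> = B u u - t * B u v - t * B v u + t * t * B v v"
    by (simp add: bilinear_lsub[OF bil] bilinear_rsub[OF bil] bilinear_lmul[OF bil] bilinear_rmul[OF bil] algebra_simps)
  also have "\<dots> = B u u - (B u v)\<^sup>2 / B v v"
    using vv by (simp add: t_def sym[of v u] power2_eq_square)
  finally show ?thesis using vv by (simp add: pos_divide_le_eq)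
qed

text \<open>The Riesz representation for \<open>B\<close> instead of the Euclidean product:
  \<open>T w\<close> is the Euclidean vector representing \<open>B w\<close>. Positivity makes
  \<open>T\<close> injective, and finite dimension makes it surjective.\<close>

lemma form_representation:
  fixes B :: "'e::euclidean_space \<Rightarrow> 'e \<Rightarrow> real"
  assumes bil: "bilinear B" and pos: "\<And>v. v \<noteq> 0 \<Longrightarrow> B v v > 0" and D: "linear D"
  obtains w where "\<And>v. B w v = D v"
proof -
  define T where "T w = (\<Sum>b\<in>Basis. B w b *\<^sub>R b)" for w
  have lin: "linear T"
    unfolding T_def
    by (rule linearI) (simp_all add: bilinear_ladd[OF bil] bilinear_lmul[OF bil] scaleR_left_distrib sum.distrib scaleR_sum_right)
  have T: "T w \<bullet> b = B w b" if "b \<in> Basis" for w b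
    using that by (simp add: T_def inner_sum_left inner_Basis if_distrib cong: if_cong)
  have rep: "B w v = T w \<bullet> v" for w v
  proof -
    have "B w v = B w (\<Sum>b\<in>Basis. (v \<bullet> b) *\<^sub>R b)" by (simp add: euclidean_representation)
    also have "\<dots> = (\<Sum>b\<in>Basis. (v \<bullet> b) * B w b)"
      using bil unfolding bilinear_def by (simp add: linear_sum linear_scale)
    also have "\<dots> = T w \<bullet> v"
      by (simp add: T_def inner_sum_left inner_commute[of v] mult.commute)
    finally show ?thesis .
  qed
  have "inj T"
    unfolding linear_injective_0[OF lin] using rep pos by (metis inner_zero_left less_irrefl)
  then have "surj T" by (rule linear_injective_imp_surjective[OF lin]) simp
  then obtain w where w: "T w = (\<Sum>b\<in>Basis. D b *\<^sub>R b)" by (metis surjD)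
  have "B w v = D v" for v
  proof -
    have "B w v = (\<Sum>b\<in>Basis. D b * (v \<bullet> b))"
      by (simp add: rep w inner_sum_left inner_commute[of v])
    also have "\<dots> = D (\<Sum>b\<in>Basis. (v \<bullet> b) *\<^sub>R b)"
      by (simp add: linear_sum[OF D] linear_scale[OF D] mult.commute)
    finally show ?thesis by (simp add: euclidean_representation)
  qed
  then show thesis by (rule that)
qed

text \<open>Cauchy-Schwarz bounds each quotient by \<open>B w w\<close>, with equality at
  \<open>v = w\<close>; by continuity away from 0, directions in a dense set come arbitrarily close
  to this value. When \<open>B w\<close> is a differential, the left-hand side gives its squared
  dual norm without mentioning \<open>w\<close>, as a supremum that is countable if \<open>Q\<close>
  is.\<close>

lemma form_dual_norm_dense:
  fixes B :: "'e::euclidean_space \<Rightarrow> 'e \<Rightarrow> real"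
  assumes bil: "bilinear B" and sym: "\<And>u v. B u v = B v u" and pos: "\<And>v. v \<noteq> 0 \<Longrightarrow> B v v > 0"
    and dense: "\<And>X. open X \<Longrightarrow> X \<noteq> {} \<Longrightarrow> \<exists>d\<in>Q. d \<in> X"
  shows "(SUP v\<in>Q - {0}. ennreal ((B w v)\<^sup>2 / B v v)) = ennreal (B w w)"
proof (rule antisym)
  have nonneg: "0 \<le> B v v" for v using pos[of v] bilinear_lzero[OF bil] by (cases "v = 0") auto
  have bcont: "continuous_on A (\<lambda>x. B (h x) (k x))" if "continuous_on A h" "continuous_on A k"
    for A :: "'e set" and h k
    using bil that by (intro bounded_bilinear.continuous_on[of B]) (simp_all add: bilinear_conv_bounded_bilinear)
  show "(SUP v\<in>Q - {0}. ennreal ((B w v)\<^sup>2 / B v v)) \<le> ennreal (B w w)"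
  proof (rule SUP_least, rule ennreal_leI)
    fix v assume v: "v \<in> Q - {0}"
    then have "B v v > 0" using pos by simp
    moreover have "(B w v)\<^sup>2 \<le> B w w * B v v"
      using form_cauchy_schwarz[OF bil sym nonneg, of v w] pos[of v] by fastforce
    ultimately show "(B w v)\<^sup>2 / B v v \<le> B w w" by (simp add: pos_divide_le_eq)
  qed
  show "ennreal (B w w) \<le> (SUP v\<in>Q - {0}. ennreal ((B w v)\<^sup>2 / B v v))"
  proof (cases "w = 0")
    case True
    then show ?thesis using bilinear_lzero[OF bil] by simp
  next
    case False
    show ?thesis
    proof (rule ccontr)
      assume "\<not> ?thesis"
      then have less: "(SUP v\<in>Q - {0}. ennreal ((B w v)\<^sup>2 / B v v)) < ennreal (B w w)" by simp
      then obtain h where h: "(SUP v\<in>Q - {0}. ennreal ((B w v)\<^sup>2 / B v v)) = ennreal h" "0 \<le> h"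
        by (cases "SUP v\<in>Q - {0}. ennreal ((B w v)\<^sup>2 / B v v)") auto
      have hB: "h < B w w" using less unfolding h(1) using h(2) nonneg[of w] by (simp add: ennreal_less_iff)
      have "continuous_on (- {0}) (\<lambda>v. (B w v)\<^sup>2 / B v v)"
        by (intro continuous_intros bcont) (use pos in force)
      from continuous_open_preimage[OF this _ open_greaterThan[of h]]
      have "open (- {0} \<inter> (\<lambda>v. (B w v)\<^sup>2 / B v v) -` {h<..})" by (simp add: open_Compl)
      moreover have "w \<in> - {0} \<inter> (\<lambda>v. (B w v)\<^sup>2 / B v v) -` {h<..}"
        using False hB pos[OF False] by (simp add: power2_eq_square)
      ultimately obtain v where v: "v \<in> Q" "v \<noteq> 0" "h < (B w v)\<^sup>2 / B v v" using dense by blast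
      have "ennreal ((B w v)\<^sup>2 / B v v) \<le> ennreal h"
        unfolding h(1)[symmetric] by (rule SUP_upper) (use v in auto)
      then show False using v(3) h(2) by (simp add: ennreal_le_iff)
    qed
  qed
qed

section \<open>Derivatives in power spaces and increments along curves\<close>

lemma norm_axis_eq: "norm (axis k x :: 'e::real_normed_vector^'n::finite) = norm x"
  by (simp add: norm_vec_def L2_set_def axis_def if_distrib[of norm] if_distrib[of "\<lambda>r. r\<^sup>2"] cong: if_cong)

lemma bounded_linear_axis: "bounded_linear (axis k :: 'e::real_normed_vector \<Rightarrow> 'e^'n::finite)"
  by (rule bounded_linear_intro[where K = 1]) (simp_all add: vec_eq_iff axis_def norm_axis_eq[unfolded axis_def])

lemma vec_eq_sum_axis: "(\<chi> k. f k) = (\<Sum>k\<in>UNIV. axis k (f k))" for f :: "'n::finite \<Rightarrow> 'e::real_normed_vector"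
proof -
  have "(\<Sum>k\<in>UNIV. axis k (f k) $ j) = f j" for j
    by (simp add: axis_def if_distrib cong: if_cong)
  then show ?thesis by (simp add: vec_eq_iff)
qed

lemma has_vector_derivative_vec_lambda:
  fixes f :: "'n::finite \<Rightarrow> real \<Rightarrow> 'e::real_normed_vector"
  assumes "\<And>k. (f k has_vector_derivative v k) (at t)"
  shows "((\<lambda>t. \<chi> k. f k t) has_vector_derivative (\<chi> k. v k)) (at t)"
  unfolding vec_eq_sum_axis
  by (rule has_vector_derivative_sum, rule bounded_linear.has_vector_derivative[OF bounded_linear_axis], rule assms)

text \<open>The derivative may be unbounded near the points of \<open>S\<close>. Either the
  right-hand side is infinite, or the derivative is Lebesgue integrable; then the fundamental
  theorem for the gauge integral, which tolerates finitely many exceptional points, identifies its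
  integral with the increment.\<close>

lemma increment_le_nn_integral_derivative:
  fixes \<phi> :: "real \<Rightarrow> real"
  assumes ab: "a \<le> b" and S: "finite S" and cont: "continuous_on {a..b} \<phi>"
    and deriv: "\<And>t. t \<in> {a<..<b} - S \<Longrightarrow> (\<phi> has_vector_derivative \<phi>' t) (at t)"
    and C1: "continuous_on ({a<..<b} - S) \<phi>'"
  shows "ennreal (\<phi> b - \<phi> a) \<le> (\<integral>\<^sup>+t. ennreal (indicator ({a<..<b} - S) t * \<bar>\<phi>' t\<bar>) \<partial>lborel)"
proof -
  define g where "g t = indicator ({a<..<b} - S) t *\<^sub>R \<phi>' t" for t
  have "{a<..<b} - S \<in> sets borel" using S by (intro sets.Diff) (auto simp: finite_imp_closed)
  then have meas: "g \<in> borel_measurable borel"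
    unfolding g_def by (rule borel_measurable_continuous_on_indicator[OF _ C1])
  have abs_g: "ennreal (indicator ({a<..<b} - S) t * \<bar>\<phi>' t\<bar>) = ennreal (norm (g t))" for t
    by (simp add: g_def abs_mult)
  show ?thesis
    unfolding abs_g
  proof (cases "(\<integral>\<^sup>+t. ennreal (norm (g t)) \<partial>lborel) = \<infinity>")
    case False
    then have int: "integrable lborel g"
      using meas by (simp add: integrable_iff_bounded less_top)
    have "(\<phi>' has_integral (\<phi> b - \<phi> a)) {a..b}"
      by (rule fundamental_theorem_of_calculus_interior_strong[OF S ab deriv cont])
    then have "(g has_integral (\<phi> b - \<phi> a)) {a..b}"
      by (rule has_integral_spike_finite[of "S \<union> {a, b}", rotated 2]) (use S in \<open>auto simp: g_def\<close>)
    moreover have "(g has_integral integral\<^sup>L lborel g) UNIV"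
      by (rule has_integral_integral_lborel[OF int])
    then have "((\<lambda>t. if t \<in> {a..b} then g t else 0) has_integral integral\<^sup>L lborel g) UNIV"
      by (rule has_integral_eq[rotated]) (auto simp: g_def indicator_def)
    then have "(g has_integral integral\<^sup>L lborel g) {a..b}"
      by (simp only: has_integral_restrict_UNIV)
    ultimately have eq: "\<phi> b - \<phi> a = integral\<^sup>L lborel g"
      by (rule has_integral_unique)
    have "ennreal (\<phi> b - \<phi> a) \<le> ennreal (\<integral>t. norm (g t) \<partial>lborel)"
      unfolding eq by (intro ennreal_leI integral_mono int integrable_norm) auto
    also have "\<dots> = (\<integral>\<^sup>+t. ennreal (norm (g t)) \<partial>lborel)"
      by (rule nn_integral_eq_integral[symmetric]) (use int in auto)
    finally show "ennreal (\<phi> b - \<phi> a) \<le> (\<integral>\<^sup>+t. ennreal (norm (g t)) \<partial>lborel)" .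
  qed simp
qed

lemma ennreal_le_divide_if:
  assumes "ennreal a \<le> A" "d \<le> ennreal b" "0 < a" "0 < b"
  shows "ennreal (a / b) \<le> A / d"
proof (cases d)
  case (real d')
  show ?thesis
  proof (cases "d' = 0")
    \<comment> \<open>The numerator \<open>A\<close> is positive, and a positive
      \<open>ennreal\<close> divided by 0 is \<infinity>.\<close>
    case True
    then show ?thesis using real assms(1,3) by auto
  next
    case False
    then have d': "0 < d'" "d' \<le> b" using real assms by (auto simp: ennreal_le_iff)
    then have "ennreal (a / b) \<le> ennreal (a / d')" using assms by (intro ennreal_leI frac_le) auto
    also have "\<dots> = ennreal a / ennreal d'" using d' assms by (simp add: divide_ennreal)
    also have "\<dots> \<le> A / d" unfolding real by (rule divide_right_mono_ennreal[OF assms(1)])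
    finally show ?thesis .
  qed
qed (use assms in \<open>auto simp: top_unique\<close>)

section \<open>Geometry of a Riemannian manifold and of its powers\<close>

text \<open>To avoid the measurability of \<^term>\<open>grad_norm\<close>, Borel functions are placed between the
  squared partial gradients and the squared full gradient.\<close>

definition separates_gradients ::
  "('i, 'a::topological_space, 'e::real_normed_vector) riemannian \<Rightarrow> (('n::finite \<Rightarrow> 'a) \<Rightarrow> real) \<Rightarrow> ('n \<Rightarrow> 'a) \<Rightarrow> ('n \<Rightarrow> ennreal) \<Rightarrow> bool" where
  "separates_gradients M f x u \<longleftrightarrow>
     (\<forall>k. (grad_norm M (\<lambda>y. f (x(k := y))) (x k))\<^sup>2 \<le> u k) \<and> (\<Sum>k\<in>UNIV. u k) \<le> (grad_norm (riemannian_power M) f x)\<^sup>2"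

section \<open>Charts, the metric in coordinates, and the speed of curves\<close>

context
  fixes M :: "('i, 'a::{second_countable_topology, t2_space}, 'e::euclidean_space) riemannian"
  assumes manifold: "riemannian_manifold M"
begin

lemma atlas: "smooth_atlas M" and metric: "riemannian_metric M"
  using manifold by (auto simp: riemannian_manifold_def)

lemma chart_exists: "\<exists>c\<in>charts M. p \<in> chart_dom M c"
  using atlas unfolding smooth_atlas_def by blast

lemma open_chart_dom: "c \<in> charts M \<Longrightarrow> open (chart_dom M c)"
  and open_chart_im: "c \<in> charts M \<Longrightarrow> open (chart_im M c)"
  and chart_homeo: "c \<in> charts M \<Longrightarrow> homeomorphism (chart_dom M c) (chart_im M c) (coord M c) (param M c)"
  using atlas unfolding smooth_atlas_def by blast+

lemma continuous_coord: "c \<in> charts M \<Longrightarrow> continuous_on (chart_dom M c) (coord M c)"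
  and continuous_param: "c \<in> charts M \<Longrightarrow> continuous_on (chart_im M c) (param M c)"
  and coord_in: "c \<in> charts M \<Longrightarrow> p \<in> chart_dom M c \<Longrightarrow> coord M c p \<in> chart_im M c"
  and param_in: "c \<in> charts M \<Longrightarrow> x \<in> chart_im M c \<Longrightarrow> param M c x \<in> chart_dom M c"
  and param_coord: "c \<in> charts M \<Longrightarrow> p \<in> chart_dom M c \<Longrightarrow> param M c (coord M c p) = p"
  and coord_param: "c \<in> charts M \<Longrightarrow> x \<in> chart_im M c \<Longrightarrow> coord M c (param M c x) = x"
  using chart_homeo[of c] unfolding homeomorphism_def by auto

lemma transition_differentiable:
  assumes "c \<in> charts M" "d \<in> charts M" "x \<in> chart_im M c" "param M c x \<in> chart_dom M d"
  shows "transition M c d differentiable (at x)"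
proof -
  have "x \<in> coord M c ` (chart_dom M c \<inter> chart_dom M d)"
    using assms coord_param param_in by force
  moreover have "Ck_on (Suc 0) (coord M c ` (chart_dom M c \<inter> chart_dom M d)) (transition M c d)"
    using atlas assms(1,2) unfolding smooth_atlas_def smooth_on_def by blast
  ultimately show ?thesis unfolding Ck_on.simps by blast
qed

lemma transition_derivative_continuous:
  assumes "c \<in> charts M" "d \<in> charts M"
  shows "continuous_on (coord M c ` (chart_dom M c \<inter> chart_dom M d)) (\<lambda>x. frechet_derivative (transition M c d) (at x) v)"
proof -
  have "Ck_on (Suc 0) (coord M c ` (chart_dom M c \<inter> chart_dom M d)) (transition M c d)"
    using atlas assms(1,2) unfolding smooth_atlas_def smooth_on_def by blast
  then show ?thesis by simp
qed

lemma metric_bilinear: "c \<in> charts M \<Longrightarrow> p \<in> chart_dom M c \<Longrightarrow> bilinear (metric M c p)"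
  and metric_sym: "c \<in> charts M \<Longrightarrow> p \<in> chart_dom M c \<Longrightarrow> metric M c p u v = metric M c p v u"
  and metric_pos: "c \<in> charts M \<Longrightarrow> p \<in> chart_dom M c \<Longrightarrow> v \<noteq> 0 \<Longrightarrow> 0 < metric M c p v v"
  using metric unfolding riemannian_metric_def by blast+

lemma metric_nonneg: "c \<in> charts M \<Longrightarrow> p \<in> chart_dom M c \<Longrightarrow> 0 \<le> metric M c p v v"
  using metric_pos[of c p v] bilinear_lzero[OF metric_bilinear, of c p] by (cases "v = 0") auto

lemma metric_change:
  "c \<in> charts M \<Longrightarrow> d \<in> charts M \<Longrightarrow> p \<in> chart_dom M c \<Longrightarrow> p \<in> chart_dom M d \<Longrightarrow>
   metric M c p u v =
     metric M d p (frechet_derivative (transition M c d) (at (coord M c p)) u)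
       (frechet_derivative (transition M c d) (at (coord M c p)) v)"
  using metric unfolding riemannian_metric_def Let_def by blast

lemma metric_continuous:
  assumes "c \<in> charts M"
  shows "continuous_on (chart_im M c) (\<lambda>x. metric M c (param M c x) u v)"
proof -
  have "Ck_on 0 (chart_im M c) (\<lambda>x. metric M c (param M c x) u v)"
    using metric assms unfolding riemannian_metric_def smooth_on_def by blast
  then show ?thesis by simp
qed

text \<open>Continuity of the finitely many coefficients on basis vectors gives an error of at most
  \<open>N * N * \<delta> * (norm v)\<^sup>2\<close>, and the positive lower bound of the form at
  \<open>p\<close> turns this into an error relative to that form, uniformly in
  \<open>v\<close>.\<close>

lemma metric_comparison:
  assumes c: "c \<in> charts M" and p: "p \<in> chart_dom M c" and \<epsilon>: "\<epsilon> > 0"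
  obtains r where "r > 0" "ball (coord M c p) r \<subseteq> chart_im M c"
    "\<And>x v. x \<in> ball (coord M c p) r \<Longrightarrow> (1 - \<epsilon>) * metric M c p v v \<le> metric M c (param M c x) v v"
    "\<And>x v. x \<in> ball (coord M c p) r \<Longrightarrow> metric M c (param M c x) v v \<le> (1 + \<epsilon>) * metric M c p v v"
proof -
  let ?\<xi> = "coord M c p"
  obtain l where l: "l > 0" "\<And>v. l * (norm v)\<^sup>2 \<le> metric M c p v v"
    using positive_definite_lower[OF metric_bilinear metric_pos, OF c p c p] by blast
  define N where "N = real DIM('e)"
  \<comment> \<open>There are \<open>N * N\<close> pairs of basis vectors, and \<open>l\<close> is
    the lower bound of the form at \<open>p\<close>.\<close>
  define \<delta> where "\<delta> = \<epsilon> * l / (N * N)"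
  have N: "N > 0" by (simp add: N_def)
  have \<delta>: "\<delta> > 0" "N * N * \<delta> = \<epsilon> * l" using \<epsilon> l N by (auto simp: \<delta>_def)
  have \<xi>: "?\<xi> \<in> chart_im M c" by (rule coord_in[OF c p])
  have "\<forall>\<^sub>F x in at ?\<xi>. \<forall>b\<in>Basis. \<forall>b'\<in>Basis. dist (metric M c (param M c x) b b') (metric M c p b b') < \<delta>"
  proof (intro eventually_ball_finite ballI finite_Basis)
    fix b b' :: 'e
    have "isCont (\<lambda>x. metric M c (param M c x) b b') ?\<xi>"
      using metric_continuous[OF c] open_chart_im[OF c] \<xi> by (simp add: continuous_on_eq_continuous_at)
    then show "\<forall>\<^sub>F x in at ?\<xi>. dist (metric M c (param M c x) b b') (metric M c p b b') < \<delta>"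
      unfolding isCont_def using \<delta>(1) param_coord[OF c p] by (auto dest: tendstoD)
  qed
  moreover have "\<forall>\<^sub>F x in at ?\<xi>. x \<in> chart_im M c"
    using open_chart_im[OF c] \<xi> by (rule eventually_at_in_open')
  ultimately have "\<forall>\<^sub>F x in at ?\<xi>. x \<in> chart_im M c \<and>
      (\<forall>b\<in>Basis. \<forall>b'\<in>Basis. dist (metric M c (param M c x) b b') (metric M c p b b') < \<delta>)"
    by eventually_elim auto
  then obtain r where r: "r > 0" "\<And>x. x \<noteq> ?\<xi> \<Longrightarrow> dist x ?\<xi> < r \<Longrightarrow> x \<in> chart_im M c \<and>
      (\<forall>b\<in>Basis. \<forall>b'\<in>Basis. dist (metric M c (param M c x) b b') (metric M c p b b') < \<delta>)"
    unfolding eventually_at by blast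
  have im: "x \<in> chart_im M c" if "x \<in> ball ?\<xi> r" for x
    using r(2)[of x] that \<xi> by (cases "x = ?\<xi>") (auto simp: dist_commute)
  have close: "\<bar>metric M c (param M c x) v v - metric M c p v v\<bar> \<le> \<epsilon> * metric M c p v v" if x: "x \<in> ball ?\<xi> r" for x v
  proof -
    have pd: "param M c x \<in> chart_dom M c" by (rule param_in[OF c im[OF x]])
    have small: "\<bar>metric M c (param M c x) b b' - metric M c p b b'\<bar> \<le> \<delta>" if "b \<in> Basis" "b' \<in> Basis" for b b'
    proof (cases "x = ?\<xi>")
      case True
      then show ?thesis using \<delta>(1) param_coord[OF c p] by simp
    next
      case False
      moreover have "dist x ?\<xi> < r" using x by (simp add: dist_commute)
      ultimately have "dist (metric M c (param M c x) b b') (metric M c p b b') < \<delta>"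
        using r(2) that by blast
      then show ?thesis by (simp add: dist_real_def)
    qed
    have "metric M c (param M c x) v v - metric M c p v v =
      (\<Sum>b\<in>Basis. \<Sum>b'\<in>Basis. (v \<bullet> b) * (v \<bullet> b') * (metric M c (param M c x) b b' - metric M c p b b'))"
      by (subst bilinear_form_expand[OF metric_bilinear[OF c pd]], subst bilinear_form_expand[OF metric_bilinear[OF c p]])
        (simp add: sum_subtractf[symmetric] right_diff_distrib)
    also have "\<bar>\<dots>\<bar> \<le> (\<Sum>b\<in>(Basis::'e set). \<Sum>b'\<in>(Basis::'e set). (norm v)\<^sup>2 * \<delta>)"
    proof (intro order_trans[OF sum_abs] sum_mono)
      fix b b' :: 'e assume b: "b \<in> Basis" "b' \<in> Basis"
      have "\<bar>v \<bullet> b\<bar> \<le> norm v" "\<bar>v \<bullet> b'\<bar> \<le> norm v" using b Basis_le_norm by auto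
      then have "\<bar>v \<bullet> b\<bar> * \<bar>v \<bullet> b'\<bar> \<le> (norm v)\<^sup>2"
        unfolding power2_eq_square by (intro mult_mono) auto
      then show "\<bar>(v \<bullet> b) * (v \<bullet> b') * (metric M c (param M c x) b b' - metric M c p b b')\<bar> \<le> (norm v)\<^sup>2 * \<delta>"
        unfolding abs_mult using small[OF b] by (intro mult_mono) auto
    qed
    also have "\<dots> = (N * N * \<delta>) * (norm v)\<^sup>2"
      by (simp add: N_def)
    also have "\<dots> = \<epsilon> * (l * (norm v)\<^sup>2)"
      by (simp add: \<delta>(2))
    also have "\<dots> \<le> \<epsilon> * metric M c p v v"
      using l(2) \<epsilon> by (intro mult_left_mono) auto
    finally show ?thesis .
  qed
  show thesis
  proof (rule that[OF r(1)])
    show "ball ?\<xi> r \<subseteq> chart_im M c" using im by blast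
  qed (use close in \<open>auto simp: abs_le_iff algebra_simps\<close>)
qed

text \<open>A coordinate map is meaningful only on its domain. Continuity keeps the curve in the
  domain of \<open>c\<close> near \<open>t\<close>, where its second coordinate expression is the
  transition map after the first one, and the chain rule applies.\<close>

lemma chart_change_derivative:
  assumes c: "c \<in> charts M" and d: "d \<in> charts M" and p: "\<gamma> t \<in> chart_dom M c" "\<gamma> t \<in> chart_dom M d"
    and cont: "isCont \<gamma> t" and deriv: "(coord M c \<circ> \<gamma> has_vector_derivative v) (at t)"
  shows "(coord M d \<circ> \<gamma> has_vector_derivative
    frechet_derivative (transition M c d) (at (coord M c (\<gamma> t))) v) (at t)"
proof -
  let ?D = "frechet_derivative (transition M c d) (at (coord M c (\<gamma> t)))"
  have "transition M c d differentiable (at (coord M c (\<gamma> t)))"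
    by (rule transition_differentiable[OF c d coord_in[OF c p(1)]])
      (simp add: param_coord[OF c p(1)] p(2))
  then have D: "(transition M c d has_derivative ?D) (at ((coord M c \<circ> \<gamma>) t))"
    by (simp add: frechet_derivative_works)
  have lin: "linear ?D" using D has_derivative_linear by auto
  have chain: "((transition M c d \<circ> (coord M c \<circ> \<gamma>)) has_derivative (\<lambda>h. h *\<^sub>R ?D v)) (at t)"
    using diff_chain_at[OF deriv[unfolded has_vector_derivative_def] D] by (simp add: o_def linear_scale[OF lin])
  have "\<forall>\<^sub>F s in at t. \<gamma> s \<in> chart_dom M c"
    using cont open_chart_dom[OF c] p(1) unfolding isCont_def by (rule topological_tendstoD)
  then have "\<forall>\<^sub>F s in at t. (transition M c d \<circ> (coord M c \<circ> \<gamma>)) s = (coord M d \<circ> \<gamma>) s"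
    by eventually_elim (simp add: transition_def param_coord[OF c])
  then show ?thesis
    unfolding has_vector_derivative_def
    by (rule has_derivative_transform_eventually[OF chain]) (simp_all add: transition_def param_coord[OF c p(1)])
qed

lemma speed_eq:
  assumes c: "c \<in> charts M" and p: "\<gamma> t \<in> chart_dom M c"
    and cont: "isCont \<gamma> t" and deriv: "(coord M c \<circ> \<gamma> has_vector_derivative v) (at t)"
  shows "speed M \<gamma> t = sqrt (metric M c (\<gamma> t) v v)"
proof -
  define d where "d = (SOME c. c \<in> charts M \<and> \<gamma> t \<in> chart_dom M c)"
  have d: "d \<in> charts M" "\<gamma> t \<in> chart_dom M d"
    unfolding d_def using someI[of "\<lambda>c. c \<in> charts M \<and> \<gamma> t \<in> chart_dom M c" c] c p by auto
  have "vector_derivative (coord M d \<circ> \<gamma>) (at t) = frechet_derivative (transition M c d) (at (coord M c (\<gamma> t))) v"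
    by (rule vector_derivative_at[OF chart_change_derivative[OF c d(1) p d(2) cont deriv]])
  then show ?thesis
    unfolding speed_def Let_def d_def[symmetric] using metric_change[OF c d(1) p d(2), of v v] by simp
qed

lemma piecewise_C1_curve_derivatives:
  assumes "piecewise_C1_curve M \<gamma>"
  obtains S where "finite S" "\<And>t. t \<in> {0<..<1} - S \<Longrightarrow> isCont \<gamma> t"
    "\<And>t c. t \<in> {0<..<1} - S \<Longrightarrow> c \<in> charts M \<Longrightarrow> \<gamma> t \<in> chart_dom M c \<Longrightarrow>
      (coord M c \<circ> \<gamma> has_vector_derivative vector_derivative (coord M c \<circ> \<gamma>) (at t)) (at t)"
    "\<And>c. c \<in> charts M \<Longrightarrow>
      continuous_on {t \<in> {0<..<1} - S. \<gamma> t \<in> chart_dom M c} (\<lambda>t. vector_derivative (coord M c \<circ> \<gamma>) (at t))"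
proof -
  obtain S where S: "finite S" "\<And>c. c \<in> charts M \<Longrightarrow> (coord M c \<circ> \<gamma>) C1_differentiable_on {t \<in> {0<..<1} - S. \<gamma> t \<in> chart_dom M c}"
    using assms unfolding piecewise_C1_curve_def by blast
  have "continuous_on {0<..<1} \<gamma>"
    using assms unfolding piecewise_C1_curve_def path_def by (auto intro: continuous_on_subset)
  then have cont: "isCont \<gamma> t" if "t \<in> {0<..<1} - S" for t
    using that by (simp add: continuous_on_eq_continuous_at)
  show thesis
    by (rule that[OF S(1) cont]) (use S(2) in \<open>auto simp: C1_differentiable_on_eq vector_derivative_works[symmetric]\<close>)
qed

text \<open>An existential form of the preceding rule, from which exceptional sets can be chosen for
  all factors of a power at once.\<close>

lemma piecewise_C1_curve_has_derivatives:
  assumes "piecewise_C1_curve M \<gamma>"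
  shows "\<exists>S. finite S \<and> (\<forall>t\<in>{0<..<1} - S. isCont \<gamma> t \<and> (\<forall>c\<in>charts M. \<gamma> t \<in> chart_dom M c \<longrightarrow>
      (coord M c \<circ> \<gamma> has_vector_derivative vector_derivative (coord M c \<circ> \<gamma>) (at t)) (at t)))"
proof (rule piecewise_C1_curve_derivatives[OF assms], goal_cases)
  case (1 S)
  then show ?case by blast
qed

lemma speed_nonneg_AE:
  assumes "piecewise_C1_curve M \<gamma>"
  obtains S where "finite S" "\<And>t. t \<in> {0<..<1} - S \<Longrightarrow> 0 \<le> speed M \<gamma> t"
proof -
  obtain S where S: "finite S" "\<And>t. t \<in> {0<..<1} - S \<Longrightarrow> isCont \<gamma> t"
    "\<And>t c. t \<in> {0<..<1} - S \<Longrightarrow> c \<in> charts M \<Longrightarrow> \<gamma> t \<in> chart_dom M c \<Longrightarrow>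
      (coord M c \<circ> \<gamma> has_vector_derivative vector_derivative (coord M c \<circ> \<gamma>) (at t)) (at t)"
    using piecewise_C1_curve_has_derivatives[OF assms] by blast
  have "0 \<le> speed M \<gamma> t" if t: "t \<in> {0<..<1} - S" for t
  proof -
    obtain c where c: "c \<in> charts M" "\<gamma> t \<in> chart_dom M c" using chart_exists by blast
    show ?thesis
      using speed_eq[OF c S(2)[OF t] S(3)[OF t c]] metric_nonneg[OF c] by simp
  qed
  then show thesis by (rule that[OF S(1)])
qed

section \<open>Curves, lengths and distances in powers\<close>

lemma power_charts: "c \<in> charts (riemannian_power M) \<longleftrightarrow> (\<forall>k. c k \<in> charts M)"
  and power_chart_dom: "p \<in> chart_dom (riemannian_power M) c \<longleftrightarrow> (\<forall>k. p k \<in> chart_dom M (c k))"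
  and power_coord: "coord (riemannian_power M) c p = (\<chi> k. coord M (c k) (p k))"
  and power_metric: "metric (riemannian_power M) c p u v = (\<Sum>k\<in>UNIV. metric M (c k) (p k) (u $ k) (v $ k))"
  by (simp_all add: riemannian_power_def)

lemma power_piecewise_C1:
  fixes \<gamma> :: "'n::finite \<Rightarrow> real \<Rightarrow> 'a"
  assumes "\<And>k. piecewise_C1_curve M (\<gamma> k)"
  shows "piecewise_C1_curve (riemannian_power M) (\<lambda>t k. \<gamma> k t)"
proof -
  have "\<forall>k. \<exists>S. finite S \<and> (\<forall>c\<in>charts M. (coord M c \<circ> \<gamma> k) C1_differentiable_on {t \<in> {0<..<1} - S. \<gamma> k t \<in> chart_dom M c})"
    using assms unfolding piecewise_C1_curve_def by blast
  then obtain S where S: "\<And>k. finite (S k)"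
    "\<And>k c. c \<in> charts M \<Longrightarrow> (coord M c \<circ> \<gamma> k) C1_differentiable_on {t \<in> {0<..<1} - S k. \<gamma> k t \<in> chart_dom M c}"
    by metis
  show ?thesis
    unfolding piecewise_C1_curve_def
  proof (intro conjI exI[of _ "\<Union>k. S k"] ballI)
    show "path (\<lambda>t k. \<gamma> k t)"
      using assms unfolding piecewise_C1_curve_def path_def by (intro continuous_on_coordinatewise_then_product) auto
    show "finite (\<Union>k. S k)" using S(1) by simp
    fix c :: "'n \<Rightarrow> 'i" assume "c \<in> charts (riemannian_power M)"
    then have c: "c k \<in> charts M" for k by (simp add: power_charts)
    let ?T = "{t \<in> {0<..<1} - (\<Union>k. S k). (\<lambda>k. \<gamma> k t) \<in> chart_dom (riemannian_power M) c}"
    have "\<forall>k. \<exists>D. (\<forall>t\<in>{t \<in> {0<..<1} - S k. \<gamma> k t \<in> chart_dom M (c k)}. (coord M (c k) \<circ> \<gamma> k has_vector_derivative D t) (at t)) \<and>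
        continuous_on {t \<in> {0<..<1} - S k. \<gamma> k t \<in> chart_dom M (c k)} D"
      using S(2)[OF c] unfolding C1_differentiable_on_def by blast
    from choice[OF this] obtain D where "\<forall>k. (\<forall>t\<in>{t \<in> {0<..<1} - S k. \<gamma> k t \<in> chart_dom M (c k)}. (coord M (c k) \<circ> \<gamma> k has_vector_derivative D k t) (at t)) \<and>
        continuous_on {t \<in> {0<..<1} - S k. \<gamma> k t \<in> chart_dom M (c k)} (D k)" ..
    then have D: "\<And>k. \<forall>t\<in>{t \<in> {0<..<1} - S k. \<gamma> k t \<in> chart_dom M (c k)}. (coord M (c k) \<circ> \<gamma> k has_vector_derivative D k t) (at t)"
      "\<And>k. continuous_on {t \<in> {0<..<1} - S k. \<gamma> k t \<in> chart_dom M (c k)} (D k)"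
      by blast+
    show "(coord (riemannian_power M) c \<circ> (\<lambda>t k. \<gamma> k t)) C1_differentiable_on ?T"
      unfolding C1_differentiable_on_def
    proof (intro exI[of _ "\<lambda>t. \<chi> k. D k t"] conjI ballI)
      show "continuous_on ?T (\<lambda>t. \<chi> k. D k t)"
        by (intro continuous_on_vec_lambda continuous_on_subset[OF D(2)]) (auto simp: power_chart_dom)
      fix t assume "t \<in> ?T"
      then have "(coord M (c k) \<circ> \<gamma> k has_vector_derivative D k t) (at t)" for k
        by (intro bspec[OF D(1)]) (auto simp: power_chart_dom)
      from has_vector_derivative_vec_lambda[OF this]
      show "(coord (riemannian_power M) c \<circ> (\<lambda>t k. \<gamma> k t) has_vector_derivative (\<chi> k. D k t)) (at t)"
        by (simp add: o_def power_coord)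
    qed
  qed
qed

text \<open>The chart that \<open>speed\<close> picks in the power is some family \<open>c\<close>,
  unrelated to the charts it picks in the factors. By \<open>speed_eq\<close> each factor may be
  measured in its own component of \<open>c\<close>, away from the union of the exceptional
  sets.\<close>

lemma power_speed:
  fixes \<gamma> :: "'n::finite \<Rightarrow> real \<Rightarrow> 'a"
  assumes "\<And>k. piecewise_C1_curve M (\<gamma> k)"
  obtains S where "finite S" "\<And>t. t \<in> {0<..<1} - S \<Longrightarrow> speed (riemannian_power M) (\<lambda>t k. \<gamma> k t) t = sqrt (\<Sum>k\<in>UNIV. (speed M (\<gamma> k) t)\<^sup>2)"
proof -
  obtain S where fin: "\<And>k. finite (S k)" and S: "\<And>k. \<forall>t\<in>{0<..<1} - S k. isCont (\<gamma> k) t \<and> (\<forall>c\<in>charts M. \<gamma> k t \<in> chart_dom M c \<longrightarrow>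
      (coord M c \<circ> \<gamma> k has_vector_derivative vector_derivative (coord M c \<circ> \<gamma> k) (at t)) (at t))"
    using piecewise_C1_curve_has_derivatives[OF assms] by metis
  have "speed (riemannian_power M) (\<lambda>t k. \<gamma> k t) t = sqrt (\<Sum>k\<in>UNIV. (speed M (\<gamma> k) t)\<^sup>2)"
    if t: "t \<in> {0<..<1} - (\<Union>k. S k)" for t
  proof -
    define c where "c = (SOME c. c \<in> charts (riemannian_power M) \<and> (\<lambda>k. \<gamma> k t) \<in> chart_dom (riemannian_power M) c)"
    have "\<forall>k. \<exists>c. c \<in> charts M \<and> \<gamma> k t \<in> chart_dom M c"
      using chart_exists by blast
    then obtain c0 where "\<And>k. c0 k \<in> charts M" "\<And>k. \<gamma> k t \<in> chart_dom M (c0 k)"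
      by metis
    then have "c0 \<in> charts (riemannian_power M) \<and> (\<lambda>k. \<gamma> k t) \<in> chart_dom (riemannian_power M) c0"
      by (simp add: power_charts power_chart_dom)
    then have "c \<in> charts (riemannian_power M) \<and> (\<lambda>k. \<gamma> k t) \<in> chart_dom (riemannian_power M) c"
      unfolding c_def by (rule someI[where P = "\<lambda>c. c \<in> charts (riemannian_power M) \<and> (\<lambda>k. \<gamma> k t) \<in> chart_dom (riemannian_power M) c"])
    then have c: "\<And>k. c k \<in> charts M" "\<And>k. \<gamma> k t \<in> chart_dom M (c k)"
      by (simp_all add: power_charts power_chart_dom)
    define v where "v k = vector_derivative (coord M (c k) \<circ> \<gamma> k) (at t)" for k
    have v: "(coord M (c k) \<circ> \<gamma> k has_vector_derivative v k) (at t)" for k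
      unfolding v_def using S[of k] c t by blast
    have cont: "isCont (\<gamma> k) t" for k using S[of k] t by blast
    have sp: "(speed M (\<gamma> k) t)\<^sup>2 = metric M (c k) (\<gamma> k t) (v k) (v k)" for k
      using speed_eq[OF c cont v, of k] metric_nonneg[OF c] by auto
    have "vector_derivative (coord (riemannian_power M) c \<circ> (\<lambda>t k. \<gamma> k t)) (at t) = (\<chi> k. v k)"
      using vector_derivative_at[OF has_vector_derivative_vec_lambda[OF v]] by (simp add: o_def power_coord)
    then show ?thesis
      unfolding speed_def[of "riemannian_power M"] Let_def c_def[symmetric] by (simp add: power_metric sp)
  qed
  then show thesis using fin by (intro that[of "\<Union>k. S k"]) auto
qed

lemma AE_unit_interval_cofinite:
  assumes "finite S" "\<And>t. t \<in> {0<..<1} - S \<Longrightarrow> P t"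
  shows "AE t in lborel. t \<in> {0..1::real} \<longrightarrow> P t"
proof -
  have "AE t in lborel. t \<notin> S \<union> {0, 1}"
    by (rule AE_not_in) (simp add: finite_imp_null_set_lborel assms(1))
  then show ?thesis by eventually_elim (use assms(2) in force)
qed

lemma power_curve_length:
  fixes \<gamma> :: "'n::finite \<Rightarrow> real \<Rightarrow> 'a"
  assumes "\<And>k. piecewise_C1_curve M (\<gamma> k)"
  shows "curve_length (riemannian_power M) (\<lambda>t k. \<gamma> k t) = (\<integral>\<^sup>+t\<in>{0..1}. ennreal (sqrt (\<Sum>k\<in>UNIV. (speed M (\<gamma> k) t)\<^sup>2)) \<partial>lborel)"
proof -
  obtain S where S: "finite S" "\<And>t. t \<in> {0<..<1} - S \<Longrightarrow> speed (riemannian_power M) (\<lambda>t k. \<gamma> k t) t = sqrt (\<Sum>k\<in>UNIV. (speed M (\<gamma> k) t)\<^sup>2)"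
    using power_speed[of \<gamma>] assms by blast
  have "AE t in lborel. t \<in> {0..1} \<longrightarrow>
      speed (riemannian_power M) (\<lambda>t k. \<gamma> k t) t = sqrt (\<Sum>k\<in>UNIV. (speed M (\<gamma> k) t)\<^sup>2)"
    using S by (rule AE_unit_interval_cofinite)
  then show ?thesis
    unfolding curve_length_def by (intro nn_integral_cong_AE) (auto simp: indicator_def elim!: eventually_mono)
qed

text \<open>Straight coordinate segments are the test curves behind all upper bounds for distances.
  They are admissible because the differentials of the transition maps vary continuously, so that a
  segment in \<open>c\<close> is continuously differentiable in every other chart.\<close>

lemma param_line:
  assumes c: "c \<in> charts M" and im: "\<And>t. t \<in> {0..1} \<Longrightarrow> \<xi> + t *\<^sub>R w \<in> chart_im M c"
  shows "piecewise_C1_curve M (\<lambda>t. param M c (\<xi> + t *\<^sub>R w))"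
    and "t \<in> {0<..<1} \<Longrightarrow> speed M (\<lambda>t. param M c (\<xi> + t *\<^sub>R w)) t = sqrt (metric M c (param M c (\<xi> + t *\<^sub>R w)) w w)"
proof -
  let ?\<gamma> = "\<lambda>t. param M c (\<xi> + t *\<^sub>R w)"
  have line: "((\<lambda>t. \<xi> + t *\<^sub>R w) has_vector_derivative w) (at t)" for t
    by (auto intro!: derivative_eq_intros)
  have path: "continuous_on {0..1} ?\<gamma>"
    by (rule continuous_on_compose2[OF continuous_param[OF c]]) (use im in \<open>auto intro!: continuous_intros\<close>)
  show "piecewise_C1_curve M ?\<gamma>"
    unfolding piecewise_C1_curve_def
  proof (intro conjI exI[of _ "{}"] ballI)
    show "path ?\<gamma>" using path by (simp add: path_def)
    fix d assume d: "d \<in> charts M"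
    let ?T = "{t \<in> {0<..<1} - {}. ?\<gamma> t \<in> chart_dom M d}"
    let ?D = "\<lambda>t. frechet_derivative (transition M c d) (at (\<xi> + t *\<^sub>R w)) w"
    show "(coord M d \<circ> ?\<gamma>) C1_differentiable_on ?T"
      unfolding C1_differentiable_on_def
    proof (intro exI[of _ ?D] conjI ballI)
      fix t assume t: "t \<in> ?T"
      have "transition M c d differentiable (at (\<xi> + t *\<^sub>R w))"
        by (rule transition_differentiable[OF c d im]) (use t in auto)
      then have D: "(transition M c d has_derivative frechet_derivative (transition M c d) (at (\<xi> + t *\<^sub>R w))) (at (\<xi> + t *\<^sub>R w))"
        by (simp add: frechet_derivative_works)
      have "((transition M c d \<circ> (\<lambda>t. \<xi> + t *\<^sub>R w)) has_derivative (\<lambda>h. h *\<^sub>R ?D t)) (at t)"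
        using diff_chain_at[OF line[unfolded has_vector_derivative_def] D]
        by (simp add: o_def linear_scale[OF has_derivative_linear[OF D]])
      then show "(coord M d \<circ> ?\<gamma> has_vector_derivative ?D t) (at t)"
        by (simp add: has_vector_derivative_def transition_def o_def)
    next
      show "continuous_on ?T ?D"
      proof (rule continuous_on_compose2[OF transition_derivative_continuous[OF c d]])
        show "(\<lambda>t. \<xi> + t *\<^sub>R w) ` ?T \<subseteq> coord M c ` (chart_dom M c \<inter> chart_dom M d)"
        proof safe
          fix t assume t: "t \<in> {0<..<1::real}" "?\<gamma> t \<in> chart_dom M d"
          then have "\<xi> + t *\<^sub>R w \<in> chart_im M c" by (intro im) auto
          then show "\<xi> + t *\<^sub>R w \<in> coord M c ` (chart_dom M c \<inter> chart_dom M d)"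
            using t(2) coord_param[OF c] param_in[OF c] by (metis IntI imageI)
        qed
      qed (intro continuous_intros)
    qed
  qed simp
  assume t: "t \<in> {0<..<1}"
  have tim: "\<xi> + t *\<^sub>R w \<in> chart_im M c" using im t by auto
  have ev: "\<forall>\<^sub>F s in at t. s \<in> {0<..<1::real}" by (rule eventually_at_in_open') (use t in auto)
  show "speed M ?\<gamma> t = sqrt (metric M c (?\<gamma> t) w w)"
  proof (rule speed_eq[OF c])
    show "?\<gamma> t \<in> chart_dom M c" by (rule param_in[OF c tim])
    show "isCont ?\<gamma> t"
    proof -
      have "continuous_on {0<..<1} ?\<gamma>" by (rule continuous_on_subset[OF path]) auto
      then show ?thesis using t by (simp add: continuous_on_eq_continuous_at)
    qed
    show "(coord M c \<circ> ?\<gamma> has_vector_derivative w) (at t)"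
      unfolding has_vector_derivative_def
    proof (rule has_derivative_transform_eventually[OF line[unfolded has_vector_derivative_def]])
      show "\<forall>\<^sub>F s in at t. \<xi> + s *\<^sub>R w = (coord M c \<circ> ?\<gamma>) s"
        using ev by eventually_elim (simp add: coord_param[OF c im])
    qed (simp_all add: coord_param[OF c tim])
  qed
qed

text \<open>A coordinate segment in direction 0. It serves for the factors that stay fixed while one
  coordinate moves.\<close>

lemma constant_curve:
  "piecewise_C1_curve M (\<lambda>t. p)" "t \<in> {0<..<1} \<Longrightarrow> speed M (\<lambda>t. p) t = 0"
proof -
  obtain c where c: "c \<in> charts M" "p \<in> chart_dom M c" using chart_exists by blast
  have im: "coord M c p + s *\<^sub>R 0 \<in> chart_im M c" for s :: real using coord_in[OF c] by simp
  show "piecewise_C1_curve M (\<lambda>t. p)"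
    using param_line(1)[OF c(1) im] by (simp add: param_coord[OF c])
  show "t \<in> {0<..<1} \<Longrightarrow> speed M (\<lambda>t. p) t = 0"
    using param_line(2)[OF c(1) im, of t] bilinear_lzero[OF metric_bilinear[OF c]]
    by (simp add: param_coord[OF c])
qed

lemma geodesic_dist_le:
  "piecewise_C1_curve N \<gamma> \<Longrightarrow> geodesic_dist N (\<gamma> 0) (\<gamma> 1) \<le> curve_length N \<gamma>"
  unfolding geodesic_dist_def by (rule INF_lower) (auto simp: pathstart_def pathfinish_def)

text \<open>The test curve runs through all coordinate segments simultaneously in unit time, so its
  squared speed is the sum of those of the factors, at most the sum of the
  \<open>K k\<close>.\<close>

lemma power_dist_line_le:
  fixes \<xi> w :: "'e^'n::finite"
  assumes c: "\<And>k. c k \<in> charts M"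
    and im: "\<And>k t. t \<in> {0..1} \<Longrightarrow> \<xi> $ k + t *\<^sub>R w $ k \<in> chart_im M (c k)"
    and le: "\<And>k t. t \<in> {0..1} \<Longrightarrow> metric M (c k) (param M (c k) (\<xi> $ k + t *\<^sub>R w $ k)) (w $ k) (w $ k) \<le> K k"
  shows "geodesic_dist (riemannian_power M) (\<lambda>k. param M (c k) (\<xi> $ k)) (\<lambda>k. param M (c k) ((\<xi> + w) $ k))
    \<le> ennreal (sqrt (\<Sum>k\<in>UNIV. K k))"
proof -
  let ?\<gamma> = "\<lambda>k t. param M (c k) (\<xi> $ k + t *\<^sub>R w $ k)"
  have C1: "piecewise_C1_curve M (?\<gamma> k)" for k by (rule param_line(1)[OF c im])
  have "geodesic_dist (riemannian_power M) (\<lambda>k. param M (c k) (\<xi> $ k)) (\<lambda>k. param M (c k) ((\<xi> + w) $ k))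
    \<le> curve_length (riemannian_power M) (\<lambda>t k. ?\<gamma> k t)"
    using geodesic_dist_le[OF power_piecewise_C1[OF C1]] by simp
  also have "\<dots> = (\<integral>\<^sup>+t\<in>{0..1}. ennreal (sqrt (\<Sum>k\<in>UNIV. (speed M (?\<gamma> k) t)\<^sup>2)) \<partial>lborel)"
    by (rule power_curve_length[OF C1])
  also have "\<dots> \<le> (\<integral>\<^sup>+t\<in>{0..1}. ennreal (sqrt (\<Sum>k\<in>UNIV. K k)) \<partial>(lborel :: real measure))"
  proof (rule nn_integral_mono_AE)
    have "AE t in lborel. t \<in> {0..1} \<longrightarrow> sqrt (\<Sum>k\<in>UNIV. (speed M (?\<gamma> k) t)\<^sup>2) \<le> sqrt (\<Sum>k\<in>UNIV. K k)"
    proof (rule AE_unit_interval_cofinite[of "{}"])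
      fix t :: real assume t: "t \<in> {0<..<1} - {}"
      have "(speed M (?\<gamma> k) t)\<^sup>2 \<le> K k" for k
        using param_line(2)[OF c im, of t k] le[of t k] t metric_nonneg[OF c param_in[OF c im], of t k] by auto
      then show "sqrt (\<Sum>k\<in>UNIV. (speed M (?\<gamma> k) t)\<^sup>2) \<le> sqrt (\<Sum>k\<in>UNIV. K k)"
        by (intro real_sqrt_le_mono sum_mono)
    qed simp
    then show "AE t in lborel. ennreal (sqrt (\<Sum>k\<in>UNIV. (speed M (?\<gamma> k) t)\<^sup>2)) * indicator {0..1} t \<le> ennreal (sqrt (\<Sum>k\<in>UNIV. K k)) * indicator {0..1} t"
      by eventually_elim (auto simp: indicator_def intro: ennreal_leI)
  qed
  also have "\<dots> = ennreal (sqrt (\<Sum>k\<in>UNIV. K k))"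
    by (simp add: nn_integral_cmult_indicator)
  finally show ?thesis .
qed

text \<open>A curve in \<open>M\<close>, completed by constants in the other coordinates, has the
  same length in the power. Hence Lipschitz bounds in the power pass to slices.\<close>

lemma power_dist_slice_le:
  fixes x :: "'n::finite \<Rightarrow> 'a"
  shows "geodesic_dist (riemannian_power M) (x(k := y)) (x(k := z)) \<le> geodesic_dist M y z"
  unfolding geodesic_dist_def[of M]
proof (rule INF_greatest, clarify)
  fix \<gamma> assume \<gamma>: "piecewise_C1_curve M \<gamma>" and y: "y = pathstart \<gamma>" and z: "z = pathfinish \<gamma>"
  define \<Gamma> where "\<Gamma> j = (if j = k then \<gamma> else (\<lambda>t. x j))" for j
  have C1: "piecewise_C1_curve M (\<Gamma> j)" for j using \<gamma> constant_curve(1) by (simp add: \<Gamma>_def)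
  have "(\<lambda>j. \<Gamma> j 0) = x(k := y)" "(\<lambda>j. \<Gamma> j 1) = x(k := z)"
    by (auto simp: \<Gamma>_def y z pathstart_def pathfinish_def)
  then have "geodesic_dist (riemannian_power M) (x(k := y)) (x(k := z)) \<le> curve_length (riemannian_power M) (\<lambda>t j. \<Gamma> j t)"
    using geodesic_dist_le[OF power_piecewise_C1[of \<Gamma>, OF C1]] by simp
  also have "\<dots> = (\<integral>\<^sup>+t\<in>{0..1}. ennreal (sqrt (\<Sum>j\<in>UNIV. (speed M (\<Gamma> j) t)\<^sup>2)) \<partial>lborel)"
    by (rule power_curve_length[OF C1])
  also have "\<dots> = curve_length M \<gamma>"
    unfolding curve_length_def
  proof (rule nn_integral_cong_AE)
    obtain S where S: "finite S" "\<And>t. t \<in> {0<..<1} - S \<Longrightarrow> 0 \<le> speed M \<gamma> t"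
      using speed_nonneg_AE[OF \<gamma>] by blast
    have "AE t in lborel. t \<in> {0..1} \<longrightarrow> sqrt (\<Sum>j\<in>UNIV. (speed M (\<Gamma> j) t)\<^sup>2) = speed M \<gamma> t"
    proof (rule AE_unit_interval_cofinite[OF S(1)])
      fix t assume t: "t \<in> {0<..<1} - S"
      have "(\<Sum>j\<in>UNIV. (speed M (\<Gamma> j) t)\<^sup>2) = (\<Sum>j\<in>UNIV. if j = k then (speed M \<gamma> t)\<^sup>2 else 0)"
        by (rule sum.cong) (use t in \<open>auto simp: \<Gamma>_def constant_curve(2)\<close>)
      then show "sqrt (\<Sum>j\<in>UNIV. (speed M (\<Gamma> j) t)\<^sup>2) = speed M \<gamma> t"
        using S(2)[OF t] by simp
    qed
    then show "AE t in lborel. ennreal (sqrt (\<Sum>j\<in>UNIV. (speed M (\<Gamma> j) t)\<^sup>2)) * indicator {0..1} t = ennreal (speed M \<gamma> t) * indicator {0..1} t"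
      by eventually_elim (auto simp: indicator_def)
  qed
  finally show "geodesic_dist (riemannian_power M) (x(k := pathstart \<gamma>)) (x(k := pathfinish \<gamma>)) \<le> curve_length M \<gamma>"
    by (simp add: y z)
qed

text \<open>A curve from \<open>p\<close> to \<open>y\<close> is followed until it first leaves the coordinate ball, for the metric
  at \<open>p\<close>, on whose boundary \<open>y\<close> lies; up to that time its speed is almost the one measured at \<open>p\<close>.\<close>

lemma curve_length_lower:
  assumes c: "c \<in> charts M" and p: "p \<in> chart_dom M c" and y: "y \<in> chart_dom M c"
    and R: "0 < R" "R\<^sup>2 = metric M c p (coord M c y - coord M c p) (coord M c y - coord M c p)"
    and \<epsilon>: "0 < \<epsilon>" "\<epsilon> < 1"
    and ball: "\<And>x. metric M c p (x - coord M c p) (x - coord M c p) \<le> R\<^sup>2 \<Longrightarrow> x \<in> chart_im M c"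
    and compare: "\<And>x v. metric M c p (x - coord M c p) (x - coord M c p) \<le> R\<^sup>2 \<Longrightarrow>
      (1 - \<epsilon>) * metric M c p v v \<le> metric M c (param M c x) v v"
    and \<gamma>: "piecewise_C1_curve M \<gamma>" "\<gamma> 0 = p" "\<gamma> 1 = y"
  shows "ennreal ((1 - \<epsilon>) * R) \<le> curve_length M \<gamma>"
proof -
  let ?\<xi> = "coord M c p"
  define B where "B = metric M c p"
  have bil: "bilinear B" and sym: "\<And>u v. B u v = B v u" and nonneg: "\<And>v. 0 \<le> B v v"
    and pos: "\<And>v. v \<noteq> 0 \<Longrightarrow> B v v > 0"
    using metric_bilinear[OF c p] metric_sym[OF c p] metric_nonneg[OF c p] metric_pos[OF c p]
    by (auto simp: B_def)
  have Bcont: "continuous_on A (\<lambda>x. B (h x) (k x))" if "continuous_on A h" "continuous_on A k"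
    for A :: "'z::topological_space set" and h k
    using bil that by (intro bounded_bilinear.continuous_on[of B]) (simp_all add: bilinear_conv_bounded_bilinear)
  obtain l where l: "l > 0" "\<And>v. l * (norm v)\<^sup>2 \<le> B v v"
    using positive_definite_lower[OF bil pos] by blast
  define BR where "BR = {x. B (x - ?\<xi>) (x - ?\<xi>) \<le> R\<^sup>2}"
  define E where "E = {q \<in> chart_dom M c. B (coord M c q - ?\<xi>) (coord M c q - ?\<xi>) < R\<^sup>2}"
  have "closed BR"
    unfolding BR_def by (intro closed_Collect_le Bcont continuous_intros)
  moreover have "bounded BR"
  proof (rule bounded_subset[OF bounded_cball])
    show "BR \<subseteq> cball ?\<xi> (R / sqrt l)"
    proof
      fix x assume "x \<in> BR"
      then have "l * (norm (x - ?\<xi>))\<^sup>2 \<le> R\<^sup>2" using l(2)[of "x - ?\<xi>"] by (simp add: BR_def)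
      then have "(sqrt l * norm (x - ?\<xi>))\<^sup>2 \<le> R\<^sup>2" using l(1) by (simp add: power_mult_distrib)
      then have "sqrt l * norm (x - ?\<xi>) \<le> R" using R(1) by (auto intro: power2_le_imp_le)
      then show "x \<in> cball ?\<xi> (R / sqrt l)"
        using l(1) by (simp add: dist_norm norm_minus_commute pos_le_divide_eq mult.commute)
    qed
  qed
  ultimately have "compact BR" by (simp add: compact_eq_bounded_closed)
  have BRim: "BR \<subseteq> chart_im M c" using ball by (auto simp: BR_def B_def)
  \<comment> \<open>The image of the closed coordinate ball is compact, hence closed in the
    Hausdorff space \<open>M\<close>. So the curve is still in the chart domain at the exit time
    \<open>T\<close>, and its coordinates have then reached the boundary of the ball.\<close>
  have "compact (param M c ` BR)"
    by (rule compact_continuous_image[OF continuous_on_subset[OF continuous_param[OF c] BRim] \<open>compact BR\<close>])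
  then have closedK: "closed (param M c ` BR)" by (rule compact_imp_closed)
  have K: "q \<in> chart_dom M c \<and> B (coord M c q - ?\<xi>) (coord M c q - ?\<xi>) \<le> R\<^sup>2" if "q \<in> param M c ` BR" for q
    using that BRim coord_param[OF c] param_in[OF c] by (auto simp: BR_def)
  have EK: "E \<subseteq> param M c ` BR"
  proof
    fix q assume q: "q \<in> E"
    then have "q = param M c (coord M c q)" "coord M c q \<in> BR"
      using param_coord[OF c] by (auto simp: E_def BR_def)
    then show "q \<in> param M c ` BR" by blast
  qed
  have "open E"
  proof -
    have "continuous_on (chart_dom M c) (\<lambda>q. B (coord M c q - ?\<xi>) (coord M c q - ?\<xi>))"
      by (intro Bcont continuous_intros continuous_coord[OF c])
    from continuous_open_preimage[OF this open_chart_dom[OF c], of "{..<R\<^sup>2}"]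
    show ?thesis by (simp add: E_def vimage_def Int_def)
  qed
  have \<gamma>cont: "continuous_on {0..1} \<gamma>" using \<gamma>(1) by (simp add: piecewise_C1_curve_def path_def)
  define Z where "Z = {0..1} \<inter> \<gamma> -` (- E)"
  have "closed Z"
    unfolding Z_def using \<open>open E\<close> by (intro continuous_closed_preimage[OF \<gamma>cont]) auto
  then have "compact Z"
    unfolding compact_eq_bounded_closed by (auto simp: Z_def intro: bounded_subset[of "{0..1}"])
  moreover have "1 \<in> Z" using R \<gamma>(3) y by (simp add: Z_def E_def B_def)
  ultimately obtain T where T: "T \<in> Z" "\<And>t. t \<in> Z \<Longrightarrow> T \<le> t"
    using compact_attains_inf[of Z] by blast
  have before: "\<gamma> t \<in> E" if "t \<in> {0..<T}" for t
    using T(2)[of t] that T(1) by (auto simp: Z_def)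
  have "p \<in> E" using p R(1) bilinear_lzero[OF bil] by (simp add: E_def)
  then have T01: "0 < T" "T \<le> 1" using T(1) \<gamma>(2) by (auto simp: Z_def less_le)
  have cont_T: "continuous_on {0..T} \<gamma>" by (rule continuous_on_subset[OF \<gamma>cont]) (use T01 in auto)
  have inK: "\<gamma> t \<in> param M c ` BR" if "t \<in> {0..T}" for t
  proof -
    have "\<gamma> ` closure {0..<T} \<subseteq> closure (\<gamma> ` {0..<T})"
      using cont_T T01 by (intro image_closure_subset) (auto intro: closure_subset[THEN subsetD])
    also have "\<dots> \<subseteq> param M c ` BR"
      by (rule closure_minimal[OF _ closedK]) (use before EK in auto)
    finally show ?thesis using that T01(1) by auto
  qed
  define u where "u = coord M c \<circ> \<gamma>"
  have u_cont: "continuous_on {0..T} u"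
    unfolding u_def by (rule continuous_on_compose[OF cont_T continuous_on_subset[OF continuous_coord[OF c]]]) (use inK K in auto)
  define w where "w = u T - ?\<xi>"
  have "\<gamma> T \<notin> E" using T(1) by (simp add: Z_def)
  then have ww: "B w w = R\<^sup>2" using K[OF inK[of T]] T01 by (auto simp: E_def w_def u_def)
  obtain S where S: "finite S" "\<And>t. t \<in> {0<..<1} - S \<Longrightarrow> isCont \<gamma> t"
    "\<And>t c. t \<in> {0<..<1} - S \<Longrightarrow> c \<in> charts M \<Longrightarrow> \<gamma> t \<in> chart_dom M c \<Longrightarrow>
      (coord M c \<circ> \<gamma> has_vector_derivative vector_derivative (coord M c \<circ> \<gamma>) (at t)) (at t)"
    "\<And>c. c \<in> charts M \<Longrightarrow>
      continuous_on {t \<in> {0<..<1} - S. \<gamma> t \<in> chart_dom M c} (\<lambda>t. vector_derivative (coord M c \<circ> \<gamma>) (at t))"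
    by (rule piecewise_C1_curve_derivatives[OF \<gamma>(1)]) blast
  define v where "v t = vector_derivative u (at t)" for t
  \<comment> \<open>The component of the coordinate curve along its exit vector \<open>w\<close>.
    Because \<open>B w w = R\<^sup>2\<close>, its increment up to \<open>T\<close> is
    \<open>(1 - \<epsilon>) * R\<close>, and by Cauchy-Schwarz its derivative is at most the
    speed.\<close>
  define \<phi> where "\<phi> t = (1 - \<epsilon>) / R * B w (u t)" for t
  have uv: "(u has_vector_derivative v t) (at t)" if "t \<in> {0<..<T} - S" for t
    unfolding u_def v_def using S(3)[OF _ c, of t] that T01 K[OF inK[of t]] by auto
  have Bw: "bounded_linear (B w)"
    using bil by (simp add: bilinear_def linear_conv_bounded_linear)
  have "ennreal (\<phi> T - \<phi> 0) \<le> (\<integral>\<^sup>+t. ennreal (indicator ({0<..<T} - S) t * \<bar>(1 - \<epsilon>) / R * B w (v t)\<bar>) \<partial>lborel)"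
  proof (rule increment_le_nn_integral_derivative[OF _ S(1)])
    show "continuous_on {0..T} \<phi>"
      unfolding \<phi>_def by (intro continuous_intros bounded_linear.continuous_on[OF Bw] u_cont)
    show "continuous_on ({0<..<T} - S) (\<lambda>t. (1 - \<epsilon>) / R * B w (v t))"
      unfolding v_def u_def
      by (intro continuous_intros bounded_linear.continuous_on[OF Bw] continuous_on_subset[OF S(4)[OF c]])
        (use T01 inK K in auto)
    show "(\<phi> has_vector_derivative (1 - \<epsilon>) / R * B w (v t)) (at t)" if "t \<in> {0<..<T} - S" for t
      unfolding \<phi>_def
      by (intro has_vector_derivative_mult_right bounded_linear.has_vector_derivative[OF Bw uv[OF that]])
  qed (use T01 in auto)
  also have "\<dots> \<le> curve_length M \<gamma>"
    unfolding curve_length_def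
  proof (rule nn_integral_mono)
    fix t
    show "ennreal (indicator ({0<..<T} - S) t * \<bar>(1 - \<epsilon>) / R * B w (v t)\<bar>) \<le> ennreal (speed M \<gamma> t) * indicator {0..1} t"
    proof (cases "t \<in> {0<..<T} - S")
      case True
      then have t: "t \<in> {0<..<1} - S" "t \<in> {0..T}" using T01 by auto
      have sp: "speed M \<gamma> t = sqrt (metric M c (\<gamma> t) (v t) (v t))"
        using speed_eq[OF c _ S(2)[OF t(1)]] uv[OF True] K[OF inK[OF t(2)]] by (simp add: u_def)
      obtain x where x: "x \<in> BR" "\<gamma> t = param M c x" using inK[OF t(2)] by blast
      have "(1 - \<epsilon>) * B (v t) (v t) \<le> metric M c (\<gamma> t) (v t) (v t)"
        using compare[of x "v t"] x by (simp add: BR_def B_def)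
      \<comment> \<open>The metrics are compared at the level of squared speeds, where only the
        factor \<open>1 - \<epsilon>\<close> is lost. The claim concerns the speed itself and so
        allows for its square.\<close>
      moreover have "(1 - \<epsilon>)\<^sup>2 * B (v t) (v t) \<le> (1 - \<epsilon>) * B (v t) (v t)"
        using \<epsilon> nonneg[of "v t"] by (intro mult_right_mono) (auto simp: power2_eq_square mult_left_le_one_le)
      moreover have "(B w (v t))\<^sup>2 \<le> R\<^sup>2 * B (v t) (v t)"
        using form_cauchy_schwarz[OF bil sym nonneg, of "v t" w] pos[of "v t"] ww by fastforce
      then have "((1 - \<epsilon>) / R * B w (v t))\<^sup>2 \<le> (1 - \<epsilon>)\<^sup>2 * B (v t) (v t)"
      proof -
        assume "(B w (v t))\<^sup>2 \<le> R\<^sup>2 * B (v t) (v t)"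
        then have "(B w (v t) / R)\<^sup>2 \<le> B (v t) (v t)"
          using R(1) by (simp add: power_divide pos_divide_le_eq mult.commute)
        then have "(1 - \<epsilon>)\<^sup>2 * (B w (v t) / R)\<^sup>2 \<le> (1 - \<epsilon>)\<^sup>2 * B (v t) (v t)"
          by (rule mult_left_mono) simp
        then show ?thesis by (simp add: power_mult_distrib[symmetric])
      qed
      ultimately have "((1 - \<epsilon>) / R * B w (v t))\<^sup>2 \<le> metric M c (\<gamma> t) (v t) (v t)" by linarith
      then have "\<bar>(1 - \<epsilon>) / R * B w (v t)\<bar> \<le> speed M \<gamma> t"
        unfolding sp by (intro real_le_rsqrt) (simp only: power2_abs)
      then show ?thesis using True t by (auto simp: indicator_def intro: ennreal_leI)
    qed simp
  qed
  also have "\<phi> T - \<phi> 0 = (1 - \<epsilon>) * R"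
  proof -
    have "B w (u T) - B w (u 0) = B w w"
      using bilinear_rsub[OF bil, of w "u T" "u 0"] \<gamma>(2) by (simp add: w_def u_def)
    then have "\<phi> T - \<phi> 0 = (1 - \<epsilon>) / R * R\<^sup>2" unfolding \<phi>_def right_diff_distrib[symmetric] ww by simp
    then show ?thesis using R(1) by (simp add: power2_eq_square)
  qed
  finally show ?thesis .
qed

text \<open>Each \<open>y\<close> near \<open>p\<close> lies on the boundary of the ball whose
  radius \<open>R\<close> is its own coordinate distance from \<open>p\<close>, measured by the
  metric at \<open>p\<close>. The threshold \<open>l * r\<^sup>2\<close> forces that ball into the
  Euclidean ball of radius \<open>r\<close> on which the metrics are comparable, so
  \<open>curve_length_lower\<close> applies to every curve from \<open>p\<close> to
  \<open>y\<close>.\<close>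

lemma geodesic_dist_lower:
  assumes c: "c \<in> charts M" and p: "p \<in> chart_dom M c" and \<epsilon>: "0 < \<epsilon>" "\<epsilon> < 1"
  shows "\<forall>\<^sub>F y in nhds p. y \<in> chart_dom M c \<and>
    ennreal ((1 - \<epsilon>) * sqrt (metric M c p (coord M c y - coord M c p) (coord M c y - coord M c p))) \<le> geodesic_dist M p y"
proof -
  let ?\<xi> = "coord M c p"
  obtain r where r: "r > 0" "ball ?\<xi> r \<subseteq> chart_im M c"
    "\<And>x v. x \<in> ball ?\<xi> r \<Longrightarrow> (1 - \<epsilon>) * metric M c p v v \<le> metric M c (param M c x) v v"
    using metric_comparison[OF c p \<epsilon>(1)] by metis
  obtain l where l: "l > 0" "\<And>v. l * (norm v)\<^sup>2 \<le> metric M c p v v"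
    using positive_definite_lower[OF metric_bilinear[OF c p] metric_pos[OF c p]] by blast
  let ?q = "\<lambda>y. metric M c p (coord M c y - ?\<xi>) (coord M c y - ?\<xi>)"
  have "continuous_on (chart_dom M c) ?q"
    using metric_bilinear[OF c p]
    by (intro bounded_bilinear.continuous_on[of "metric M c p"] continuous_intros continuous_coord[OF c])
      (simp add: bilinear_conv_bounded_bilinear)
  from continuous_open_preimage[OF this open_chart_dom[OF c], of "{..<l * r\<^sup>2}"]
  have "open (chart_dom M c \<inter> ?q -` {..<l * r\<^sup>2})" by simp
  moreover have "p \<in> chart_dom M c \<inter> ?q -` {..<l * r\<^sup>2}"
    using p l(1) r(1) bilinear_lzero[OF metric_bilinear[OF c p]] by simp
  ultimately have "\<forall>\<^sub>F y in nhds p. y \<in> chart_dom M c \<inter> ?q -` {..<l * r\<^sup>2}"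
    by (rule eventually_nhds_in_open)
  then show ?thesis
  proof eventually_elim
    case (elim y)
    then have y: "y \<in> chart_dom M c" "?q y < l * r\<^sup>2" by auto
    show ?case
    proof (intro conjI y(1))
      show "ennreal ((1 - \<epsilon>) * sqrt (?q y)) \<le> geodesic_dist M p y"
      proof (cases "?q y = 0")
        case False
        define R where "R = sqrt (?q y)"
        have R: "0 < R" "R\<^sup>2 = ?q y"
          using False metric_nonneg[OF c p, of "coord M c y - ?\<xi>"] by (auto simp: R_def less_le)
        have inball: "x \<in> ball ?\<xi> r" if "metric M c p (x - ?\<xi>) (x - ?\<xi>) \<le> R\<^sup>2" for x
        proof -
          have "l * (norm (x - ?\<xi>))\<^sup>2 < l * r\<^sup>2" using l(2)[of "x - ?\<xi>"] that R(2) y(2) by linarith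
          then have "norm (x - ?\<xi>) < r" using l(1) r(1) by (auto intro: power2_less_imp_less)
          then show ?thesis by (simp add: dist_norm norm_minus_commute)
        qed
        show ?thesis
          unfolding geodesic_dist_def R_def[symmetric]
        proof (rule INF_greatest, clarify)
          fix \<gamma> assume "piecewise_C1_curve M \<gamma>" "p = pathstart \<gamma>" "y = pathfinish \<gamma>"
          then show "ennreal ((1 - \<epsilon>) * R) \<le> curve_length M \<gamma>"
            by (intro curve_length_lower[OF c p y(1) R \<epsilon>])
              (use inball r in \<open>auto simp: pathstart_def pathfinish_def\<close>)
        qed
      qed simp
    qed
  qed
qed

section \<open>Locally Lipschitz functions in coordinates and on slices\<close>

lemma open_power_chart_im:
  assumes "\<And>k. c k \<in> charts M"
  shows "open {\<xi> :: 'e^'n::finite. \<forall>k. \<xi> $ k \<in> chart_im M (c k)}"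
proof -
  have "open (\<Inter>k. (\<lambda>\<xi> :: 'e^'n. \<xi> $ k) -` chart_im M (c k))"
    by (intro open_INT ballI open_vimage open_chart_im[OF assms] continuous_intros) simp
  moreover have "(\<Inter>k. (\<lambda>\<xi> :: 'e^'n. \<xi> $ k) -` chart_im M (c k)) = {\<xi> :: 'e^'n. \<forall>k. \<xi> $ k \<in> chart_im M (c k)}"
    by auto
  ultimately show ?thesis by simp
qed

lemma continuous_power_param:
  assumes "\<And>k. c k \<in> charts M"
  shows "continuous_on {\<xi> :: 'e^'n::finite. \<forall>k. \<xi> $ k \<in> chart_im M (c k)} (\<lambda>\<xi> k. param M (c k) (\<xi> $ k))"
  by (intro continuous_on_coordinatewise_then_product continuous_on_compose2[OF continuous_param[OF assms]] continuous_intros)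
    auto

text \<open>Near \<xi> the metrics are bounded by multiples of the Euclidean one. Balls are convex,
  so the segment between two points stays in this region, and its length bounds the geodesic
  distance by a multiple of the Euclidean distance.\<close>

lemma coordinate_lipschitz:
  fixes f :: "('n::finite \<Rightarrow> 'a) \<Rightarrow> real" and \<xi> :: "'e^'n"
  assumes c: "\<And>k. c k \<in> charts M" and ll: "locally_lipschitz (riemannian_power M) f"
    and \<xi>: "\<And>k. \<xi> $ k \<in> chart_im M (c k)"
  shows "\<exists>r>0. \<exists>L. L-lipschitz_on (ball \<xi> r) (\<lambda>\<xi>. f (\<lambda>k. param M (c k) (\<xi> $ k)))"
proof -
  let ?P = "\<lambda>\<xi> :: 'e^'n. (\<lambda>k. param M (c k) (\<xi> $ k))"
  let ?O = "{\<xi> :: 'e^'n. \<forall>k. \<xi> $ k \<in> chart_im M (c k)}"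
  obtain U L where U: "open U" "?P \<xi> \<in> U"
    and L: "\<And>y z. y \<in> U \<Longrightarrow> z \<in> U \<Longrightarrow> ennreal \<bar>f y - f z\<bar> \<le> ennreal L * geodesic_dist (riemannian_power M) y z"
    using ll unfolding locally_lipschitz_def by meson
  have "open (?O \<inter> ?P -` U)"
    by (rule continuous_open_preimage[OF continuous_power_param[OF c] open_power_chart_im[OF c] U(1)])
  moreover have "\<xi> \<in> ?O \<inter> ?P -` U" using \<xi> U(2) by simp
  ultimately obtain r0 where r0: "r0 > 0" "ball \<xi> r0 \<subseteq> ?O \<inter> ?P -` U"
    by (meson open_contains_ball)
  have p: "param M (c k) (\<xi> $ k) \<in> chart_dom M (c k)" for k by (rule param_in[OF c \<xi>])
  have "\<forall>k. \<exists>r C. r > 0 \<and> C > 0 \<and> (\<forall>x\<in>ball (\<xi> $ k) r. \<forall>v. metric M (c k) (param M (c k) x) v v \<le> C * (norm v)\<^sup>2)"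
  proof
    fix k
    obtain r where r: "r > 0" "\<And>x v. x \<in> ball (\<xi> $ k) r \<Longrightarrow>
        metric M (c k) (param M (c k) x) v v \<le> (1 + 1) * metric M (c k) (param M (c k) (\<xi> $ k)) v v"
      using metric_comparison[OF c p, of 1 k] coord_param[OF c \<xi>] by (metis zero_less_one)
    obtain C where C: "C > 0" "\<And>v. metric M (c k) (param M (c k) (\<xi> $ k)) v v \<le> C * (norm v)\<^sup>2"
      using bilinear_form_upper[OF metric_bilinear[OF c p]] by blast
    have "metric M (c k) (param M (c k) x) v v \<le> (2 * C) * (norm v)\<^sup>2" if "x \<in> ball (\<xi> $ k) r" for x v
      using r(2)[OF that, of v] C(2)[of v] by simp
    then show "\<exists>r C. r > 0 \<and> C > 0 \<and> (\<forall>x\<in>ball (\<xi> $ k) r. \<forall>v. metric M (c k) (param M (c k) x) v v \<le> C * (norm v)\<^sup>2)"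
      using r(1) C(1) by (intro exI[of _ r] exI[of _ "2 * C"]) auto
  qed
  then obtain r C where r: "\<And>k. r k > 0" and C: "\<And>k. C k > 0"
    "\<And>k x v. x \<in> ball (\<xi> $ k) (r k) \<Longrightarrow> metric M (c k) (param M (c k) x) v v \<le> C k * (norm v)\<^sup>2"
    by metis
  define \<rho> where "\<rho> = Min (insert r0 (range r))"
  have \<rho>: "\<rho> > 0" "\<rho> \<le> r0" "\<And>k. \<rho> \<le> r k" using r0 r by (auto simp: \<rho>_def min_le_iff_disj)
  define K where "K = sqrt (\<Sum>k\<in>UNIV. C k)"
  have K0: "0 \<le> K" using C(1) by (auto simp: K_def intro: sum_nonneg less_imp_le)
  \<comment> \<open>The definition of local Lipschitz continuity admits a negative \<open>L\<close>,
    which counts as 0 under \<open>ennreal\<close>; the absolute value covers both signs.\<close>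
  have "(\<bar>L\<bar> * K)-lipschitz_on (ball \<xi> \<rho>) (\<lambda>\<xi>. f (?P \<xi>))"
  proof (rule lipschitz_onI)
    fix a b assume ab: "a \<in> ball \<xi> \<rho>" "b \<in> ball \<xi> \<rho>"
    define w where "w = b - a"
    have line: "a + t *\<^sub>R w \<in> ball \<xi> \<rho>" if "t \<in> {0..1}" for t
    proof -
      have "a + t *\<^sub>R w = (1 - t) *\<^sub>R a + t *\<^sub>R b" by (simp add: w_def algebra_simps)
      then show ?thesis using convexD[OF convex_ball ab, of "1 - t" t] that by simp
    qed
    have comp: "a $ k + t *\<^sub>R w $ k \<in> ball (\<xi> $ k) (r k)" if "t \<in> {0..1}" for t k
    proof -
      have "dist (\<xi> $ k) ((a + t *\<^sub>R w) $ k) \<le> dist \<xi> (a + t *\<^sub>R w)" by (rule dist_vec_nth_le)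
      then show ?thesis using line[OF that] \<rho>(3)[of k] by simp
    qed
    have "geodesic_dist (riemannian_power M) (?P a) (\<lambda>k. param M (c k) ((a + w) $ k))
        \<le> ennreal (sqrt (\<Sum>k\<in>UNIV. C k * (norm (w $ k))\<^sup>2))"
    proof (rule power_dist_line_le[OF c])
      fix k and t :: real assume t: "t \<in> {0..1}"
      show "a $ k + t *\<^sub>R w $ k \<in> chart_im M (c k)"
      proof -
        have "a + t *\<^sub>R w \<in> ball \<xi> r0" using line[OF t] \<rho>(2) by auto
        then have "(a + t *\<^sub>R w) $ k \<in> chart_im M (c k)" using r0(2) by blast
        then show ?thesis by simp
      qed
      show "metric M (c k) (param M (c k) (a $ k + t *\<^sub>R w $ k)) (w $ k) (w $ k) \<le> C k * (norm (w $ k))\<^sup>2"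
        by (rule C(2)[OF comp[OF t]])
    qed
    also have "sqrt (\<Sum>k\<in>UNIV. C k * (norm (w $ k))\<^sup>2) \<le> sqrt (\<Sum>k\<in>UNIV. C k * (norm w)\<^sup>2)"
      using C(1) by (intro real_sqrt_le_mono sum_mono mult_left_mono power_mono Finite_Cartesian_Product.norm_nth_le) (auto intro: less_imp_le)
    also have "\<dots> = K * norm w" by (simp add: K_def sum_distrib_right[symmetric] real_sqrt_mult)
    finally have d: "geodesic_dist (riemannian_power M) (?P a) (?P b) \<le> ennreal (K * norm w)"
      by (simp add: w_def ennreal_leI)
    have "?P a \<in> U" "?P b \<in> U" using ab \<rho>(2) r0(2) by (auto simp: subset_iff)
    then have "ennreal \<bar>f (?P a) - f (?P b)\<bar> \<le> ennreal L * geodesic_dist (riemannian_power M) (?P a) (?P b)" by (rule L)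
    also have "\<dots> \<le> ennreal \<bar>L\<bar> * ennreal (K * norm w)"
      by (intro mult_mono d ennreal_leI) auto
    also have "\<dots> = ennreal (\<bar>L\<bar> * (K * norm w))"
      using K0 by (simp add: ennreal_mult)
    finally have "\<bar>f (?P a) - f (?P b)\<bar> \<le> \<bar>L\<bar> * (K * norm w)"
      using K0 by (subst (asm) ennreal_le_iff) auto
    then show "dist (f (?P a)) (f (?P b)) \<le> \<bar>L\<bar> * K * dist a b"
      by (simp add: dist_real_def dist_norm w_def norm_minus_commute mult.assoc)
  qed (use K0 in auto)
  then show ?thesis using \<rho>(1) by blast
qed

lemma slice_locally_lipschitz:
  fixes f :: "('n::finite \<Rightarrow> 'a) \<Rightarrow> real"
  assumes "locally_lipschitz (riemannian_power M) f"
  shows "locally_lipschitz M (\<lambda>y. f (x(k := y)))"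
  unfolding locally_lipschitz_def
proof
  fix y
  obtain U L where U: "open U" "x(k := y) \<in> U"
    and L: "\<And>y z. y \<in> U \<Longrightarrow> z \<in> U \<Longrightarrow> ennreal \<bar>f y - f z\<bar> \<le> ennreal L * geodesic_dist (riemannian_power M) y z"
    using assms unfolding locally_lipschitz_def by meson
  have "continuous_on UNIV (\<lambda>z. x(k := z))"
  proof (rule continuous_on_coordinatewise_then_product)
    show "continuous_on UNIV (\<lambda>z. (x(k := z)) i)" for i by (cases "i = k") auto
  qed
  then have "open ((\<lambda>z. x(k := z)) -` U)" using U(1) by (auto intro: open_vimage)
  moreover have "ennreal \<bar>f (x(k := a)) - f (x(k := b))\<bar> \<le> ennreal L * geodesic_dist M a b"
    if "a \<in> (\<lambda>z. x(k := z)) -` U" "b \<in> (\<lambda>z. x(k := z)) -` U" for a b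
  proof -
    have "ennreal \<bar>f (x(k := a)) - f (x(k := b))\<bar> \<le> ennreal L * geodesic_dist (riemannian_power M) (x(k := a)) (x(k := b))"
      using that by (intro L) auto
    also have "\<dots> \<le> ennreal L * geodesic_dist M a b"
      by (intro mult_left_mono power_dist_slice_le) auto
    finally show ?thesis .
  qed
  ultimately show "\<exists>U L. open U \<and> y \<in> U \<and> (\<forall>a\<in>U. \<forall>b\<in>U. ennreal \<bar>f (x(k := a)) - f (x(k := b))\<bar> \<le> ennreal L * geodesic_dist M a b)"
    using U(2) by (intro exI[of _ "(\<lambda>z. x(k := z)) -` U"] exI[of _ L]) auto
qed

lemma continuous_power_coord:
  assumes "\<And>k. c k \<in> charts M"
  shows "continuous_on {x :: 'n::finite \<Rightarrow> 'a. \<forall>k. x k \<in> chart_dom M (c k)} (\<lambda>x. \<chi> k. coord M (c k) (x k))"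
proof (intro continuous_on_vec_lambda)
  fix k
  have "continuous_on {x :: 'n \<Rightarrow> 'a. \<forall>k. x k \<in> chart_dom M (c k)} (\<lambda>x. x k)"
    using continuous_on_product_coordinates by (rule continuous_on_subset) simp
  then show "continuous_on {x :: 'n \<Rightarrow> 'a. \<forall>k. x k \<in> chart_dom M (c k)} (\<lambda>x. coord M (c k) (x k))"
    by (rule continuous_on_compose2[OF continuous_coord[OF assms]]) auto
qed

lemma open_power_chart_dom:
  assumes "\<And>k. c k \<in> charts M"
  shows "open {x :: 'n::finite \<Rightarrow> 'a. \<forall>k. x k \<in> chart_dom M (c k)}"
proof -
  have "open (\<Inter>k. (\<lambda>x :: 'n \<Rightarrow> 'a. x k) -` chart_dom M (c k))"
    by (intro open_INT ballI open_vimage open_chart_dom[OF assms] continuous_on_product_coordinates) simp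
  moreover have "(\<Inter>k. (\<lambda>x :: 'n \<Rightarrow> 'a. x k) -` chart_dom M (c k)) = {x. \<forall>k. x k \<in> chart_dom M (c k)}"
    by auto
  ultimately show ?thesis by simp
qed

text \<open>The assumption refers to the geodesic distance, the conclusion to the topology of the
  type. The link between them is the coordinate expression of \<open>f\<close>, which is Lipschitz
  for the Euclidean distance, composed with the continuous coordinates.\<close>

lemma locally_lipschitz_continuous:
  fixes f :: "('n::finite \<Rightarrow> 'a) \<Rightarrow> real"
  assumes ll: "locally_lipschitz (riemannian_power M) f"
  shows "continuous_on UNIV f"
  unfolding continuous_on_def
proof
  fix x :: "'n \<Rightarrow> 'a"
  have "\<forall>k. \<exists>c. c \<in> charts M \<and> x k \<in> chart_dom M c" using chart_exists by blast
  then obtain c where c: "\<And>k. c k \<in> charts M" and x: "\<And>k. x k \<in> chart_dom M (c k)" by metis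
  let ?D = "{x :: 'n \<Rightarrow> 'a. \<forall>k. x k \<in> chart_dom M (c k)}"
  let ?co = "\<lambda>x. (\<chi> k. coord M (c k) (x k)) :: 'e^'n"
  let ?F = "\<lambda>\<xi> :: 'e^'n. f (\<lambda>k. param M (c k) (\<xi> $ k))"
  have "?co x $ k \<in> chart_im M (c k)" for k using coord_in[OF c x] by simp
  from coordinate_lipschitz[OF c ll this]
  obtain r L where "r > 0" "L-lipschitz_on (ball (?co x) r) ?F" by blast
  then have "continuous_on (ball (?co x) r) ?F" by (intro lipschitz_on_continuous_on)
  then have "isCont ?F (?co x)" using \<open>r > 0\<close> by (simp add: continuous_on_eq_continuous_at)
  moreover have "(?co \<longlongrightarrow> ?co x) (at x)"
    using continuous_power_coord[of c, OF c] open_power_chart_dom[of c, OF c] x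
    by (auto simp: continuous_on_def at_within_open[where S = ?D])
  ultimately have "((\<lambda>y. ?F (?co y)) \<longlongrightarrow> ?F (?co x)) (at x)" by (rule isCont_tendsto_compose)
  moreover have "\<forall>\<^sub>F y in at x. ?F (?co y) = f y"
  proof -
    have "\<forall>\<^sub>F y in at x. y \<in> ?D"
      by (rule eventually_at_in_open'[OF open_power_chart_dom[OF c]]) (use x in simp)
    then show ?thesis by eventually_elim (simp add: param_coord[OF c])
  qed
  moreover have "?F (?co x) = f x" by (simp add: param_coord[OF c] x)
  ultimately show "(f \<longlongrightarrow> f x) (at x within UNIV)"
    by (simp add: tendsto_cong)
qed

section \<open>Slopes at a point where the coordinate expression is differentiable\<close>

context
  fixes f :: "('n::finite \<Rightarrow> 'a) \<Rightarrow> real" and c :: "'n \<Rightarrow> 'i" and x :: "'n \<Rightarrow> 'a" and D :: "'e^'n \<Rightarrow> real"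
  assumes c: "\<And>k. c k \<in> charts M" and x: "\<And>k. x k \<in> chart_dom M (c k)"
    and D: "((\<lambda>\<xi>. f (\<lambda>k. param M (c k) (\<xi> $ k))) has_derivative D) (at (\<chi> k. coord M (c k) (x k)))"
begin

text \<open>\<open>w\<close> represents the block of \<open>D\<close> at \<open>k\<close>. For a
  coordinate increment \<Delta> the function changes by \<open>B w \<Delta>\<close> up to a small
  error, which Cauchy-Schwarz bounds by \<open>a * sqrt (B \<Delta> \<Delta>)\<close>, whereas the
  distance is at least \<open>(1 - \<delta>) * sqrt (B \<Delta> \<Delta>)\<close>.\<close>

lemma slice_gradient_le:
  assumes w: "\<And>v. metric M (c k) (x k) w v = D (axis k v)"
  shows "grad_norm M (\<lambda>y. f (x(k := y))) (x k) \<le> ennreal (sqrt (metric M (c k) (x k) w w))"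
proof (rule ennreal_le_epsilon)
  fix e :: real assume e: "0 < e"
  define \<xi> :: "'e^'n" where "\<xi> = (\<chi> k. coord M (c k) (x k))"
  define B where "B = metric M (c k) (x k)"
  let ?F = "\<lambda>\<xi> :: 'e^'n. f (\<lambda>k. param M (c k) (\<xi> $ k))"
  have bil: "bilinear B" and sym: "\<And>u v. B u v = B v u" and nonneg: "\<And>v. 0 \<le> B v v"
    and pos: "\<And>v. v \<noteq> 0 \<Longrightarrow> B v v > 0"
    using metric_bilinear[OF c x] metric_sym[OF c x] metric_nonneg[OF c x] metric_pos[OF c x]
    by (auto simp: B_def)
  define a where "a = sqrt (B w w)"
  have a: "0 \<le> a" using nonneg by (simp add: a_def)
  \<comment> \<open>The solution of \<open>a + \<delta> = (a + e) * (1 - \<delta>)\<close>, which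
    makes the quotient of the two estimates equal to \<open>a + e\<close>.\<close>
  define \<delta> where "\<delta> = e / (1 + a + e)"
  have \<delta>: "0 < \<delta>" "\<delta> < 1" "a + \<delta> \<le> (a + e) * (1 - \<delta>)"
  proof -
    have "1 + a + e > 0" using e a by simp
    then show "0 < \<delta>" "\<delta> < 1" using e a by (auto simp: \<delta>_def)
    have "\<delta> * (1 + a + e) = e" using \<open>1 + a + e > 0\<close> by (simp add: \<delta>_def)
    then show "a + \<delta> \<le> (a + e) * (1 - \<delta>)" by (simp add: algebra_simps)
  qed
  obtain l where l: "l > 0" "\<And>v. l * (norm v)\<^sup>2 \<le> B v v"
    using positive_definite_lower[OF bil pos] by blast
  \<comment> \<open>The factor \<open>sqrt l\<close> in the tolerance converts the Euclidean error
    into one of at most \<delta> times \<open>sqrt (B \<Delta> \<Delta>)\<close>.\<close>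
  obtain d where d: "d > 0" "\<And>\<eta>. norm (\<eta> - \<xi>) < d \<Longrightarrow> norm (?F \<eta> - ?F \<xi> - D (\<eta> - \<xi>)) \<le> (\<delta> * sqrt l) * norm (\<eta> - \<xi>)"
  proof -
    have "0 < \<delta> * sqrt l" using \<delta>(1) l(1) by simp
    then show thesis using that D[folded \<xi>_def] unfolding has_derivative_at_alt by meson
  qed
  have F\<xi>: "?F \<xi> = f x" by (simp add: \<xi>_def param_coord[OF c x])
  have "isCont (coord M (c k)) (x k)"
    using continuous_coord[OF c] open_chart_dom[OF c] x by (simp add: continuous_on_eq_continuous_at)
  then have "\<forall>\<^sub>F y in at (x k). dist (coord M (c k) y) (coord M (c k) (x k)) < d"
    unfolding isCont_def using d(1) by (rule tendstoD)
  moreover have "\<forall>\<^sub>F y in at (x k). y \<in> chart_dom M (c k) \<and>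
      ennreal ((1 - \<delta>) * sqrt (B (coord M (c k) y - coord M (c k) (x k)) (coord M (c k) y - coord M (c k) (x k)))) \<le> geodesic_dist M (x k) y"
    using geodesic_dist_lower[OF c x \<delta>(1,2)] unfolding B_def eventually_at_filter
    by (rule eventually_mono) simp
  moreover have "\<forall>\<^sub>F y in at (x k). y \<noteq> x k" by (simp add: eventually_at_filter)
  ultimately have "\<forall>\<^sub>F y in at (x k). ennreal \<bar>f (x(k := x k)) - f (x(k := y))\<bar> / geodesic_dist M (x k) y \<le> ennreal (a + e)"
  proof eventually_elim
    case (elim y)
    define \<Delta> where "\<Delta> = coord M (c k) y - coord M (c k) (x k)"
    have y: "y \<in> chart_dom M (c k)" and dl: "ennreal ((1 - \<delta>) * sqrt (B \<Delta> \<Delta>)) \<le> geodesic_dist M (x k) y"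
      using elim(2) by (auto simp: \<Delta>_def)
    have "\<Delta> \<noteq> 0" using elim(3) param_coord[OF c y] param_coord[OF c x[of k]] by (auto simp: \<Delta>_def)
    then have N: "0 < sqrt (B \<Delta> \<Delta>)" using pos by simp
    have F: "?F (\<xi> + axis k \<Delta>) = f (x(k := y))"
    proof -
      have "param M (c j) ((\<xi> + axis k \<Delta>) $ j) = (x(k := y)) j" for j
        using param_coord[OF c y] param_coord[OF c x[of j]]
        by (cases "j = k") (auto simp: \<xi>_def axis_def \<Delta>_def)
      then have "(\<lambda>j. param M (c j) ((\<xi> + axis k \<Delta>) $ j)) = x(k := y)" by (rule ext)
      then show ?thesis by (simp only:)
    qed
    have small: "norm (\<xi> + axis k \<Delta> - \<xi>) < d"
      using elim(1) by (simp add: norm_axis_eq \<Delta>_def dist_norm)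
    have 1: "\<bar>f (x(k := y)) - f x - D (axis k \<Delta>)\<bar> \<le> \<delta> * sqrt l * norm \<Delta>"
      using d(2)[OF small] unfolding F F\<xi> by (simp add: norm_axis_eq)
    have 2: "\<bar>D (axis k \<Delta>)\<bar> \<le> a * sqrt (B \<Delta> \<Delta>)"
    proof -
      have "(B w \<Delta>)\<^sup>2 \<le> B w w * B \<Delta> \<Delta>"
        using form_cauchy_schwarz[OF bil sym nonneg, of \<Delta> w] pos[of \<Delta>] by fastforce
      then have "\<bar>B w \<Delta>\<bar> \<le> sqrt (B w w * B \<Delta> \<Delta>)" by (intro real_le_rsqrt) (simp only: power2_abs)
      then show ?thesis using w[of \<Delta>] by (simp add: B_def a_def real_sqrt_mult)
    qed
    have 3: "sqrt l * norm \<Delta> \<le> sqrt (B \<Delta> \<Delta>)"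
      using real_sqrt_le_mono[OF l(2)[of \<Delta>]] by (simp add: real_sqrt_mult)
    have "\<bar>f x - f (x(k := y))\<bar> \<le> a * sqrt (B \<Delta> \<Delta>) + \<delta> * (sqrt l * norm \<Delta>)"
      using 1 2 by (simp add: mult.assoc)
    also have "\<dots> \<le> (a + \<delta>) * sqrt (B \<Delta> \<Delta>)"
      using mult_left_mono[OF 3, of \<delta>] \<delta>(1) by (simp add: distrib_right)
    also have "\<dots> \<le> (a + e) * (1 - \<delta>) * sqrt (B \<Delta> \<Delta>)"
      using \<delta>(3) N by (intro mult_right_mono) auto
    finally have "ennreal \<bar>f x - f (x(k := y))\<bar> \<le> ennreal ((a + e) * ((1 - \<delta>) * sqrt (B \<Delta> \<Delta>)))"
      by (intro ennreal_leI) (simp add: mult.assoc)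
    also have "\<dots> = ennreal (a + e) * ennreal ((1 - \<delta>) * sqrt (B \<Delta> \<Delta>))"
      using a e \<delta>(2) N by (intro ennreal_mult) auto
    also have "\<dots> \<le> geodesic_dist M (x k) y * ennreal (a + e)"
      using dl by (simp add: mult.commute mult_left_mono)
    finally have le: "ennreal \<bar>f x - f (x(k := y))\<bar> \<le> geodesic_dist M (x k) y * ennreal (a + e)" .
    have "0 < ennreal ((1 - \<delta>) * sqrt (B \<Delta> \<Delta>))" using \<delta>(2) N by simp
    also note dl
    finally show ?case using le by (simp add: divide_le_posI_ennreal)
  qed
  then have "grad_norm M (\<lambda>y. f (x(k := y))) (x k) \<le> ennreal (a + e)"
    unfolding grad_norm_def by (rule Limsup_bounded)
  then show "grad_norm M (\<lambda>y. f (x(k := y))) (x k) \<le> ennreal (sqrt (metric M (c k) (x k) w w)) + ennreal e"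
    using a e by (simp add: a_def B_def ennreal_plus)
qed

text \<open>The direction \<open>W\<close> collects the representing vectors of all blocks. Then
  \<open>D W = A\<^sup>2\<close>, while \<open>W\<close> has length \<open>A\<close> for the product
  metric at \<open>x\<close>, so the quotient along the segment in direction \<open>W\<close>
  approaches at least \<open>A\<close>.\<close>

lemma power_gradient_ge:
  assumes w: "\<And>k v. metric M (c k) (x k) (w k) v = D (axis k v)"
  shows "ennreal (sqrt (\<Sum>k\<in>UNIV. metric M (c k) (x k) (w k) (w k))) \<le> grad_norm (riemannian_power M) f x"
proof (rule ennreal_le_epsilon)
  fix e :: real assume e: "0 < e"
  define \<xi> :: "'e^'n" where "\<xi> = (\<chi> k. coord M (c k) (x k))"
  define W :: "'e^'n" where "W = (\<chi> k. w k)"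
  define b where "b k = metric M (c k) (x k) (w k) (w k)" for k
  let ?P = "\<lambda>\<xi> :: 'e^'n. (\<lambda>k. param M (c k) (\<xi> $ k))"
  have b0: "0 \<le> b k" for k using metric_nonneg[OF c x] by (simp add: b_def)
  define A where "A = sqrt (\<Sum>k\<in>UNIV. b k)"
  have A2: "A\<^sup>2 = (\<Sum>k\<in>UNIV. b k)" using b0 by (simp add: A_def sum_nonneg)
  have A0: "0 \<le> A" using b0 by (simp add: A_def sum_nonneg)
  have "ennreal A \<le> grad_norm (riemannian_power M) f x + ennreal e"
  \<comment> \<open>The trivial case takes care of \<open>A = 0\<close>, where there is no direction
    to follow.\<close>
  proof (cases "A \<le> e")
    case True
    then show ?thesis by (intro order_trans[OF ennreal_leI[OF True]]) simp
  next
    case False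
    then have Apos: "0 < A" using e by simp
    \<comment> \<open>With \<open>e = 2 * \<delta> * A\<close> the relative errors of numerator and
      distance are absorbed by
      \<open>(1 - \<delta>) / (1 + \<delta>) \<ge> 1 - 2 * \<delta>\<close>.\<close>
    define \<delta> where "\<delta> = e / (2 * A)"
    have \<delta>: "0 < \<delta>" "\<delta> < 1" "A - e \<le> (1 - \<delta>) * A\<^sup>2 / ((1 + \<delta>) * A)"
    proof -
      show \<delta>0: "0 < \<delta>" "\<delta> < 1" using False e Apos by (auto simp: \<delta>_def divide_simps)
      have eA: "e = 2 * \<delta> * A" using Apos by (simp add: \<delta>_def)
      have "A - e = (1 - 2 * \<delta>) * A" by (simp add: eA algebra_simps)
      moreover have "(1 - 2 * \<delta>) * (1 + \<delta>) \<le> 1 - \<delta>" using \<delta>0 by (simp add: algebra_simps)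
      then have "1 - 2 * \<delta> \<le> (1 - \<delta>) / (1 + \<delta>)" using \<delta>0 by (simp add: pos_le_divide_eq)
      then have "(1 - 2 * \<delta>) * A \<le> (1 - \<delta>) / (1 + \<delta>) * A" using A0 by (rule mult_right_mono)
      moreover have "(1 - \<delta>) / (1 + \<delta>) * A = (1 - \<delta>) * A\<^sup>2 / ((1 + \<delta>) * A)"
        using Apos by (simp add: power2_eq_square)
      ultimately show "A - e \<le> (1 - \<delta>) * A\<^sup>2 / ((1 + \<delta>) * A)" by simp
    qed
    have linD: "linear D" using D has_derivative_linear by blast
    have DW: "D W = A\<^sup>2"
    proof -
      have "D W = (\<Sum>k\<in>UNIV. D (axis k (w k)))"
        unfolding W_def vec_eq_sum_axis by (rule linear_sum[OF linD])
      then show ?thesis by (simp add: A2 b_def w[symmetric])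
    qed
    have W0: "W \<noteq> 0" using DW Apos linear_0[OF linD] by auto
    \<comment> \<open>At the point \<open>\<xi> + h *\<^sub>R W\<close> this tolerance amounts to an
      error of at most \<open>h * (\<delta> * A\<^sup>2)\<close>, that is, \<delta> relative to the
      main term.\<close>
    have "0 < \<delta> * A\<^sup>2 / norm W" using \<delta>(1) Apos W0 by simp
    then obtain d where d: "d > 0" "\<And>\<eta>. norm (\<eta> - \<xi>) < d \<Longrightarrow>
        norm (f (?P \<eta>) - f (?P \<xi>) - D (\<eta> - \<xi>)) \<le> (\<delta> * A\<^sup>2 / norm W) * norm (\<eta> - \<xi>)"
      using D[folded \<xi>_def] unfolding has_derivative_at_alt by meson
    have P\<xi>: "?P \<xi> = x" by (simp add: \<xi>_def param_coord[OF c x])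
    have "\<forall>k. \<exists>r>0. ball (\<xi> $ k) r \<subseteq> chart_im M (c k) \<and>
      (\<forall>y\<in>ball (\<xi> $ k) r. \<forall>v. metric M (c k) (param M (c k) y) v v \<le> (1 + \<delta>) * metric M (c k) (x k) v v)"
      using metric_comparison[OF c x \<delta>(1)] unfolding \<xi>_def by (simp, metis)
    then obtain r where r: "\<And>k. r k > 0" "\<And>k. ball (\<xi> $ k) (r k) \<subseteq> chart_im M (c k)"
      "\<And>k y v. y \<in> ball (\<xi> $ k) (r k) \<Longrightarrow> metric M (c k) (param M (c k) y) v v \<le> (1 + \<delta>) * metric M (c k) (x k) v v"
      by metis
    define \<rho> where "\<rho> = Min (insert d (range r))"
    have \<rho>: "\<rho> > 0" "\<rho> \<le> d" "\<And>k. \<rho> \<le> r k" using d(1) r(1) by (auto simp: \<rho>_def min_le_iff_disj)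
    define h0 where "h0 = \<rho> / (2 * norm W)"
    have h0: "h0 > 0" "h0 * norm W < \<rho>" using \<rho>(1) W0 by (auto simp: h0_def)
    have near: "\<xi> $ k + t *\<^sub>R W $ k \<in> ball (\<xi> $ k) (r k)" if "t \<in> {0..h0}" for t :: real and k :: 'n
    proof -
      have "norm (t *\<^sub>R W $ k) \<le> h0 * norm W" using that Finite_Cartesian_Product.norm_nth_le[of W k] by (auto intro!: mult_mono)
      also have "\<dots> < r k" using h0(2) \<rho>(3)[of k] by simp
      finally show ?thesis by (simp add: dist_norm)
    qed
    define y where "y h = ?P (\<xi> + h *\<^sub>R W)" for h
    have cont: "continuous_on {0..h0} y"
      unfolding y_def
      by (rule continuous_on_compose2[OF continuous_power_param[OF c]])
        (use subsetD[OF r(2) near] in \<open>auto intro!: continuous_intros\<close>)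
    have "(y \<longlongrightarrow> y 0) (at 0 within {0..h0})"
      using cont h0(1) by (auto simp: continuous_on_def)
    then have lim: "(y \<longlongrightarrow> x) (at_right 0)"
      using h0(1) by (simp add: y_def P\<xi> at_within_Icc_at_right)
    have ev: "\<forall>\<^sub>F h in at_right 0. h \<in> {0<..<h0}"
      using eventually_at_right_real[OF h0(1)] by simp
    \<comment> \<open>The upper limit in \<open>grad_norm\<close> is taken along
      \<open>at x\<close>, which excludes \<open>x\<close> itself.\<close>
    have ne: "y h \<noteq> x" if h: "h \<in> {0<..<h0}" for h
    proof
      assume "y h = x"
      obtain k where k: "W $ k \<noteq> 0" using W0 by (auto simp: vec_eq_iff)
      have im: "\<xi> $ k + h *\<^sub>R W $ k \<in> chart_im M (c k)" using near[of h k] r(2)[of k] h by auto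
      have "param M (c k) (\<xi> $ k + h *\<^sub>R W $ k) = x k" using fun_cong[OF \<open>y h = x\<close>, of k] by (simp add: y_def)
      then have "\<xi> $ k + h *\<^sub>R W $ k = coord M (c k) (x k)" using coord_param[OF c im] by simp
      then show False using k h by (simp add: \<xi>_def)
    qed
    have "filterlim y (at x) (at_right 0)"
      using lim ev ne unfolding filterlim_at by (auto elim!: eventually_mono)
    have quot: "ennreal (A - e) \<le> ennreal \<bar>f x - f (y h)\<bar> / geodesic_dist (riemannian_power M) x (y h)"
      if h: "h \<in> {0<..<h0}" for h
    proof -
      have hW: "norm (\<xi> + h *\<^sub>R W - \<xi>) < d"
      proof -
        have "norm (h *\<^sub>R W) \<le> h0 * norm W" using h by (auto intro!: mult_right_mono)
        then show ?thesis using h0(2) \<rho>(2) by simp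
      qed
      have "\<bar>f (y h) - f x - h * A\<^sup>2\<bar> \<le> (\<delta> * A\<^sup>2 / norm W) * (h * norm W)"
        using d(2)[OF hW] h W0 by (simp add: y_def P\<xi> linear_scale[OF linD] DW mult.assoc)
      also have "\<dots> = h * (\<delta> * A\<^sup>2)" using W0 by simp
      finally have num: "h * ((1 - \<delta>) * A\<^sup>2) \<le> \<bar>f x - f (y h)\<bar>" by (simp add: algebra_simps)
      have "geodesic_dist (riemannian_power M) (?P \<xi>) (\<lambda>k. param M (c k) ((\<xi> + h *\<^sub>R W) $ k))
          \<le> ennreal (sqrt (\<Sum>k\<in>UNIV. (1 + \<delta>) * h\<^sup>2 * b k))"
      proof (rule power_dist_line_le[OF c])
        fix k and t :: real assume t: "t \<in> {0..1}"
        have th: "t * h \<in> {0..h0}" using t h by (auto intro: mult_le_one order_trans[OF mult_left_le_one_le])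
        have eq: "\<xi> $ k + t *\<^sub>R (h *\<^sub>R W) $ k = \<xi> $ k + (t * h) *\<^sub>R W $ k" by simp
        show "\<xi> $ k + t *\<^sub>R (h *\<^sub>R W) $ k \<in> chart_im M (c k)"
          unfolding eq using near[OF th] r(2) by blast
        have "metric M (c k) (param M (c k) (\<xi> $ k + t *\<^sub>R (h *\<^sub>R W) $ k)) ((h *\<^sub>R W) $ k) ((h *\<^sub>R W) $ k)
          \<le> (1 + \<delta>) * metric M (c k) (x k) ((h *\<^sub>R W) $ k) ((h *\<^sub>R W) $ k)"
          unfolding eq by (rule r(3)[OF near[OF th]])
        also have "\<dots> = (1 + \<delta>) * h\<^sup>2 * b k"
          using bilinear_lmul[OF metric_bilinear[OF c x]] bilinear_rmul[OF metric_bilinear[OF c x]]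
          by (simp add: b_def W_def power2_eq_square mult.assoc)
        finally show "metric M (c k) (param M (c k) (\<xi> $ k + t *\<^sub>R (h *\<^sub>R W) $ k)) ((h *\<^sub>R W) $ k) ((h *\<^sub>R W) $ k)
          \<le> (1 + \<delta>) * h\<^sup>2 * b k" .
      qed
      also have "sqrt (\<Sum>k\<in>UNIV. (1 + \<delta>) * h\<^sup>2 * b k) \<le> (1 + \<delta>) * (h * A)"
      proof (rule real_le_lsqrt)
        have "(\<Sum>k\<in>UNIV. (1 + \<delta>) * h\<^sup>2 * b k) = (1 + \<delta>) * (h * A)\<^sup>2"
          by (simp add: sum_distrib_left[symmetric] A2 power_mult_distrib mult.assoc)
        also have "\<dots> \<le> (1 + \<delta>)\<^sup>2 * (h * A)\<^sup>2"
          using \<delta>(1) by (intro mult_right_mono) (auto simp: power2_eq_square)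
        finally show "(\<Sum>k\<in>UNIV. (1 + \<delta>) * h\<^sup>2 * b k) \<le> ((1 + \<delta>) * (h * A))\<^sup>2"
          by (simp add: power_mult_distrib)
      qed (use \<delta> h A0 in auto)
      finally have den: "geodesic_dist (riemannian_power M) x (y h) \<le> ennreal ((1 + \<delta>) * (h * A))"
        by (simp add: y_def P\<xi> ennreal_leI)
      have "ennreal (A - e) \<le> ennreal ((1 - \<delta>) * A\<^sup>2 / ((1 + \<delta>) * A))" by (rule ennreal_leI[OF \<delta>(3)])
      also have "(1 - \<delta>) * A\<^sup>2 / ((1 + \<delta>) * A) = (h * ((1 - \<delta>) * A\<^sup>2)) / ((1 + \<delta>) * (h * A))"
        using h by simp
      also have "ennreal \<dots> \<le> ennreal \<bar>f x - f (y h)\<bar> / geodesic_dist (riemannian_power M) x (y h)"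
        by (rule ennreal_le_divide_if[OF ennreal_leI[OF num] den]) (use h \<delta> Apos in auto)
      finally show ?thesis .
    qed
    have "ennreal (A - e) \<le> grad_norm (riemannian_power M) f x"
    proof (rule ccontr)
      assume "\<not> ?thesis"
      then have "grad_norm (riemannian_power M) f x < ennreal (A - e)" by simp
      then have "\<forall>\<^sub>F y in at x. ennreal \<bar>f x - f y\<bar> / geodesic_dist (riemannian_power M) x y < ennreal (A - e)"
        unfolding grad_norm_def by (rule Limsup_lessD)
      then have "\<forall>\<^sub>F h in at_right 0. ennreal \<bar>f x - f (y h)\<bar> / geodesic_dist (riemannian_power M) x (y h) < ennreal (A - e)"
        using \<open>filterlim y (at x) (at_right 0)\<close> by (rule eventually_compose_filterlim)
      then have "\<forall>\<^sub>F h::real in at_right 0. False"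
        using ev by eventually_elim (use quot in \<open>auto simp: not_less[symmetric]\<close>)
      then show False by (simp add: trivial_limit_at_right_real)
    qed
    then have "ennreal (A - e) + ennreal e \<le> grad_norm (riemannian_power M) f x + ennreal e"
      by (rule add_right_mono)
    then show ?thesis using False e by (simp add: ennreal_plus[symmetric] del: ennreal_plus)
  qed
  then show "ennreal (sqrt (\<Sum>k\<in>UNIV. metric M (c k) (x k) (w k) (w k))) \<le> grad_norm (riemannian_power M) f x + ennreal e"
    by (simp add: A_def b_def)
qed

end

text \<open>\<open>H k\<close> is the squared dual norm of the \<open>k\<close>-th block of the
  differential. It is written with limits of difference quotients and a countable supremum so as to
  be Borel everywhere; its meaning is needed only at points of differentiability, which are almost
  all by Rademacher's theorem. There both slope estimates apply with the same representing
  vectors.\<close>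

lemma chart_gradient_comparison:
  fixes f :: "('n::finite \<Rightarrow> 'a) \<Rightarrow> real"
  assumes c: "\<And>k. c k \<in> charts M" and ll: "locally_lipschitz (riemannian_power M) f"
  obtains H :: "'n \<Rightarrow> 'e^'n \<Rightarrow> ennreal" where "\<And>k. H k \<in> borel_measurable borel"
    "AE \<xi> in lborel. \<forall>x. (\<forall>k. x k \<in> chart_dom M (c k)) \<and> \<xi> = (\<chi> k. coord M (c k) (x k)) \<longrightarrow>
      separates_gradients M f x (\<lambda>k. H k \<xi>)"
proof -
  let ?P = "\<lambda>\<xi> :: 'e^'n. (\<lambda>k. param M (c k) (\<xi> $ k))"
  define O' where "O' = {\<xi> :: 'e^'n. \<forall>k. \<xi> $ k \<in> chart_im M (c k)}"
  have O': "open O'" unfolding O'_def by (rule open_power_chart_im[OF c])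
  have lip: "\<exists>r>0. \<exists>L. L-lipschitz_on (ball \<xi> r) (\<lambda>\<xi>. f (?P \<xi>))" if "\<xi> \<in> O'" for \<xi>
    using coordinate_lipschitz[OF c ll] that by (simp add: O'_def)
  obtain Q :: "'e set" where Q: "countable Q" "\<And>X. open X \<Longrightarrow> X \<noteq> {} \<Longrightarrow> \<exists>d\<in>Q. d \<in> X"
    using countable_dense_exists by blast
  \<comment> \<open>Extension by 0 makes a function that is continuous on the open set
    \<open>O'\<close> Borel on the whole space. Only points of \<open>O'\<close> are coordinates of
    points of the power.\<close>
  define F where "F \<xi> = indicator O' \<xi> *\<^sub>R f (?P \<xi>)" for \<xi>
  have "continuous_on O' (\<lambda>\<xi>. f (?P \<xi>))"
    unfolding O'_def
    by (rule continuous_on_compose2[OF locally_lipschitz_continuous[OF ll] continuous_power_param[OF c]]) simp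
  then have [measurable]: "F \<in> borel_measurable borel"
    unfolding F_def using O' by (intro borel_measurable_continuous_on_indicator) auto
  \<comment> \<open>Where the quotients diverge, \<open>lim\<close> has an unspecified value, but
    the resulting function is Borel all the same.\<close>
  define q where "q k v \<xi> = lim (\<lambda>n. (F (\<xi> + (1 / real (Suc n)) *\<^sub>R axis k v) - F \<xi>) / (1 / real (Suc n)))" for k v \<xi>
  have [measurable]: "q k v \<in> borel_measurable borel" for k v unfolding q_def by measurable
  define g where "g k v \<xi> = indicator O' \<xi> *\<^sub>R metric M (c k) (param M (c k) (\<xi> $ k)) v v" for k v \<xi>
  have "continuous_on O' (\<lambda>\<xi>. metric M (c k) (param M (c k) (\<xi> $ k)) v v)" for k v
    by (rule continuous_on_compose2[OF metric_continuous[OF c]]) (auto simp: O'_def intro!: continuous_intros)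
  then have [measurable]: "g k v \<in> borel_measurable borel" for k v
    unfolding g_def using O' by (intro borel_measurable_continuous_on_indicator) auto
  define H where "H k \<xi> = (SUP v\<in>Q - {0}. ennreal ((q k v \<xi>)\<^sup>2 / g k v \<xi>))" for k \<xi>
  have meas: "H k \<in> borel_measurable borel" for k
    unfolding H_def by (intro borel_measurable_SUP) (use Q(1) in auto)
  have main: "(grad_norm M (\<lambda>y. f (x(k := y))) (x k))\<^sup>2 \<le> H k \<xi> \<and> (\<Sum>k\<in>UNIV. H k \<xi>) \<le> (grad_norm (riemannian_power M) f x)\<^sup>2"
    if diff: "(\<lambda>\<xi>. f (?P \<xi>)) differentiable (at \<xi>)" and x: "\<And>k. x k \<in> chart_dom M (c k)" and \<xi>: "\<xi> = (\<chi> k. coord M (c k) (x k))" for \<xi> x k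
  proof -
    have \<xi>O: "\<xi> \<in> O'" using coord_in[OF c x] by (simp add: O'_def \<xi>)
    obtain D where D: "((\<lambda>\<xi>. f (?P \<xi>)) has_derivative D) (at \<xi>)" using diff unfolding differentiable_def by blast
    have FD: "(F has_derivative D) (at \<xi>)"
      by (rule has_derivative_transform_within_open[OF D O' \<xi>O]) (simp add: F_def)
    have qD: "q k v \<xi> = D (axis k v)" for k v
      unfolding q_def by (rule limI[OF has_derivative_imp_tendsto_quotient[OF FD]])
    have lin: "linear D" using D by (rule has_derivative_linear)
    have "linear (\<lambda>v. D (axis k v))" for k
      using linear_compose[OF bounded_linear.linear[OF bounded_linear_axis] lin] by (simp add: o_def)
    then have "\<exists>w. \<forall>v. metric M (c k) (x k) w v = D (axis k v)" for k
      using form_representation[OF metric_bilinear[OF c x] metric_pos[OF c x]] by metis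
    then obtain w where w: "\<And>k v. metric M (c k) (x k) (w k) v = D (axis k v)" by metis
    define b where "b k = metric M (c k) (x k) (w k) (w k)" for k
    have b0: "0 \<le> b k" for k using metric_nonneg[OF c x] by (simp add: b_def)
    have Hb: "H k \<xi> = ennreal (b k)" for k
    proof -
      have "g k v \<xi> = metric M (c k) (x k) v v" for v
        using \<xi>O by (simp add: g_def \<xi> param_coord[OF c x])
      then have "H k \<xi> = (SUP v\<in>Q - {0}. ennreal ((metric M (c k) (x k) (w k) v)\<^sup>2 / metric M (c k) (x k) v v))"
        by (simp add: H_def qD w)
      also have "\<dots> = ennreal (b k)"
        unfolding b_def
        by (rule form_dual_norm_dense[OF metric_bilinear[OF c x] metric_sym[OF c x] metric_pos[OF c x] Q(2)])
      finally show ?thesis .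
    qed
    have "(grad_norm M (\<lambda>y. f (x(k := y))) (x k))\<^sup>2 \<le> (ennreal (sqrt (b k)))\<^sup>2"
      unfolding b_def by (intro power_mono_ennreal slice_gradient_le[OF c x D[unfolded \<xi>] w])
    then have 1: "(grad_norm M (\<lambda>y. f (x(k := y))) (x k))\<^sup>2 \<le> H k \<xi>"
      using b0 by (simp add: Hb ennreal_power)
    have "(\<Sum>k\<in>UNIV. H k \<xi>) = (ennreal (sqrt (\<Sum>k\<in>UNIV. b k)))\<^sup>2"
      using b0 by (simp add: Hb ennreal_power sum_nonneg)
    also have "\<dots> \<le> (grad_norm (riemannian_power M) f x)\<^sup>2"
      unfolding b_def by (intro power_mono_ennreal power_gradient_ge[OF c x D[unfolded \<xi>] w])
    finally show ?thesis using 1 by simp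
  qed
  have "AE \<xi> in lborel. \<xi> \<in> O' \<longrightarrow> (\<lambda>\<xi>. f (?P \<xi>)) differentiable (at \<xi>)"
    by (rule rademacher_local[OF O' lip])
  then have "AE \<xi> in lborel. \<forall>x. (\<forall>k. x k \<in> chart_dom M (c k)) \<and> \<xi> = (\<chi> k. coord M (c k) (x k)) \<longrightarrow>
      separates_gradients M f x (\<lambda>k. H k \<xi>)"
  proof eventually_elim
    case (elim \<xi>)
    show ?case
    proof (intro allI impI)
      fix x assume x: "(\<forall>k. x k \<in> chart_dom M (c k)) \<and> \<xi> = (\<chi> k. coord M (c k) (x k))"
      then have "\<xi> \<in> O'" using coord_in[OF c] by (simp add: O'_def)
      then show "separates_gradients M f x (\<lambda>k. H k \<xi>)"
        using main elim x by (simp add: separates_gradients_def)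
    qed
  qed
  with meas show thesis by (rule that)
qed

end

section \<open>The Efron--Stein inequality\<close>

text \<open>A real-valued variance, so that integrals can be subtracted and Fubini used for each
  term. It is meant for bounded measurable functions under a probability measure, where
  \<open>real_var_eq\<close> identifies it with \<open>Var\<close>.\<close>

definition real_var :: "'a measure \<Rightarrow> ('a \<Rightarrow> real) \<Rightarrow> real" where
  "real_var N u = (\<integral>x. (u x)\<^sup>2 \<partial>N) - (\<integral>x. u x \<partial>N)\<^sup>2"

lemma (in prob_space) integrable_bounded:
  fixes u :: "'a \<Rightarrow> real"
  assumes "u \<in> borel_measurable M" "\<And>x. x \<in> space M \<Longrightarrow> \<bar>u x\<bar> \<le> C"
  shows "integrable M u"
  by (rule integrable_const_bound[of u C]) (use assms in auto)

lemma (in prob_space) integral_abs_bound: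
  fixes u :: "'a \<Rightarrow> real"
  assumes "u \<in> borel_measurable M" "\<And>x. x \<in> space M \<Longrightarrow> \<bar>u x\<bar> \<le> C"
  shows "\<bar>\<integral>x. u x \<partial>M\<bar> \<le> C"
proof -
  have int: "integrable M u" by (rule integrable_bounded[OF assms])
  have le: "u x \<le> C" "- C \<le> u x" if "x \<in> space M" for x
    using assms(2)[OF that] by (simp_all add: abs_le_iff minus_le_iff)
  have "(\<integral>x. u x \<partial>M) \<le> (\<integral>x. C \<partial>M)" "(\<integral>x. - C \<partial>M) \<le> (\<integral>x. u x \<partial>M)"
    by (rule integral_mono; use int le in simp)+
  then show ?thesis by (simp add: prob_space)
qed

lemma (in prob_space) real_var_eq:
  fixes u :: "'a \<Rightarrow> real"
  assumes u[measurable]: "u \<in> borel_measurable M" and b: "\<And>x. x \<in> space M \<Longrightarrow> \<bar>u x\<bar> \<le> C"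
  shows "real_var M u = (\<integral>x. (u x - (\<integral>y. u y \<partial>M))\<^sup>2 \<partial>M)"
    and "Var M u = ennreal (real_var M u)"
    and "0 \<le> real_var M u" and "real_var M u \<le> C\<^sup>2"
proof -
  let ?m = "\<integral>y. u y \<partial>M"
  have int: "integrable M u" by (rule integrable_bounded[OF assms])
  have sq: "(u x)\<^sup>2 \<le> C\<^sup>2" if "x \<in> space M" for x
    using power_mono[OF b[OF that], of 2] by simp
  have int2: "integrable M (\<lambda>x. (u x)\<^sup>2)"
    by (rule integrable_bounded[where C = "C\<^sup>2"]) (use sq in auto)
  have expand: "(u x - ?m)\<^sup>2 = (u x)\<^sup>2 - 2 * ?m * u x + ?m\<^sup>2" for x
    by (simp add: power2_diff)
  have intd: "integrable M (\<lambda>x. (u x - ?m)\<^sup>2)"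
    unfolding expand using int int2 by auto
  show eq: "real_var M u = (\<integral>x. (u x - ?m)\<^sup>2 \<partial>M)"
  proof -
    have "(\<integral>x. (u x)\<^sup>2 - 2 * ?m * u x + ?m\<^sup>2 \<partial>M) = (\<integral>x. (u x)\<^sup>2 \<partial>M) - 2 * ?m * ?m + ?m\<^sup>2"
      using int int2 by (simp add: prob_space)
    then show ?thesis unfolding expand real_var_def by (simp add: power2_eq_square)
  qed
  show nonneg: "0 \<le> real_var M u"
    unfolding eq by (rule integral_nonneg_AE) auto
  show "Var M u = ennreal (real_var M u)"
    unfolding Var_def eq by (rule nn_integral_eq_integral[OF intd]) auto
  have "(\<integral>x. (u x)\<^sup>2 \<partial>M) \<le> (\<integral>x. C\<^sup>2 \<partial>M)" using int2 sq by (intro integral_mono) auto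
  then have "(\<integral>x. (u x)\<^sup>2 \<partial>M) \<le> C\<^sup>2" by (simp add: prob_space)
  moreover have "0 \<le> (\<integral>x. u x \<partial>M)\<^sup>2" by simp
  ultimately show "real_var M u \<le> C\<^sup>2" unfolding real_var_def by linarith
qed

text \<open>With marginals \<open>m\<close>, \<open>n\<close> and mean \<open>I\<close> of \<open>F\<close>, the claim is that \<open>(F - m - n + I)\<^sup>2\<close> has a nonnegative integral.\<close>

lemma real_var_product_le:
  fixes F :: "'a \<Rightarrow> 'b \<Rightarrow> real"
  assumes A: "prob_space A" and B: "prob_space B"
    and F[measurable]: "(\<lambda>(a, b). F a b) \<in> borel_measurable (A \<Otimes>\<^sub>M B)"
    and bound: "\<And>a b. a \<in> space A \<Longrightarrow> b \<in> space B \<Longrightarrow> \<bar>F a b\<bar> \<le> C"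
  shows "(\<integral>a. \<integral>b. (F a b)\<^sup>2 \<partial>B \<partial>A) - (\<integral>a. \<integral>b. F a b \<partial>B \<partial>A)\<^sup>2
    \<le> (\<integral>a. real_var B (F a) \<partial>A) + (\<integral>b. real_var A (\<lambda>a. F a b) \<partial>B)"
proof -
  interpret A: prob_space A by fact
  interpret B: prob_space B by fact
  interpret P: pair_prob_space A B ..
  have intP: "integrable (A \<Otimes>\<^sub>M B) (\<lambda>(a, b). u a b)"
    if "(\<lambda>(a, b). u a b) \<in> borel_measurable (A \<Otimes>\<^sub>M B)" "\<And>a b. a \<in> space A \<Longrightarrow> b \<in> space B \<Longrightarrow> \<bar>u a b\<bar> \<le> c"
    for u :: "'a \<Rightarrow> 'b \<Rightarrow> real" and c
    by (rule P.integrable_bounded[where C = c]) (use that in \<open>auto simp: space_pair_measure\<close>)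
  define m where "m a = (\<integral>b. F a b \<partial>B)" for a
  define n where "n b = (\<integral>a. F a b \<partial>A)" for b
  define I where "I = (\<integral>a. m a \<partial>A)"
  have m[measurable]: "m \<in> borel_measurable A" unfolding m_def by measurable
  have n[measurable]: "n \<in> borel_measurable B" unfolding n_def by measurable
  have mb: "\<bar>m a\<bar> \<le> C" if "a \<in> space A" for a
    unfolding m_def by (rule B.integral_abs_bound) (use that bound in auto)
  have nb: "\<bar>n b\<bar> \<le> C" if "b \<in> space B" for b
    unfolding n_def by (rule A.integral_abs_bound) (use that bound in auto)
  have Ib: "\<bar>I\<bar> \<le> C" unfolding I_def by (rule A.integral_abs_bound) (use mb in auto)
  have intF: "integrable (A \<Otimes>\<^sub>M B) (\<lambda>(a, b). F a b)" by (rule intP[OF F bound])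
  have In: "I = (\<integral>b. n b \<partial>B)"
    unfolding I_def m_def n_def by (rule P.Fubini_integral[OF intF, symmetric])
  have sq: "(F a b)\<^sup>2 \<le> C\<^sup>2" if "a \<in> space A" "b \<in> space B" for a b
    using power_mono[OF bound[OF that], of 2] by simp
  have intF2: "integrable (A \<Otimes>\<^sub>M B) (\<lambda>(a, b). (F a b)\<^sup>2)"
  proof (rule intP)
    show "(\<lambda>(a, b). (F a b)\<^sup>2) \<in> borel_measurable (A \<Otimes>\<^sub>M B)" by measurable
  qed (use sq in auto)
  define S where "S = (\<integral>a. \<integral>b. (F a b)\<^sup>2 \<partial>B \<partial>A)"
  have S': "S = (\<integral>b. \<integral>a. (F a b)\<^sup>2 \<partial>A \<partial>B)"
    unfolding S_def by (rule P.Fubini_integral[OF intF2, symmetric])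
  define m2 where "m2 = (\<integral>a. (m a)\<^sup>2 \<partial>A)"
  define n2 where "n2 = (\<integral>b. (n b)\<^sup>2 \<partial>B)"
  have msq: "\<bar>(m a)\<^sup>2\<bar> \<le> C\<^sup>2" if "a \<in> space A" for a using power_mono[OF mb[OF that], of 2] by simp
  have nsq: "\<bar>(n b)\<^sup>2\<bar> \<le> C\<^sup>2" if "b \<in> space B" for b using power_mono[OF nb[OF that], of 2] by simp
  have intm: "integrable A m" "integrable A (\<lambda>a. (m a)\<^sup>2)"
    by (rule A.integrable_bounded[OF m mb], assumption) (rule A.integrable_bounded[OF _ msq], auto)
  have intn: "integrable B n" "integrable B (\<lambda>b. (n b)\<^sup>2)"
    by (rule B.integrable_bounded[OF n nb], assumption) (rule B.integrable_bounded[OF _ nsq], auto)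
  have intFa: "integrable A (\<lambda>a. \<integral>b. (F a b)\<^sup>2 \<partial>B)" using P.integrable_fst'[OF intF2] by simp
  have intFb: "integrable B (\<lambda>b. \<integral>a. (F a b)\<^sup>2 \<partial>A)"
  proof (rule B.integrable_bounded[where C = "C\<^sup>2"])
    show "\<bar>\<integral>a. (F a b)\<^sup>2 \<partial>A\<bar> \<le> C\<^sup>2" if "b \<in> space B" for b
      by (rule A.integral_abs_bound) (use that sq in auto)
  qed measurable
  have varB: "(\<integral>a. real_var B (F a) \<partial>A) = S - m2"
    unfolding real_var_def S_def m2_def m_def[symmetric] using intm intFa by simp
  have varA: "(\<integral>b. real_var A (\<lambda>a. F a b) \<partial>B) = S - n2"
    unfolding real_var_def S' n2_def n_def[symmetric] using intn intFb by simp
  have inner: "(\<integral>b. (F a b - m a - n b + I)\<^sup>2 \<partial>B) = (\<integral>b. (F a b)\<^sup>2 \<partial>B) - (m a)\<^sup>2 + n2 - I\<^sup>2 - 2 * (\<integral>b. F a b * n b \<partial>B) + 2 * m a * I"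
    if a: "a \<in> space A" for a
  proof -
    have i1: "integrable B (F a)" by (rule B.integrable_bounded) (use a bound in auto)
    have i2: "integrable B (\<lambda>b. (F a b)\<^sup>2)" by (rule B.integrable_bounded[where C = "C\<^sup>2"]) (use a sq in auto)
    have i3: "integrable B (\<lambda>b. F a b * n b)"
    proof (rule B.integrable_bounded[where C = "C * C"])
      show "\<bar>F a b * n b\<bar> \<le> C * C" if b: "b \<in> space B" for b
        unfolding abs_mult using order_trans[OF abs_ge_zero bound[OF a b]] by (intro mult_mono bound nb a b) auto
    qed (use a in measurable)
    have "(F a b - m a - n b + I)\<^sup>2 = (F a b)\<^sup>2 + (m a - I)\<^sup>2 + (n b)\<^sup>2 - 2 * (m a - I) * F a b - 2 * (F a b * n b) + 2 * (m a - I) * n b" for b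
      by (simp add: power2_eq_square algebra_simps)
    then have "(\<integral>b. (F a b - m a - n b + I)\<^sup>2 \<partial>B) =
      (\<integral>b. (F a b)\<^sup>2 \<partial>B) + (m a - I)\<^sup>2 + n2 - 2 * (m a - I) * m a - 2 * (\<integral>b. F a b * n b \<partial>B) + 2 * (m a - I) * I"
      using i1 i2 i3 intn by (simp add: B.prob_space n2_def m_def In)
    then show ?thesis by (simp add: power2_eq_square algebra_simps)
  qed
  have FnP: "integrable (A \<Otimes>\<^sub>M B) (\<lambda>(a, b). F a b * n b)"
  proof (rule intP)
    show "(\<lambda>(a, b). F a b * n b) \<in> borel_measurable (A \<Otimes>\<^sub>M B)" by measurable
    show "\<bar>F a b * n b\<bar> \<le> C * C" if "a \<in> space A" "b \<in> space B" for a b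
      unfolding abs_mult using order_trans[OF abs_ge_zero bound[OF that]] by (intro mult_mono bound nb that) auto
  qed
  \<comment> \<open>Integrating over \<open>a\<close> first replaces \<open>F a b\<close> by its
    marginal \<open>n b\<close>.\<close>
  have Fn: "(\<integral>a. \<integral>b. F a b * n b \<partial>B \<partial>A) = n2"
  proof -
    have "(\<integral>a. \<integral>b. F a b * n b \<partial>B \<partial>A) = (\<integral>b. \<integral>a. F a b * n b \<partial>A \<partial>B)"
      by (rule P.Fubini_integral[OF FnP, symmetric])
    also have "\<dots> = n2" by (simp add: n2_def n_def[symmetric] power2_eq_square)
    finally show ?thesis .
  qed
  have intFn: "integrable A (\<lambda>a. \<integral>b. F a b * n b \<partial>B)" using P.integrable_fst'[OF FnP] by simp
  have "0 \<le> (\<integral>a. (\<integral>b. (F a b - m a - n b + I)\<^sup>2 \<partial>B) \<partial>A)"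
    by (intro integral_nonneg_AE AE_I2) auto
  also have "\<dots> = (\<integral>a. (\<integral>b. (F a b)\<^sup>2 \<partial>B) - (m a)\<^sup>2 + n2 - I\<^sup>2 - 2 * (\<integral>b. F a b * n b \<partial>B) + 2 * m a * I \<partial>A)"
    by (rule Bochner_Integration.integral_cong[OF refl inner])
  also have "\<dots> = S - m2 + n2 - I\<^sup>2 - 2 * n2 + 2 * I * I"
    using intm intFa intFn Fn by (simp add: A.prob_space S_def m2_def I_def)
  \<comment> \<open>By \<open>varB\<close> and \<open>varA\<close> the claim reads
    \<open>S - I\<^sup>2 \<le> (S - m2) + (S - n2)\<close>, which is this inequality
    rearranged.\<close>
  finally have "m2 + n2 \<le> S + I\<^sup>2" by (simp add: power2_eq_square)
  then show ?thesis
    unfolding varA varB S_def[symmetric] by (simp add: I_def m_def)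
qed

section \<open>Resampling one coordinate, and induction on the number of factors\<close>

context
  fixes \<mu> :: "'a measure"
  assumes prob: "prob_space \<mu>"
begin

interpretation prob_space \<mu> by (rule prob)

lemma prob_space_PiM_const: "prob_space (\<Pi>\<^sub>M k\<in>I. \<mu>)"
  by (rule prob_space_PiM) (rule prob)

text \<open>For \<open>k \<in> I\<close> the map that usually adds a coordinate overwrites an
  existing one, as \<open>insert k I = I\<close>.\<close>

lemma measurable_fun_upd_pair:
  "k \<in> I \<Longrightarrow> (\<lambda>(x, z). x(k := z)) \<in> (\<Pi>\<^sub>M k\<in>I. \<mu>) \<Otimes>\<^sub>M \<mu> \<rightarrow>\<^sub>M (\<Pi>\<^sub>M k\<in>I. \<mu>)"
  using measurable_add_dim[of k I "\<lambda>_. \<mu>"] by (simp add: insert_absorb)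

lemma fun_upd_in_space:
  "x \<in> space (\<Pi>\<^sub>M k\<in>I. \<mu>) \<Longrightarrow> z \<in> space \<mu> \<Longrightarrow> x(k := z) \<in> space (\<Pi>\<^sub>M k\<in>insert k I. \<mu>)"
  by (auto simp: space_PiM PiE_def extensional_def)

lemma real_var_slice_measurable:
  assumes k: "k \<in> I" and f[measurable]: "f \<in> borel_measurable (\<Pi>\<^sub>M k\<in>I. \<mu>)"
  shows "(\<lambda>x. real_var \<mu> (\<lambda>z. f (x(k := z)))) \<in> borel_measurable (\<Pi>\<^sub>M k\<in>I. \<mu>)"
proof -
  note [measurable] = measurable_fun_upd_pair[OF k]
  have [measurable]: "(\<lambda>(x, z). f (x(k := z))) \<in> borel_measurable ((\<Pi>\<^sub>M k\<in>I. \<mu>) \<Otimes>\<^sub>M \<mu>)"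
    using measurable_compose[OF measurable_fun_upd_pair[OF k] f] by (simp add: case_prod_beta')
  show ?thesis unfolding real_var_def by measurable
qed

text \<open>The new coordinate \<open>i\<close> is split off as the second factor in
  \<open>real_var_product_le\<close>. One resulting term is the averaged variance in
  \<open>i\<close>. The other averages, over the value \<open>z\<close> of that coordinate, the
  variance in the remaining ones, to which the induction hypothesis applies for each fixed
  \<open>z\<close>.\<close>

theorem efron_stein_real:
  fixes f :: "('i \<Rightarrow> 'a) \<Rightarrow> real"
  assumes "finite I" "f \<in> borel_measurable (\<Pi>\<^sub>M k\<in>I. \<mu>)" "\<And>x. x \<in> space (\<Pi>\<^sub>M k\<in>I. \<mu>) \<Longrightarrow> \<bar>f x\<bar> \<le> C"
  shows "real_var (\<Pi>\<^sub>M k\<in>I. \<mu>) f \<le> (\<Sum>k\<in>I. \<integral>x. real_var \<mu> (\<lambda>z. f (x(k := z))) \<partial>(\<Pi>\<^sub>M k\<in>I. \<mu>))"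
  using assms
proof (induction I arbitrary: f rule: finite_induct)
  case empty
  show ?case
    by (simp add: real_var_def PiM_empty lebesgue_integral_count_space_finite)
next
  case (insert i I)
  let ?P = "\<Pi>\<^sub>M k\<in>I. \<mu>" and ?Q = "\<Pi>\<^sub>M k\<in>insert i I. \<mu>"
  interpret P: prob_space ?P by (rule prob_space_PiM_const)
  interpret Q: prob_space ?Q by (rule prob_space_PiM_const)
  interpret PM: pair_prob_space ?P \<mu> ..
  interpret PP: product_prob_space "\<lambda>_ :: 'i. \<mu>" by unfold_locales
  note f[measurable] = insert.prems(1)
  have b: "\<bar>f x\<bar> \<le> C" if "x \<in> space ?Q" for x using insert.prems(2) that by simp
  have bF: "\<bar>f (x(i := z))\<bar> \<le> C" if "x \<in> space ?P" "z \<in> space \<mu>" for x z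
    by (rule b[OF fun_upd_in_space[OF that]])
  have add_dim: "(\<lambda>(x, z). x(i := z)) \<in> ?P \<Otimes>\<^sub>M \<mu> \<rightarrow>\<^sub>M ?Q"
    by (rule measurable_add_dim)
  have F[measurable]: "(\<lambda>(x, z). f (x(i := z))) \<in> borel_measurable (?P \<Otimes>\<^sub>M \<mu>)"
    using measurable_compose[OF add_dim f] by (simp add: case_prod_beta')
  have int: "integrable ?Q u" if "u \<in> borel_measurable ?Q" "\<And>x. x \<in> space ?Q \<Longrightarrow> \<bar>u x\<bar> \<le> c" for u :: "_ \<Rightarrow> real" and c
    by (rule Q.integrable_bounded[OF that])
  have insert_integral: "(\<integral>x. u x \<partial>?Q) = (\<integral>x. \<integral>z. u (x(i := z)) \<partial>\<mu> \<partial>?P)" if "integrable ?Q u" for u :: "_ \<Rightarrow> real"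
    by (rule PP.product_integral_insert[OF insert.hyps(1,2) that])
  have sq: "\<bar>(f x)\<^sup>2\<bar> \<le> C\<^sup>2" if "x \<in> space ?Q" for x using power_mono[OF b[OF that], of 2] by simp
  have slice_b: "\<bar>real_var \<mu> (\<lambda>z. f (x(k := z)))\<bar> \<le> C\<^sup>2" if x: "x \<in> space ?Q" and k: "k \<in> insert i I" for x k
  proof -
    have "(\<lambda>z. f (x(k := z))) \<in> borel_measurable \<mu>"
      using measurable_Pair2[OF measurable_compose[OF measurable_fun_upd_pair[OF k] f] x] by (simp add: fun_upd_def)
    moreover have "\<bar>f (x(k := z))\<bar> \<le> C" if "z \<in> space \<mu>" for z
      using b[of "x(k := z)"] fun_upd_in_space[OF x that, of k] k by (simp add: insert_absorb)
    ultimately show ?thesis using real_var_eq(3,4)[of "\<lambda>z. f (x(k := z))" C] by simp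
  qed
  have slice_int: "integrable ?Q (\<lambda>x. real_var \<mu> (\<lambda>z. f (x(k := z))))" if "k \<in> insert i I" for k
    by (rule int[OF real_var_slice_measurable[OF that f] slice_b[OF _ that]])
  define V where "V k x = real_var \<mu> (\<lambda>y. f (x(k := y)))" for k x
  have V: "V k (x(i := z)) = real_var \<mu> (\<lambda>y. f (x(k := y, i := z)))" if "k \<in> I" for k x z
  proof -
    have "k \<noteq> i" using that insert.hyps(2) by auto
    then show ?thesis by (simp add: V_def fun_upd_twist)
  qed
  have V_pair: "integrable (?P \<Otimes>\<^sub>M \<mu>) (\<lambda>(x, z). V k (x(i := z)))" if k: "k \<in> I" for k
  proof (rule PM.integrable_bounded)
    have "V k \<in> borel_measurable ?Q"
      unfolding V_def by (rule real_var_slice_measurable[OF _ f]) (use k in simp)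
    from measurable_compose[OF add_dim this]
    show "(\<lambda>(x, z). V k (x(i := z))) \<in> borel_measurable (?P \<Otimes>\<^sub>M \<mu>)" by (simp add: case_prod_beta')
    show "\<bar>case p of (x, z) \<Rightarrow> V k (x(i := z))\<bar> \<le> C\<^sup>2" if "p \<in> space (?P \<Otimes>\<^sub>M \<mu>)" for p
      using that slice_b[OF fun_upd_in_space, of "fst p" "snd p" k] k by (auto simp: V_def space_pair_measure)
  qed
  have swap_int: "integrable \<mu> (\<lambda>z. \<integral>x. real_var \<mu> (\<lambda>y. f (x(k := y, i := z))) \<partial>?P)" if k: "k \<in> I" for k
    using PM.integrable_snd[OF V_pair[OF k]] by (simp add: V[OF k])
  \<comment> \<open>Updates at \<open>k\<close> and \<open>i\<close> commute because
    \<open>k \<noteq> i\<close>, so by Fubini the terms from the induction hypothesis, averaged over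
    \<open>z\<close>, are integrals over the enlarged product.\<close>
  have swap_eq: "(\<integral>z. (\<integral>x. real_var \<mu> (\<lambda>y. f (x(k := y, i := z))) \<partial>?P) \<partial>\<mu>) = (\<integral>x. real_var \<mu> (\<lambda>y. f (x(k := y))) \<partial>?Q)"
    if k: "k \<in> I" for k
  proof -
    have "(\<integral>x. V k x \<partial>?Q) = (\<integral>x. \<integral>z. V k (x(i := z)) \<partial>\<mu> \<partial>?P)"
      by (rule insert_integral) (use slice_int[of k] k in \<open>simp add: V_def\<close>)
    also have "\<dots> = (\<integral>z. \<integral>x. V k (x(i := z)) \<partial>?P \<partial>\<mu>)"
      by (rule PM.Fubini_integral[OF V_pair[OF k], symmetric])
    finally show ?thesis by (simp add: V[OF k]) (simp add: V_def)
  qed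
  have "real_var ?Q f = (\<integral>x. \<integral>z. (f (x(i := z)))\<^sup>2 \<partial>\<mu> \<partial>?P) - (\<integral>x. \<integral>z. f (x(i := z)) \<partial>\<mu> \<partial>?P)\<^sup>2"
    unfolding real_var_def
    by (subst insert_integral[OF int[OF f b]], assumption, subst insert_integral[OF int[OF _ sq]]) auto
  also have "\<dots> \<le> (\<integral>x. real_var \<mu> (\<lambda>z. f (x(i := z))) \<partial>?P) + (\<integral>z. real_var ?P (\<lambda>x. f (x(i := z))) \<partial>\<mu>)"
    by (rule real_var_product_le[OF P.prob_space_axioms prob F bF])
  \<comment> \<open>The variance in coordinate \<open>i\<close> does not depend on the current value
    at \<open>i\<close>, so integrating over that value as well changes nothing.\<close>
  also have "(\<integral>x. real_var \<mu> (\<lambda>z. f (x(i := z))) \<partial>?P) = (\<integral>x. real_var \<mu> (\<lambda>z. f (x(i := z))) \<partial>?Q)"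
    by (subst insert_integral[OF slice_int]) (auto simp: prob_space)
  also have "(\<integral>z. real_var ?P (\<lambda>x. f (x(i := z))) \<partial>\<mu>) \<le> (\<integral>z. (\<Sum>k\<in>I. \<integral>x. real_var \<mu> (\<lambda>y. f (x(k := y, i := z))) \<partial>?P) \<partial>\<mu>)"
  proof (rule integral_mono)
    have meas: "(\<lambda>x. f (x(i := z))) \<in> borel_measurable ?P" if z: "z \<in> space \<mu>" for z
      using measurable_Pair1[OF F z] by simp
    have vb: "\<bar>real_var ?P (\<lambda>x. f (x(i := z)))\<bar> \<le> C\<^sup>2" if z: "z \<in> space \<mu>" for z
      using P.real_var_eq(3,4)[OF meas[OF z] bF[OF _ z]] by simp
    show "integrable \<mu> (\<lambda>z. real_var ?P (\<lambda>x. f (x(i := z))))"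
    proof (rule integrable_bounded[OF _ vb])
      have [measurable]: "(\<lambda>(z, x). f (x(i := z))) \<in> borel_measurable (\<mu> \<Otimes>\<^sub>M ?P)"
        using measurable_compose[OF measurable_pair_swap' F] by (simp add: case_prod_beta')
      show "(\<lambda>z. real_var ?P (\<lambda>x. f (x(i := z)))) \<in> borel_measurable \<mu>"
        unfolding real_var_def by measurable
    qed
    show "integrable \<mu> (\<lambda>z. \<Sum>k\<in>I. \<integral>x. real_var \<mu> (\<lambda>y. f (x(k := y, i := z))) \<partial>?P)"
      by (rule Bochner_Integration.integrable_sum) (use swap_int in simp)
    fix z assume z: "z \<in> space \<mu>"
    show "real_var ?P (\<lambda>x. f (x(i := z))) \<le> (\<Sum>k\<in>I. \<integral>x. real_var \<mu> (\<lambda>y. f (x(k := y, i := z))) \<partial>?P)"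
      by (rule insert.IH[OF meas[OF z] bF[OF _ z]])
  qed
  also have "\<dots> = (\<Sum>k\<in>I. \<integral>x. real_var \<mu> (\<lambda>y. f (x(k := y))) \<partial>?Q)"
  proof -
    have "(\<integral>z. (\<Sum>k\<in>I. \<integral>x. real_var \<mu> (\<lambda>y. f (x(k := y, i := z))) \<partial>?P) \<partial>\<mu>) =
        (\<Sum>k\<in>I. \<integral>z. (\<integral>x. real_var \<mu> (\<lambda>y. f (x(k := y, i := z))) \<partial>?P) \<partial>\<mu>)"
      by (rule Bochner_Integration.integral_sum) (use swap_int in simp)
    also have "\<dots> = (\<Sum>k\<in>I. \<integral>x. real_var \<mu> (\<lambda>y. f (x(k := y))) \<partial>?Q)"
      by (rule sum.cong) (use swap_eq in simp_all)
    finally show ?thesis .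
  qed
  finally show ?case by (simp only: sum.insert[OF insert.hyps(1,2)] add_left_mono)
qed

theorem efron_stein:
  fixes f :: "('i \<Rightarrow> 'a) \<Rightarrow> real"
  assumes I: "finite I" and f: "f \<in> borel_measurable (\<Pi>\<^sub>M k\<in>I. \<mu>)"
    and b: "\<And>x. x \<in> space (\<Pi>\<^sub>M k\<in>I. \<mu>) \<Longrightarrow> \<bar>f x\<bar> \<le> C"
  shows "Var (\<Pi>\<^sub>M k\<in>I. \<mu>) f \<le> (\<Sum>k\<in>I. \<integral>\<^sup>+x. Var \<mu> (\<lambda>z. f (x(k := z))) \<partial>(\<Pi>\<^sub>M k\<in>I. \<mu>))"
proof -
  let ?P = "\<Pi>\<^sub>M k\<in>I. \<mu>"
  interpret P: prob_space ?P by (rule prob_space_PiM_const)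
  have slice: "Var \<mu> (\<lambda>z. f (x(k := z))) = ennreal (real_var \<mu> (\<lambda>z. f (x(k := z))))"
    "0 \<le> real_var \<mu> (\<lambda>z. f (x(k := z)))" "real_var \<mu> (\<lambda>z. f (x(k := z))) \<le> C\<^sup>2"
    if k: "k \<in> I" and x: "x \<in> space ?P" for k x
  proof -
    have "(\<lambda>z. f (x(k := z))) \<in> borel_measurable \<mu>"
      using measurable_Pair2[OF measurable_compose[OF measurable_fun_upd_pair[OF k] f] x] by (simp add: fun_upd_def)
    moreover have "\<bar>f (x(k := z))\<bar> \<le> C" if "z \<in> space \<mu>" for z
      using b[of "x(k := z)"] fun_upd_in_space[OF x that, of k] k by (simp add: insert_absorb)
    ultimately show "Var \<mu> (\<lambda>z. f (x(k := z))) = ennreal (real_var \<mu> (\<lambda>z. f (x(k := z))))"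
      "0 \<le> real_var \<mu> (\<lambda>z. f (x(k := z)))" "real_var \<mu> (\<lambda>z. f (x(k := z))) \<le> C\<^sup>2"
      using real_var_eq(2-4)[of "\<lambda>z. f (x(k := z))" C] by auto
  qed
  have "(\<integral>\<^sup>+x. Var \<mu> (\<lambda>z. f (x(k := z))) \<partial>?P) = ennreal (\<integral>x. real_var \<mu> (\<lambda>z. f (x(k := z))) \<partial>?P)" if k: "k \<in> I" for k
  proof -
    have "(\<integral>\<^sup>+x. Var \<mu> (\<lambda>z. f (x(k := z))) \<partial>?P) = (\<integral>\<^sup>+x. ennreal (real_var \<mu> (\<lambda>z. f (x(k := z)))) \<partial>?P)"
      by (rule nn_integral_cong) (rule slice(1)[OF k])
    also have "\<dots> = ennreal (\<integral>x. real_var \<mu> (\<lambda>z. f (x(k := z))) \<partial>?P)"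
      by (intro nn_integral_eq_integral P.integrable_bounded[where C = "C\<^sup>2"] real_var_slice_measurable k f)
        (use slice(2,3)[OF k] in \<open>auto simp: abs_of_nonneg\<close>)
    finally show ?thesis .
  qed
  then have "(\<Sum>k\<in>I. \<integral>\<^sup>+x. Var \<mu> (\<lambda>z. f (x(k := z))) \<partial>?P) = ennreal (\<Sum>k\<in>I. \<integral>x. real_var \<mu> (\<lambda>z. f (x(k := z))) \<partial>?P)"
    by (simp add: integral_nonneg_AE slice(2))
  moreover have "Var ?P f = ennreal (real_var ?P f)" by (rule P.real_var_eq(2)[OF f b])
  ultimately show ?thesis using efron_stein_real[OF I f b] by (simp add: ennreal_leI)
qed

end

section \<open>Product measures and Lebesgue measure in charts\<close>

lemma prod_Basis_vec:
  fixes g :: "'e::euclidean_space^'n::finite \<Rightarrow> 'c::comm_monoid_mult"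
  shows "(\<Prod>b\<in>Basis. g b) = (\<Prod>k\<in>UNIV. \<Prod>u\<in>Basis. g (axis k u))"
proof -
  have eq: "(Basis :: ('e^'n) set) = (\<lambda>(k, u). axis k u) ` (UNIV \<times> Basis)"
    by (auto simp: Basis_vec_def)
  have inj: "inj_on (\<lambda>(k, u). axis k u :: 'e^'n) (UNIV \<times> Basis)"
    by (auto simp: inj_on_def axis_eq_axis)
  have "(\<Prod>b\<in>Basis. g b) = prod (g \<circ> (\<lambda>(k, u). axis k u)) (UNIV \<times> Basis)"
    unfolding eq by (rule prod.reindex[OF inj])
  also have "\<dots> = (\<Prod>k\<in>UNIV. \<Prod>u\<in>Basis. g (axis k u))"
    unfolding prod.cartesian_product by (simp add: split_def o_def)
  finally show ?thesis .
qed

lemma mem_box_vec: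
  fixes l u x :: "'e::euclidean_space^'n::finite"
  shows "x \<in> box l u \<longleftrightarrow> (\<forall>k. x $ k \<in> box (l $ k) (u $ k))"
proof -
  have ball: "(\<forall>b\<in>(Basis :: ('e^'n) set). Q b) \<longleftrightarrow> (\<forall>k. \<forall>v\<in>Basis. Q (axis k v))" for Q
    unfolding Basis_vec_def by auto
  show ?thesis
    unfolding mem_box(1) ball inner_axis ..
qed

lemma measurable_vec_lambda_PiM:
  "(\<lambda>x :: 'n::finite \<Rightarrow> 'e::euclidean_space. \<chi> k. x k) \<in> borel_measurable (\<Pi>\<^sub>M k\<in>UNIV. lborel)"
proof (subst borel_measurable_euclidean_space, rule ballI)
  fix b :: "'e^'n" assume "b \<in> Basis"
  then obtain k u where b: "b = axis k u" unfolding Basis_vec_def by blast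
  show "(\<lambda>x :: 'n \<Rightarrow> 'e. (\<chi> k. x k) \<bullet> b) \<in> borel_measurable (\<Pi>\<^sub>M k\<in>UNIV. lborel)"
    unfolding b inner_axis vec_lambda_beta
    using measurable_component_singleton[of k UNIV "\<lambda>_. lborel :: 'e measure"] by (intro borel_measurable_inner) auto
qed

text \<open>Lebesgue measure is determined by its values on boxes. A box in the power is a product
  of boxes, and its volume is the product of their volumes, since the basis consists of the axis
  vectors.\<close>

lemma lborel_vec_eq_PiM:
  "(lborel :: ('e::euclidean_space^'n::finite) measure) = distr (\<Pi>\<^sub>M k\<in>UNIV. lborel) borel (\<lambda>x. \<chi> k. x k)"
proof (rule lborel_eqI)
  interpret product_sigma_finite "\<lambda>_ :: 'n. lborel :: 'e measure" by unfold_locales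
  fix l u :: "'e^'n" assume le: "\<And>b. b \<in> Basis \<Longrightarrow> l \<bullet> b \<le> u \<bullet> b"
  have le': "l $ k \<bullet> v \<le> u $ k \<bullet> v" if "v \<in> Basis" for k v
    using le[of "axis k v"] that by (simp add: inner_axis axis_in_Basis_iff)
  have "emeasure (distr (\<Pi>\<^sub>M k\<in>UNIV. lborel) borel (\<lambda>x. \<chi> k. x k)) (box l u) =
      emeasure (\<Pi>\<^sub>M k\<in>UNIV. lborel) (\<Pi>\<^sub>E k\<in>UNIV. box (l $ k) (u $ k))"
    by (subst emeasure_distr[OF measurable_vec_lambda_PiM])
      (auto intro!: arg_cong[where f = "emeasure _"] simp: mem_box_vec space_PiM PiE_iff)
  also have "\<dots> = (\<Prod>k\<in>UNIV. emeasure lborel (box (l $ k) (u $ k)))"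
    by (rule emeasure_PiM) auto
  also have "\<dots> = (\<Prod>k\<in>UNIV. ennreal (\<Prod>v\<in>Basis. (u $ k - l $ k) \<bullet> v))"
    using le' by (simp add: emeasure_lborel_box_eq)
  also have "\<dots> = ennreal (\<Prod>k\<in>UNIV. \<Prod>v\<in>Basis. (u $ k - l $ k) \<bullet> v)"
    using le' by (intro prod_ennreal prod_nonneg) (auto simp: inner_diff_left)
  also have "(\<Prod>k\<in>UNIV. \<Prod>v\<in>Basis. (u $ k - l $ k) \<bullet> v) = (\<Prod>b\<in>Basis. (u - l) \<bullet> b)"
    by (subst prod_Basis_vec) (simp add: inner_axis)
  finally show "emeasure (distr (\<Pi>\<^sub>M k\<in>UNIV. lborel) borel (\<lambda>x. \<chi> k. x k)) (box l u) = (\<Prod>b\<in>Basis. (u - l) \<bullet> b)" .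
qed simp

lemma indicator_PiE_UNIV:
  fixes A :: "'n::finite \<Rightarrow> 'a set"
  shows "indicator (\<Pi>\<^sub>E k\<in>UNIV. A k) x = (\<Prod>k\<in>UNIV. indicator (A k) (x k) :: ennreal)"
proof (cases "x \<in> (\<Pi>\<^sub>E k\<in>UNIV. A k)")
  case False
  then obtain k where "x k \<notin> A k" by auto
  then have "(\<Prod>k\<in>UNIV. indicator (A k) (x k) :: ennreal) = 0"
    by (intro prod_zero) (auto simp: indicator_def)
  with False show ?thesis by simp
qed (auto simp: PiE_iff)

text \<open>Both sides agree on measurable rectangles by Tonelli's formula for products. Finiteness
  of the factors provides the sigma-finiteness under which rectangles determine the product
  measure.\<close>

lemma density_PiM_lborel:
  fixes h :: "'n::finite \<Rightarrow> 'e::euclidean_space \<Rightarrow> ennreal"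
  assumes h[measurable]: "\<And>k. h k \<in> borel_measurable borel" and fin: "\<And>k. finite_measure (density lborel (h k))"
  shows "(\<Pi>\<^sub>M k\<in>UNIV. density lborel (h k)) = density (\<Pi>\<^sub>M k\<in>UNIV. lborel) (\<lambda>x. \<Prod>k\<in>UNIV. h k (x k))"
proof -
  interpret L: product_sigma_finite "\<lambda>_ :: 'n. lborel :: 'e measure" by unfold_locales
  interpret N: product_sigma_finite "\<lambda>k. density lborel (h k)"
    using fin by (simp add: product_sigma_finite_def finite_measure_def)
  have "density (\<Pi>\<^sub>M k\<in>UNIV. lborel) (\<lambda>x. \<Prod>k\<in>UNIV. h k (x k)) = (\<Pi>\<^sub>M k\<in>UNIV. density lborel (h k))"
  proof (rule N.PiM_eqI)
    show "sets (density (\<Pi>\<^sub>M k\<in>UNIV. lborel) (\<lambda>x. \<Prod>k\<in>UNIV. h k (x k))) = sets (\<Pi>\<^sub>M k\<in>UNIV. density lborel (h k))"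
      by (simp cong: sets_PiM_cong)
    fix A assume "\<And>k. k \<in> UNIV \<Longrightarrow> A k \<in> sets (density lborel (h k))"
    then have A[measurable]: "A k \<in> sets borel" for k by simp
    have "emeasure (density (\<Pi>\<^sub>M k\<in>UNIV. lborel) (\<lambda>x. \<Prod>k\<in>UNIV. h k (x k))) (Pi\<^sub>E UNIV A) =
        (\<integral>\<^sup>+x. (\<Prod>k\<in>UNIV. h k (x k) * indicator (A k) (x k)) \<partial>(\<Pi>\<^sub>M k\<in>UNIV. lborel))"
      by (subst emeasure_density) (auto simp: indicator_PiE_UNIV prod.distrib intro!: sets_PiM_I_finite)
    also have "\<dots> = (\<Prod>k\<in>UNIV. \<integral>\<^sup>+x. h k x * indicator (A k) x \<partial>lborel)"
      by (rule L.product_nn_integral_prod) auto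
    also have "\<dots> = (\<Prod>k\<in>UNIV. emeasure (density lborel (h k)) (A k))"
      by (simp add: emeasure_density)
    finally show "emeasure (density (\<Pi>\<^sub>M k\<in>UNIV. lborel) (\<lambda>x. \<Prod>k\<in>UNIV. h k (x k))) (Pi\<^sub>E UNIV A) =
        (\<Prod>k\<in>UNIV. emeasure (density lborel (h k)) (A k))" .
  qed simp
  then show ?thesis by simp
qed

text \<open>\<open>\<nu> k\<close> is the part of \<open>\<mu>\<close> on \<open>Dm k\<close>,
  transported to coordinates. By assumption it is absolutely continuous, so it has a Lebesgue
  density; the product of these densities is a density of the product of the \<open>\<nu> k\<close>,
  which therefore ignores Lebesgue null sets of the power space.\<close>

lemma AE_power_chart:
  fixes \<mu> :: "'a measure" and \<phi> :: "'n::finite \<Rightarrow> 'a \<Rightarrow> 'e::euclidean_space"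
  assumes prob: "prob_space \<mu>" and Dm[measurable]: "\<And>k. Dm k \<in> sets \<mu>" and \<phi>[measurable]: "\<And>k. \<phi> k \<in> borel_measurable \<mu>"
    and null: "\<And>k A. A \<in> null_sets lborel \<Longrightarrow> emeasure \<mu> {x \<in> Dm k. \<phi> k x \<in> A} = 0"
    and ae: "AE \<xi> in lborel. P \<xi>"
  shows "AE x in (\<Pi>\<^sub>M k\<in>UNIV. \<mu>). (\<forall>k. x k \<in> Dm k) \<longrightarrow> P (\<chi> k. \<phi> k (x k))"
proof -
  interpret prob_space \<mu> by (rule prob)
  interpret PP: product_prob_space "\<lambda>_ :: 'n. \<mu>" by unfold_locales
  define \<nu> where "\<nu> k = distr (density \<mu> (indicator (Dm k))) lborel (\<phi> k)" for k
  have \<phi>': "\<phi> k \<in> measurable (density \<mu> (indicator (Dm k))) lborel" for k by simp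
  have \<nu>: "emeasure (\<nu> k) A = (\<integral>\<^sup>+x. indicator (Dm k) x * indicator A (\<phi> k x) \<partial>\<mu>)" if [measurable]: "A \<in> sets borel" for k A
    unfolding \<nu>_def
    by (subst emeasure_distr[OF \<phi>'], simp, subst emeasure_density) (auto simp: indicator_def intro!: nn_integral_cong)
  have fin: "finite_measure (\<nu> k)" for k
  proof
    have "emeasure (\<nu> k) UNIV \<le> (\<integral>\<^sup>+x. 1 \<partial>\<mu>)"
      by (subst \<nu>, simp, intro nn_integral_mono) (simp add: indicator_def)
    then show "emeasure (\<nu> k) (space (\<nu> k)) \<noteq> \<infinity>"
      by (auto simp: \<nu>_def emeasure_space_1 top_unique)
  qed
  have ac: "absolutely_continuous lborel (\<nu> k)" for k
    unfolding absolutely_continuous_def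
  proof
    fix A :: "'e set" assume A: "A \<in> null_sets lborel"
    then have [measurable]: "A \<in> sets borel" by auto
    have "emeasure (\<nu> k) A = (\<integral>\<^sup>+x. indicator {x \<in> Dm k. \<phi> k x \<in> A} x \<partial>\<mu>)"
      unfolding \<nu>[OF \<open>A \<in> sets borel\<close>] by (rule nn_integral_cong) (simp add: indicator_def)
    also have "\<dots> = emeasure \<mu> {x \<in> Dm k. \<phi> k x \<in> A}"
    proof (rule nn_integral_indicator)
      have "{x \<in> Dm k. \<phi> k x \<in> A} = Dm k \<inter> (\<phi> k -` A \<inter> space \<mu>)"
        using sets.sets_into_space[OF Dm[of k]] by auto
      then show "{x \<in> Dm k. \<phi> k x \<in> A} \<in> sets \<mu>" by simp
    qed
    finally show "A \<in> null_sets (\<nu> k)" using null[OF A] by (auto simp: \<nu>_def)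
  qed
  have "\<exists>h. h \<in> borel_measurable borel \<and> density lborel h = \<nu> k" for k
    using sigma_finite_measure.Radon_Nikodym[OF sigma_finite_lborel ac[of k]] by (auto simp: \<nu>_def)
  then obtain h where h: "\<And>k. h k \<in> borel_measurable borel" "\<And>k. density lborel (h k) = \<nu> k"
    by metis
  have PiM_\<nu>: "(\<Pi>\<^sub>M k\<in>UNIV. \<nu> k) = density (\<Pi>\<^sub>M k\<in>UNIV. lborel) (\<lambda>x. \<Prod>k\<in>UNIV. h k (x k))"
    unfolding h(2)[symmetric] by (rule density_PiM_lborel) (simp_all add: h fin)
  interpret N: product_sigma_finite \<nu>
    using fin by (simp add: product_sigma_finite_def finite_measure_def)
  let ?P = "\<Pi>\<^sub>M k\<in>(UNIV :: 'n set). \<mu>"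
  let ?T = "\<lambda>x k. \<phi> k (x k)"
  have T[measurable]: "?T \<in> measurable ?P (\<Pi>\<^sub>M k\<in>UNIV. lborel)"
    by (rule measurable_PiM_single') (auto simp: space_PiM)
  have sets_\<nu>: "sets (\<Pi>\<^sub>M k\<in>UNIV. \<nu> k) = sets (\<Pi>\<^sub>M k\<in>UNIV. (lborel :: 'e measure))"
    by (rule sets_PiM_cong) (simp_all add: \<nu>_def)
  \<comment> \<open>Restriction to the product of the domains has a product of indicators as its
    density. The integral over a rectangle therefore splits into one integral for each
    factor.\<close>
  have distr: "distr (density ?P (\<lambda>x. \<Prod>k\<in>UNIV. indicator (Dm k) (x k))) (\<Pi>\<^sub>M k\<in>UNIV. lborel) ?T = (\<Pi>\<^sub>M k\<in>UNIV. \<nu> k)"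
  proof (rule N.PiM_eqI)
    fix A assume "\<And>k. k \<in> UNIV \<Longrightarrow> A k \<in> sets (\<nu> k)"
    then have A[measurable]: "A k \<in> sets borel" for k by (simp add: \<nu>_def)
    have "emeasure (distr (density ?P (\<lambda>x. \<Prod>k\<in>UNIV. indicator (Dm k) (x k))) (\<Pi>\<^sub>M k\<in>UNIV. lborel) ?T) (Pi\<^sub>E UNIV A) =
        emeasure (density ?P (\<lambda>x. \<Prod>k\<in>UNIV. indicator (Dm k) (x k))) (?T -` (Pi\<^sub>E UNIV A) \<inter> space ?P)"
      by (subst emeasure_distr) (auto intro!: sets_PiM_I_finite)
    also have "\<dots> = (\<integral>\<^sup>+x. (\<Prod>k\<in>UNIV. indicator (Dm k) (x k) * indicator (A k) (\<phi> k (x k))) \<partial>?P)"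
    proof (subst emeasure_density)
      show "?T -` (Pi\<^sub>E UNIV A) \<inter> space ?P \<in> sets ?P"
        by (rule measurable_sets[OF T]) (auto intro!: sets_PiM_I_finite)
      show "(\<integral>\<^sup>+x. (\<Prod>k\<in>UNIV. indicator (Dm k) (x k)) * indicator (?T -` (Pi\<^sub>E UNIV A) \<inter> space ?P) x \<partial>?P) =
          (\<integral>\<^sup>+x. (\<Prod>k\<in>UNIV. indicator (Dm k) (x k) * indicator (A k) (\<phi> k (x k))) \<partial>?P)"
      proof (rule nn_integral_cong)
        fix x assume "x \<in> space ?P"
        then have "indicator (?T -` (Pi\<^sub>E UNIV A) \<inter> space ?P) x = (indicator (\<Pi>\<^sub>E k\<in>UNIV. A k) (?T x) :: ennreal)"
          by (simp add: indicator_def)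
        then show "(\<Prod>k\<in>UNIV. indicator (Dm k) (x k)) * indicator (?T -` (Pi\<^sub>E UNIV A) \<inter> space ?P) x =
            (\<Prod>k\<in>UNIV. indicator (Dm k) (x k) * indicator (A k) (\<phi> k (x k)) :: ennreal)"
          by (simp only: indicator_PiE_UNIV prod.distrib)
      qed
    qed measurable
    also have "\<dots> = (\<Prod>k\<in>UNIV. \<integral>\<^sup>+x. indicator (Dm k) x * indicator (A k) (\<phi> k x) \<partial>\<mu>)"
      by (rule PP.product_nn_integral_prod) auto
    also have "\<dots> = (\<Prod>k\<in>UNIV. emeasure (\<nu> k) (A k))"
      by (simp add: \<nu>)
    finally show "emeasure (distr (density ?P (\<lambda>x. \<Prod>k\<in>UNIV. indicator (Dm k) (x k))) (\<Pi>\<^sub>M k\<in>UNIV. lborel) ?T) (Pi\<^sub>E UNIV A) =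
        (\<Prod>k\<in>UNIV. emeasure (\<nu> k) (A k))" .
  qed (simp_all add: sets_\<nu>)
  \<comment> \<open>The exceptional set of \<open>P\<close> need not be measurable. A Borel null set
    \<open>N\<close> containing it can be moved through densities and image measures.\<close>
  from ae obtain N where N: "N \<in> null_sets lborel" "{\<xi>. \<not> P \<xi>} \<subseteq> N"
    by (auto elim!: AE_E simp: null_sets_def)
  then have [measurable]: "N \<in> sets borel" by auto
  note [measurable] = measurable_vec_lambda_PiM[where 'e = 'e and 'n = 'n]
  have "AE \<xi> in lborel. \<xi> \<notin> N" by (rule AE_not_in[OF N(1)])
  then have "AE x in (\<Pi>\<^sub>M k\<in>(UNIV :: 'n set). lborel). (\<chi> k. x k) \<notin> N"
    by (subst (asm) lborel_vec_eq_PiM) (subst (asm) AE_distr_iff, auto)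
  then have "AE x in (\<Pi>\<^sub>M k\<in>UNIV. \<nu> k). (\<chi> k. x k) \<notin> N"
    unfolding PiM_\<nu> using h(1) by (subst AE_density) (auto elim: eventually_mono)
  then have "AE x in density ?P (\<lambda>x. \<Prod>k\<in>UNIV. indicator (Dm k) (x k)). (\<chi> k. \<phi> k (x k)) \<notin> N"
    unfolding distr[symmetric] by (subst (asm) AE_distr_iff) auto
  then have "AE x in ?P. 0 < (\<Prod>k\<in>UNIV. indicator (Dm k) (x k) :: ennreal) \<longrightarrow> (\<chi> k. \<phi> k (x k)) \<notin> N"
    by (subst (asm) AE_density) auto
  then show ?thesis
    by eventually_elim (use N(2) in \<open>auto simp: subset_iff\<close>)
qed

section \<open>Null sets of the Riemannian volume, and gluing the comparison over charts\<close>

context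
  fixes M :: "('i, 'a::{second_countable_topology, t2_space}, real^'m) riemannian"
  assumes manifold: "riemannian_manifold M"
begin

lemma param_measurable:
  assumes "c \<in> charts M"
  shows "param M c \<in> measurable (restrict_space lborel (chart_im M c)) borel"
proof -
  have "param M c \<in> measurable (restrict_space borel (chart_im M c)) borel"
    by (rule borel_measurable_continuous_on_restrict[OF continuous_param[OF manifold assms]])
  then show ?thesis
    by (subst measurable_cong_sets[OF sets_restrict_space_cong[OF sets_lborel] refl])
qed

lemma volume_density_measurable:
  assumes "c \<in> charts M"
  shows "(\<lambda>x. ennreal (volume_density M c (param M c x))) \<in> borel_measurable (restrict_space lborel (chart_im M c))"
proof -
  have "(\<lambda>x. metric M c (param M c x) u v) \<in> borel_measurable (restrict_space lborel (chart_im M c))" for u v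
    by (subst measurable_cong_sets[OF sets_restrict_space_cong[OF sets_lborel] refl])
      (rule borel_measurable_continuous_on_restrict[OF metric_continuous[OF manifold assms]])
  then show ?thesis
    unfolding volume_density_def det_def by simp
qed

lemma null_in_coordinates_measurable:
  assumes c: "c \<in> charts M" and A: "A \<in> sets borel"
  shows "{p \<in> chart_dom M c. coord M c p \<in> A} \<in> sets borel"
proof -
  have "coord M c \<in> measurable (restrict_space borel (chart_dom M c)) borel"
    by (rule borel_measurable_continuous_on_restrict[OF continuous_coord[OF manifold c]])
  from measurable_sets[OF this A] have "coord M c -` A \<inter> chart_dom M c \<in> sets (restrict_space borel (chart_dom M c))"
    by (simp add: space_restrict_space)
  then have "coord M c -` A \<inter> chart_dom M c \<in> sets borel"
    using open_chart_dom[OF manifold c] by (simp add: sets_restrict_space_iff)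
  then show ?thesis by (simp add: vimage_def Int_def conj_commute)
qed

text \<open>Differentiable maps between spaces of the same dimension preserve null sets. The
  transition from \<open>c\<close> to \<open>d\<close> thus makes the set null in the coordinates of
  \<open>d\<close> too, and \<open>chart_volume M d\<close> has a density there.\<close>

lemma chart_volume_null:
  assumes c: "c \<in> charts M" and d: "d \<in> charts M" and A: "A \<in> null_sets lborel"
  shows "emeasure (chart_volume M d) {p \<in> chart_dom M c. coord M c p \<in> A} = 0"
proof -
  define Z where "Z = {p \<in> chart_dom M c. coord M c p \<in> A}"
  let ?R = "restrict_space lborel (chart_im M d)"
  have Z: "Z \<in> sets borel" unfolding Z_def by (rule null_in_coordinates_measurable[OF c]) (use A in auto)
  have im: "chart_im M d \<inter> space lborel \<in> sets lborel" using open_chart_im[OF manifold d] by simp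
  define W where "W = param M d -` Z \<inter> chart_im M d"
  have Wm: "W \<in> sets ?R"
    using measurable_sets[OF param_measurable[OF d] Z] by (simp add: W_def space_restrict_space)
  then have Wb: "W \<in> sets borel" using im by (simp add: sets_restrict_space_iff)
  define T where "T = A \<inter> coord M c ` (chart_dom M c \<inter> chart_dom M d)"
  have "W \<subseteq> transition M c d ` T"
  proof
    fix x assume x: "x \<in> W"
    define p where "p = param M d x"
    have p: "p \<in> chart_dom M c" "coord M c p \<in> A" "p \<in> chart_dom M d" "coord M d p = x"
      using x param_in[OF manifold d] coord_param[OF manifold d] by (auto simp: W_def Z_def p_def)
    have "x = transition M c d (coord M c p)"
      using p param_coord[OF manifold c p(1)] by (simp add: transition_def)
    then show "x \<in> transition M c d ` T" using p by (auto simp: T_def)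
  qed
  moreover have "negligible (transition M c d ` T)"
  proof (rule negligible_differentiable_image_negligible[OF order_refl])
    have "A \<in> null_sets lebesgue" using A by (rule null_sets_completionI)
    then show "negligible T"
      unfolding negligible_iff_null_sets[symmetric] T_def by (rule negligible_subset) auto
    show "transition M c d differentiable_on T"
    proof (rule differentiable_at_imp_differentiable_on)
      fix x assume "x \<in> T"
      then obtain p where "p \<in> chart_dom M c" "p \<in> chart_dom M d" "x = coord M c p" by (auto simp: T_def)
      then show "transition M c d differentiable (at x)"
        using transition_differentiable[OF manifold c d coord_in[OF manifold c]] param_coord[OF manifold c] by simp
    qed
  qed
  ultimately have "negligible W" by (rule negligible_subset[rotated])
  then have "W \<in> null_sets lborel"
    using Wb by (simp add: negligible_iff_null_sets null_sets_completion_iff)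
  then have null: "W \<in> null_sets ?R"
    using Wm im by (auto simp: null_sets_def emeasure_restrict_space W_def)
  have "emeasure (chart_volume M d) Z =
      emeasure (density ?R (\<lambda>x. ennreal (volume_density M d (param M d x)))) W"
    unfolding chart_volume_def W_def
    by (subst emeasure_distr) (use param_measurable[OF d] Z in \<open>auto simp: space_restrict_space\<close>)
  also have "\<dots> = (\<integral>\<^sup>+x. ennreal (volume_density M d (param M d x)) * indicator W x \<partial>?R)"
    by (rule emeasure_density[OF volume_density_measurable[OF d] Wm])
  also have "\<dots> = 0"
    by (rule nn_integral_null_set[OF null])
  finally show ?thesis by (simp add: Z_def)
qed

text \<open>The supremum defining the volume stays below the restriction of the volume to the complement
  of a set that is null for each of the measures in the supremum.\<close>

lemma riemannian_volume_null:
  assumes c: "c \<in> charts M" and A: "A \<in> null_sets lborel"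
  shows "{p \<in> chart_dom M c. coord M c p \<in> A} \<in> null_sets (riemannian_volume M)"
proof -
  define Z where "Z = {p \<in> chart_dom M c. coord M c p \<in> A}"
  have Z[measurable]: "Z \<in> sets borel" unfolding Z_def by (rule null_in_coordinates_measurable[OF c]) (use A in auto)
  have sets_chart: "sets (chart_volume M d) = sets borel" for d by (simp add: chart_volume_def)
  have sets_vol: "sets (riemannian_volume M) = sets borel"
    unfolding riemannian_volume_def by (rule sets_SUP) (use sets_chart c in auto)
  let ?V = "density (riemannian_volume M) (indicator (- Z))"
  have V: "emeasure ?V X = emeasure (riemannian_volume M) (X - Z)" if X: "X \<in> sets borel" for X
  proof -
    have [measurable]: "indicator (- Z) \<in> borel_measurable (riemannian_volume M)"
      using sets_vol Z by (intro borel_measurable_indicator) auto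
    have "emeasure ?V X = (\<integral>\<^sup>+x. indicator (- Z) x * indicator X x \<partial>riemannian_volume M)"
      by (rule emeasure_density) (use X sets_vol in auto)
    also have "\<dots> = (\<integral>\<^sup>+x. indicator (X - Z) x \<partial>riemannian_volume M)"
      by (rule nn_integral_cong) (auto simp: indicator_def)
    also have "\<dots> = emeasure (riemannian_volume M) (X - Z)"
      by (rule nn_integral_indicator) (use X Z sets_vol in auto)
    finally show ?thesis .
  qed
  have "(SUP d\<in>charts M. chart_volume M d) \<le> ?V"
  proof (rule SUP_least)
    fix d assume d: "d \<in> charts M"
    show "chart_volume M d \<le> ?V"
    proof (subst le_measure)
      show "sets (chart_volume M d) = sets ?V" using sets_chart sets_vol by simp
      show "\<forall>X\<in>sets (chart_volume M d). emeasure (chart_volume M d) X \<le> emeasure ?V X"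
      proof
        fix X assume "X \<in> sets (chart_volume M d)"
        then have X: "X \<in> sets borel" by (simp add: sets_chart)
        have "emeasure (chart_volume M d) X \<le> emeasure (chart_volume M d) ((X - Z) \<union> Z)"
          by (rule emeasure_mono) (use X Z sets_chart in auto)
        also have "\<dots> \<le> emeasure (chart_volume M d) (X - Z) + emeasure (chart_volume M d) Z"
          by (rule emeasure_subadditive) (use X Z sets_chart in auto)
        also have "\<dots> = emeasure (chart_volume M d) (X - Z)"
          using chart_volume_null[OF c d A] by (simp add: Z_def)
        also have "\<dots> \<le> emeasure (riemannian_volume M) (X - Z)"
          unfolding riemannian_volume_def
          by (rule le_measureD3[OF SUP_upper[OF d]]) (use sets_chart sets_vol in \<open>simp add: riemannian_volume_def\<close>)
        finally show "emeasure (chart_volume M d) X \<le> emeasure ?V X" by (simp add: V[OF X])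
      qed
    qed
  qed
  then have "riemannian_volume M \<le> ?V"
    by (simp only: riemannian_volume_def[symmetric])
  then have "emeasure (riemannian_volume M) Z \<le> emeasure ?V Z"
    by (rule le_measureD3) simp
  also have "\<dots> = 0" by (simp add: V[OF Z])
  finally show ?thesis using Z sets_vol by (auto simp: Z_def[symmetric] null_sets_def)
qed

text \<open>Second countability leaves countably many charts, hence countably many families of
  charts, each with its own Borel functions \<open>H c\<close>. That these agree on overlaps never
  has to be shown: their infimum stays above the partial slopes because each of them does, and below
  the full slope because one of them does.\<close>

lemma AE_gradient_comparison:
  fixes f :: "('n::finite \<Rightarrow> 'a) \<Rightarrow> real"
  assumes prob: "prob_space \<mu>" and sets: "sets \<mu> = sets borel"
    and ac: "absolutely_continuous (riemannian_volume M) \<mu>"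
    and ll: "locally_lipschitz (riemannian_power M) f"
  obtains G :: "'n \<Rightarrow> ('n \<Rightarrow> 'a) \<Rightarrow> ennreal" where "\<And>k. G k \<in> borel_measurable (\<Pi>\<^sub>M k\<in>UNIV. \<mu>)"
    "AE x in (\<Pi>\<^sub>M k\<in>UNIV. \<mu>). separates_gradients M f x (\<lambda>k. G k x)"
proof -
  let ?P = "\<Pi>\<^sub>M k\<in>(UNIV :: 'n set). \<mu>"
  obtain C where C: "C \<subseteq> charts M" "countable C" "(\<Union>c\<in>C. chart_dom M c) = UNIV"
  proof (rule Lindelof_image[of "charts M" "chart_dom M"])
    show "open (chart_dom M c)" if "c \<in> charts M" for c by (rule open_chart_dom[OF manifold that])
    have "(\<Union>c\<in>charts M. chart_dom M c) = UNIV" using chart_exists[OF manifold] by blast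
    then show thesis if "T \<subseteq> charts M" "countable T" "(\<Union>c\<in>T. chart_dom M c) = (\<Union>c\<in>charts M. chart_dom M c)" for T
      using \<open>\<And>C. C \<subseteq> charts M \<Longrightarrow> countable C \<Longrightarrow> (\<Union>c\<in>C. chart_dom M c) = UNIV \<Longrightarrow> thesis\<close> that by simp
  qed
  define Fam where "Fam = {c :: 'n \<Rightarrow> 'i. \<forall>k. c k \<in> C}"
  have "Fam = (\<Pi>\<^sub>E k\<in>UNIV. C)" by (auto simp: Fam_def PiE_iff)
  then have countable: "countable Fam" using C(2) by (simp add: countable_PiE)
  have charts: "c k \<in> charts M" if "c \<in> Fam" for c k using that C(1) by (auto simp: Fam_def)
  define good where "good c H \<longleftrightarrow> (\<forall>k. H k \<in> borel_measurable borel) \<and>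
    (AE \<xi> in lborel. \<forall>x. (\<forall>k. x k \<in> chart_dom M (c k)) \<and> \<xi> = (\<chi> k. coord M (c k) (x k)) \<longrightarrow>
      separates_gradients M f x (\<lambda>k. H k \<xi>))"
    for c and H :: "'n \<Rightarrow> (real^'m)^'n \<Rightarrow> ennreal"
  have "\<exists>H. good c H" if "c \<in> Fam" for c
  proof (rule chart_gradient_comparison[where c = c, OF manifold _ ll])
    show "c k \<in> charts M" for k by (rule charts[OF that])
  qed (unfold good_def, blast)
  then obtain H where H: "\<And>c. c \<in> Fam \<Longrightarrow> good c (H c)" by metis
  \<comment> \<open>Coordinates extended by 0 outside the chart domain, to be Borel on all of
    \<open>M\<close>.\<close>
  define \<phi> where "\<phi> c p = indicator (chart_dom M c) p *\<^sub>R coord M c p" for c p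
  have \<phi>: "\<phi> c \<in> borel_measurable \<mu>" if "c \<in> charts M" for c
    unfolding measurable_cong_sets[OF sets refl] \<phi>_def
    using open_chart_dom[OF manifold that] continuous_coord[OF manifold that]
    by (intro borel_measurable_continuous_on_indicator) auto
  have dom: "chart_dom M c \<in> sets \<mu>" if "c \<in> charts M" for c
    using open_chart_dom[OF manifold that] by (simp add: sets)
  define D where "D c = (\<Pi>\<^sub>E k\<in>UNIV. chart_dom M (c k))" for c :: "'n \<Rightarrow> 'i"
  \<comment> \<open>The value \<open>top\<close> makes the infimum ignore the families whose domain
    misses \<open>x\<close>.\<close>
  define G where "G k x = (INF c\<in>Fam. if x \<in> D c then H c k (\<chi> k. \<phi> (c k) (x k)) else top)" for k x
  have G: "G k \<in> borel_measurable ?P" for k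
    unfolding G_def
  proof (rule borel_measurable_INF[OF countable])
    fix c assume c: "c \<in> Fam"
    have [measurable]: "H c k \<in> borel_measurable borel" using H[OF c] by (simp add: good_def)
    have [measurable]: "\<phi> (c k) \<in> borel_measurable \<mu>" for k by (rule \<phi>[OF charts[OF c]])
    have "(\<lambda>x k. \<phi> (c k) (x k)) \<in> measurable ?P (\<Pi>\<^sub>M k\<in>UNIV. lborel)"
      by (rule measurable_PiM_single')
        (auto simp: space_PiM)
    then have [measurable]: "(\<lambda>x. \<chi> k. \<phi> (c k) (x k)) \<in> borel_measurable ?P"
      using measurable_compose[OF _ measurable_vec_lambda_PiM] by blast
    have "D c \<in> sets ?P"
      unfolding D_def by (rule sets_PiM_I_finite) (use dom[OF charts[OF c]] in auto)
    then show "(\<lambda>x. if x \<in> D c then H c k (\<chi> k. \<phi> (c k) (x k)) else top) \<in> borel_measurable ?P"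
      by (intro measurable_If_set) auto
  qed
  have "AE x in ?P. \<forall>c\<in>Fam. x \<in> D c \<longrightarrow>
      separates_gradients M f x (\<lambda>k. H c k (\<chi> k. \<phi> (c k) (x k)))"
    unfolding AE_ball_countable[OF countable]
  proof
    fix c assume c: "c \<in> Fam"
    note cc = charts[OF c]
    have "AE x in ?P. (\<forall>k. x k \<in> chart_dom M (c k)) \<longrightarrow>
       (\<forall>x'. (\<forall>k. x' k \<in> chart_dom M (c k)) \<and> (\<chi> k. \<phi> (c k) (x k)) = (\<chi> k. coord M (c k) (x' k)) \<longrightarrow>
      separates_gradients M f x' (\<lambda>k. H c k (\<chi> k. \<phi> (c k) (x k))))"
    proof (rule AE_power_chart[where Dm = "\<lambda>k. chart_dom M (c k)" and \<phi> = "\<lambda>k. \<phi> (c k)", OF prob dom[OF cc] \<phi>[OF cc]])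
      fix k and A :: "(real^'m) set" assume A: "A \<in> null_sets lborel"
      have "{x \<in> chart_dom M (c k). \<phi> (c k) x \<in> A} = {p \<in> chart_dom M (c k). coord M (c k) p \<in> A}"
        by (auto simp: \<phi>_def)
      then show "emeasure \<mu> {x \<in> chart_dom M (c k). \<phi> (c k) x \<in> A} = 0"
        using riemannian_volume_null[OF cc A] ac unfolding absolutely_continuous_def by (auto simp: null_sets_def)
    qed (rule conjunct2[OF H[OF c, unfolded good_def]])
    then show "AE x in ?P. x \<in> D c \<longrightarrow>
      separates_gradients M f x (\<lambda>k. H c k (\<chi> k. \<phi> (c k) (x k)))"
    proof eventually_elim
      case (elim x)
      show ?case
      proof
        assume "x \<in> D c"
        then have x: "\<forall>k. x k \<in> chart_dom M (c k)" by (simp add: D_def PiE_iff)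
        then have "(\<chi> k. \<phi> (c k) (x k)) = (\<chi> k. coord M (c k) (x k))" by (simp add: \<phi>_def)
        then show "separates_gradients M f x (\<lambda>k. H c k (\<chi> k. \<phi> (c k) (x k)))"
          using elim x by blast
      qed
    qed
  qed
  then have "AE x in ?P. separates_gradients M f x (\<lambda>k. G k x)"
  proof eventually_elim
    case (elim x)
    have "\<forall>k. \<exists>c. c \<in> C \<and> x k \<in> chart_dom M c" using C(3) by blast
    then obtain c where c: "\<And>k. c k \<in> C" "\<And>k. x k \<in> chart_dom M (c k)" by metis
    then have cF: "c \<in> Fam" "x \<in> D c" by (auto simp: Fam_def D_def PiE_iff)
    have "G k x \<le> H c k (\<chi> k. \<phi> (c k) (x k))" for k
      unfolding G_def by (rule INF_lower2[OF cF(1)]) (simp add: cF(2))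
    then have "(\<Sum>k\<in>UNIV. G k x) \<le> (\<Sum>k\<in>UNIV. H c k (\<chi> k. \<phi> (c k) (x k)))"
      by (rule sum_mono)
    also have "\<dots> \<le> (grad_norm (riemannian_power M) f x)\<^sup>2" using elim cF by (auto simp: separates_gradients_def)
    finally have "(\<Sum>k\<in>UNIV. G k x) \<le> (grad_norm (riemannian_power M) f x)\<^sup>2" .
    moreover have "(grad_norm M (\<lambda>y. f (x(k := y))) (x k))\<^sup>2 \<le> G k x" for k
      unfolding G_def by (rule INF_greatest) (use elim in \<open>auto simp: separates_gradients_def\<close>)
    ultimately show ?case by (simp add: separates_gradients_def)
  qed
  with G show thesis by (rule that)
qed

end

text \<open>The preimage of a rectangle is a rectangle with full side at \<open>k\<close>, of
  measure 1, times \<open>A k\<close>. This invariance turns facts about almost every point of the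
  power, and integrals over it, into facts and integrals along slices.\<close>

lemma distr_fun_upd_PiM:
  fixes \<mu> :: "'a measure" and k :: "'n::finite"
  assumes prob: "prob_space \<mu>"
  shows "distr ((\<Pi>\<^sub>M k\<in>UNIV. \<mu>) \<Otimes>\<^sub>M \<mu>) (\<Pi>\<^sub>M k\<in>UNIV. \<mu>) (\<lambda>(x, z). x(k := z)) = (\<Pi>\<^sub>M k\<in>UNIV. \<mu>)"
proof -
  interpret prob_space \<mu> by (rule prob)
  interpret PP: product_prob_space "\<lambda>_ :: 'n. \<mu>" by unfold_locales
  let ?P = "\<Pi>\<^sub>M k\<in>(UNIV :: 'n set). \<mu>"
  note T = measurable_fun_upd_pair[OF prob, of k UNIV]
  show ?thesis
  proof (rule PP.PiM_eqI)
    fix A assume A: "\<And>j. j \<in> (UNIV :: 'n set) \<Longrightarrow> A j \<in> sets \<mu>"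
    let ?B = "\<Pi>\<^sub>E j\<in>UNIV. if j = k then space \<mu> else A j"
    have B: "?B \<in> sets ?P" by (rule sets_PiM_I_finite) (use A in auto)
    have "(\<lambda>(x, z). x(k := z)) -` (Pi\<^sub>E UNIV A) \<inter> space (?P \<Otimes>\<^sub>M \<mu>) = ?B \<times> A k"
    proof (rule set_eqI, clarify)
      fix x z
      have sub: "A j \<subseteq> space \<mu>" for j using A sets.sets_into_space by blast
      have "(x, z) \<in> (\<lambda>(x, z). x(k := z)) -` (Pi\<^sub>E UNIV A) \<inter> space (?P \<Otimes>\<^sub>M \<mu>) \<longleftrightarrow>
          (\<forall>j. x j \<in> space \<mu>) \<and> z \<in> space \<mu> \<and> z \<in> A k \<and> (\<forall>j. j \<noteq> k \<longrightarrow> x j \<in> A j)"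
        by (auto simp: space_pair_measure space_PiM PiE_iff split: if_splits)
      moreover have in_space: "x j \<in> space \<mu>" if "x k \<in> space \<mu>" "\<forall>j. j \<noteq> k \<longrightarrow> x j \<in> A j" for j
        using that sub[of j] by (cases "j = k") auto
      moreover have "(x, z) \<in> ?B \<times> A k \<longleftrightarrow> x k \<in> space \<mu> \<and> (\<forall>j. j \<noteq> k \<longrightarrow> x j \<in> A j) \<and> z \<in> A k"
        by (auto simp: PiE_iff)
      ultimately show "(x, z) \<in> (\<lambda>(x, z). x(k := z)) -` (Pi\<^sub>E UNIV A) \<inter> space (?P \<Otimes>\<^sub>M \<mu>) \<longleftrightarrow> (x, z) \<in> ?B \<times> A k"
        using sub[of k] in_space by blast
    qed
    then have "emeasure (distr (?P \<Otimes>\<^sub>M \<mu>) ?P (\<lambda>(x, z). x(k := z))) (Pi\<^sub>E UNIV A) = emeasure (?P \<Otimes>\<^sub>M \<mu>) (?B \<times> A k)"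
      by (subst emeasure_distr[OF T]) (use A in \<open>auto intro!: sets_PiM_I_finite\<close>)
    also have "\<dots> = emeasure ?P ?B * emeasure \<mu> (A k)"
      by (rule emeasure_pair_measure_Times[OF B]) (use A in auto)
    also have "emeasure ?P ?B = (\<Prod>j\<in>UNIV. emeasure \<mu> (if j = k then space \<mu> else A j))"
      by (rule PP.emeasure_PiM) (use A in auto)
    also have "\<dots> = (\<Prod>j\<in>UNIV - {k}. emeasure \<mu> (A j))"
      by (subst prod.remove[of _ k]) (auto simp: emeasure_space_1 intro!: prod.cong)
    also have "\<dots> * emeasure \<mu> (A k) = (\<Prod>j\<in>UNIV. emeasure \<mu> (A j))"
      by (subst (2) prod.remove[of _ k]) (auto simp: mult.commute)
    finally show "emeasure (distr (?P \<Otimes>\<^sub>M \<mu>) ?P (\<lambda>(x, z). x(k := z))) (Pi\<^sub>E UNIV A) = (\<Prod>j\<in>UNIV. emeasure \<mu> (A j))" .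
  qed simp_all
qed

lemma Osc_slice_le: "Osc (\<lambda>y. f (x(k := y))) \<le> Osc f"
  unfolding Osc_def
  by (intro e2ennreal_mono ereal_minus_mono SUP_least INF_greatest) (auto intro: SUP_upper INF_lower)

lemma Osc_finite_imp_bounded:
  assumes "Osc f \<noteq> top"
  obtains C where "\<And>x. \<bar>f x\<bar> \<le> C"
proof -
  define S where "S = (SUP x. ereal (f x))"
  define I where "I = (INF x. ereal (f x))"
  have SI: "ereal (f x) \<le> S" "I \<le> ereal (f x)" for x
    unfolding S_def I_def by (auto intro: SUP_upper INF_lower)
  have "S - I \<noteq> \<infinity>" using assms unfolding Osc_def S_def[symmetric] I_def[symmetric] by auto
  \<comment> \<open>Any real value of \<open>f\<close> lies between \<open>I\<close> and
    \<open>S\<close>, so \<open>S\<close> is not negative infinite and \<open>I\<close> not positive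
    infinite. With a finite difference, both are real.\<close>
  then obtain s i where "S = ereal s" "I = ereal i"
    using SI[of undefined] by (cases S; cases I) auto
  then have "\<bar>f x\<bar> \<le> \<bar>s\<bar> + \<bar>i\<bar>" for x using SI[of x] by auto
  then show thesis by (rule that)
qed

theorem theorem5:
  fixes M :: "('i, 'a::{second_countable_topology, t2_space}, real^'m) riemannian"
    and \<mu> :: "'a measure"
    and \<beta> :: "real \<Rightarrow> real"
  assumes "riemannian_manifold M"
    and "prob_space \<mu>" and "sets \<mu> = sets borel"
    and "absolutely_continuous (riemannian_volume M) \<mu>"
    and "\<And>s. s \<in> {0<..<1/4} \<Longrightarrow> 0 \<le> \<beta> s"
    and "antimono_on {0<..<1/4} \<beta>"
    and "\<And>(f :: 'a \<Rightarrow> real) s. locally_lipschitz M f \<Longrightarrow> s \<in> {0<..<1/4} \<Longrightarrow>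
           Var \<mu> f \<le> ennreal (\<beta> s) * (\<integral>\<^sup>+x. (grad_norm M f x)\<^sup>2 \<partial>\<mu>) + ennreal s * (Osc f)\<^sup>2"
  shows "\<forall>(f :: ('n::finite \<Rightarrow> 'a) \<Rightarrow> real) s.
           locally_lipschitz (riemannian_power M) f \<and> s \<in> {0<..<1/4} \<longrightarrow>
           Var (\<Pi>\<^sub>M k\<in>UNIV. \<mu>) f
             \<le> ennreal (\<beta> (s / real CARD('n)))
                 * (\<integral>\<^sup>+x. (grad_norm (riemannian_power M) f x)\<^sup>2 \<partial>(\<Pi>\<^sub>M k\<in>UNIV. \<mu>))
               + ennreal s * (Osc f)\<^sup>2"
proof (intro allI impI, elim conjE)
  fix f :: "('n \<Rightarrow> 'a) \<Rightarrow> real" and s :: real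
  assume ll: "locally_lipschitz (riemannian_power M) f" and s: "s \<in> {0<..<1/4}"
  let ?P = "\<Pi>\<^sub>M k\<in>(UNIV :: 'n set). \<mu>"
  let ?n = "real CARD('n)"
  interpret prob_space \<mu> by fact
  interpret P: prob_space ?P by (rule prob_space_PiM_const[OF assms(2)])
  interpret PM: pair_prob_space ?P \<mu> ..
  let ?b = "ennreal (\<beta> (s / ?n))"
  let ?K = "ennreal (s / ?n) * (Osc f)\<^sup>2"
  have n: "?n \<ge> 1" by (simp add: Suc_leI)
  have sn: "s / ?n \<in> {0<..<1/4}"
  proof -
    have "s / ?n \<le> s / 1" using s n by (intro divide_left_mono) auto
    moreover have "0 < s / ?n" using s n by simp
    moreover have "0 < s" "s < 1/4" using s by auto
    ultimately have "0 < s / ?n" "s / ?n < 1/4" by linarith+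
    then show ?thesis unfolding greaterThanLessThan_iff by (rule conjI)
  qed
  show "Var ?P f \<le> ?b * (\<integral>\<^sup>+x. (grad_norm (riemannian_power M) f x)\<^sup>2 \<partial>?P) + ennreal s * (Osc f)\<^sup>2"
  proof (cases "Osc f = top")
    \<comment> \<open>As \<open>s > 0\<close>, the oscillation term alone makes the right-hand side
      infinite.\<close>
    case True
    then have "ennreal s * (Osc f)\<^sup>2 = top" using s by (simp add: ennreal_mult_top power2_eq_square)
    then show ?thesis by simp
  next
    case False
    then obtain C where C: "\<And>x. \<bar>f x\<bar> \<le> C" by (rule Osc_finite_imp_bounded) blast
    have sets_P: "sets ?P = sets borel"
      using sets_PiM_cong[OF refl, of "UNIV :: 'n set" "\<lambda>_. \<mu>" "\<lambda>_. borel"] assms(3) by (simp add: sets_PiM_equal_borel)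
    have f: "f \<in> borel_measurable ?P"
      unfolding measurable_cong_sets[OF sets_P refl]
      by (rule borel_measurable_continuous_onI[OF locally_lipschitz_continuous[OF assms(1) ll]])
    obtain G where G[measurable]: "\<And>k. G k \<in> borel_measurable ?P"
      and AE_G: "AE x in ?P. separates_gradients M f x (\<lambda>k. G k x)"
      using AE_gradient_comparison[OF assms(1-4) ll] by blast
    have slice: "(\<integral>\<^sup>+x. Var \<mu> (\<lambda>z. f (x(k := z))) \<partial>?P) \<le> ?b * (\<integral>\<^sup>+x. G k x \<partial>?P) + ?K" for k
    proof -
      note T = measurable_fun_upd_pair[OF assms(2), of k UNIV]
      have [measurable]: "(\<lambda>(x, y). G k (x(k := y))) \<in> borel_measurable (?P \<Otimes>\<^sub>M \<mu>)"
        using measurable_compose[OF T G] by (simp add: case_prod_beta')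
      \<comment> \<open>By invariance under resampling, almost every point becomes
        \<open>x(k := y)\<close> for almost every pair of \<open>x\<close> and \<open>y\<close>. The
        slice in direction \<open>k\<close> through that point is the slice through
        \<open>x\<close>, so one function of \<open>y\<close> is compared with \<open>G k\<close>
        along the whole slice.\<close>
      have "AE x in distr (?P \<Otimes>\<^sub>M \<mu>) ?P (\<lambda>(x, z). x(k := z)). (grad_norm M (\<lambda>y. f (x(k := y))) (x k))\<^sup>2 \<le> G k x"
        unfolding distr_fun_upd_PiM[OF assms(2)] using AE_G by eventually_elim (simp add: separates_gradients_def)
      from AE_distrD[OF T this]
      have "AE p in ?P \<Otimes>\<^sub>M \<mu>. (grad_norm M (\<lambda>z. f ((fst p)(k := z))) (snd p))\<^sup>2 \<le> G k ((fst p)(k := snd p))"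
        by (simp add: case_prod_beta')
      from PM.AE_pair[OF this]
      have "AE x in ?P. AE y in \<mu>. (grad_norm M (\<lambda>z. f (x(k := z))) y)\<^sup>2 \<le> G k (x(k := y))" by simp
      then have "AE x in ?P. Var \<mu> (\<lambda>z. f (x(k := z))) \<le> ?b * (\<integral>\<^sup>+y. G k (x(k := y)) \<partial>\<mu>) + ?K"
      proof eventually_elim
        case (elim x)
        have "Var \<mu> (\<lambda>z. f (x(k := z))) \<le> ?b * (\<integral>\<^sup>+y. (grad_norm M (\<lambda>z. f (x(k := z))) y)\<^sup>2 \<partial>\<mu>)
            + ennreal (s / ?n) * (Osc (\<lambda>z. f (x(k := z))))\<^sup>2"
          by (rule assms(7)[OF slice_locally_lipschitz[OF assms(1) ll] sn])
        \<comment> \<open>From here on the slope is replaced by the Borel function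
          \<open>G k\<close>. Monotonicity of the integral needs no measurability; the additivity
          and Tonelli steps that follow do.\<close>
        also have "\<dots> \<le> ?b * (\<integral>\<^sup>+y. G k (x(k := y)) \<partial>\<mu>) + ?K"
          by (intro add_mono mult_left_mono power_mono_ennreal Osc_slice_le nn_integral_mono_AE elim) auto
        finally show ?case .
      qed
      then have "(\<integral>\<^sup>+x. Var \<mu> (\<lambda>z. f (x(k := z))) \<partial>?P) \<le> (\<integral>\<^sup>+x. ?b * (\<integral>\<^sup>+y. G k (x(k := y)) \<partial>\<mu>) + ?K \<partial>?P)"
        by (rule nn_integral_mono_AE)
      also have "\<dots> = ?b * (\<integral>\<^sup>+x. \<integral>\<^sup>+y. G k (x(k := y)) \<partial>\<mu> \<partial>?P) + ?K"
        by (subst nn_integral_add) (auto simp: nn_integral_cmult P.emeasure_space_1)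
      also have "(\<integral>\<^sup>+x. \<integral>\<^sup>+y. G k (x(k := y)) \<partial>\<mu> \<partial>?P) = (\<integral>\<^sup>+p. G k ((fst p)(k := snd p)) \<partial>(?P \<Otimes>\<^sub>M \<mu>))"
        by (subst nn_integral_fst[symmetric]) (auto simp: case_prod_beta'[symmetric])
      also have "\<dots> = (\<integral>\<^sup>+x. G k x \<partial>distr (?P \<Otimes>\<^sub>M \<mu>) ?P (\<lambda>(x, z). x(k := z)))"
        by (subst nn_integral_distr[OF T]) (auto simp: case_prod_beta')
      also have "\<dots> = (\<integral>\<^sup>+x. G k x \<partial>?P)" by (simp only: distr_fun_upd_PiM[OF assms(2)])
      finally show ?thesis .
    qed
    have "Var ?P f \<le> (\<Sum>k\<in>UNIV. \<integral>\<^sup>+x. Var \<mu> (\<lambda>z. f (x(k := z))) \<partial>?P)"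
      by (rule efron_stein[OF assms(2) finite f C])
    also have "\<dots> \<le> (\<Sum>k\<in>UNIV. ?b * (\<integral>\<^sup>+x. G k x \<partial>?P) + ?K)"
      by (rule sum_mono) (rule slice)
    also have "\<dots> = ?b * (\<integral>\<^sup>+x. (\<Sum>k\<in>UNIV. G k x) \<partial>?P) + of_nat CARD('n) * ?K"
      by (simp add: sum.distrib sum_distrib_left[symmetric] nn_integral_sum)
    \<comment> \<open>The reason for the argument \<open>s / n\<close> of \<beta>: the oscillation
      terms of the coordinates, each with weight \<open>s / n\<close>, add up to weight
      \<open>s\<close>.\<close>
    also have "of_nat CARD('n) * ?K = ennreal s * (Osc f)\<^sup>2"
    proof -
      have "ennreal ?n * ennreal (s / ?n) = ennreal s"
        using n s by (subst ennreal_mult[symmetric]) auto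
      then show ?thesis by (simp add: mult.assoc[symmetric] ennreal_of_nat_eq_real_of_nat)
    qed
    also have "?b * (\<integral>\<^sup>+x. (\<Sum>k\<in>UNIV. G k x) \<partial>?P) \<le> ?b * (\<integral>\<^sup>+x. (grad_norm (riemannian_power M) f x)\<^sup>2 \<partial>?P)"
      by (intro mult_left_mono nn_integral_mono_AE) (use AE_G in \<open>auto elim: eventually_mono simp: separates_gradients_def\<close>)
    finally show ?thesis by (simp add: add_right_mono)
  qed
qed

end
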